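(* Let $\alpha\in[1/2,1]$. For almost every $x\in(0,1)$ the sequence of pairs $\{(\bar\theta_k,\bar\theta_{k+1})\}_{k\ge1}$ is distributed in $\Lambda_\alpha$ according to the density $\lambda_\alpha$; that is, for every Borel set $B\subset\Lambda_\alpha$ whose boundary has Lebesgue measure zero, $$\lim_{n\to\infty}\frac1n\#\{j\le n: (\bar\theta_j,\bar\theta_{j+1})\in B\}=\int_B\lambda_\alpha(w,z)\,dw\,dz.$$
   Context: For irrational $x\in(0,1)$ with regular continued fraction $x=[a_1,a_2,\ldots]$ and convergents $p_n/q_n=[a_1,\ldots,a_n]$, put $\theta_n=q_n|q_nx-p_n|$. For $\alpha\in(0,1]$ let $n_1<n_2<\cdots$ be the positive integers $n$ with $\theta_n<\alpha$ and set $\bar\theta_k=\theta_{n_k}$. Let $\Lambda_\alpha=\{(w,z)\in\mathbb R^2: 0<w<\alpha,\ 0<z<\alpha,\ w+z<1\}$, $\Lambda_\alpha^-=\{(w,z)\in\Lambda_\alpha: z<w-\alpha+\sqrt{1-4\alpha w}\}$, $\Lambda_\alpha^+=\Lambda_\alpha\setminus\Lambda_\alpha^-$. Let $c_\alpha=\big(\int_{\Omega_\alpha}(x-y)^{-2}dx\,dy\big)^{-1}$ where $\Omega_\alpha=\{(x,y)\in(0,1)\times(-\infty,-1): x-y>1/\alpha\}$. Define $\lambda_\alpha(w,z)=c_\alpha(1-4wz)^{-1/2}$ on $\Lambda_\alpha^+$ and $\lambda_\alpha(w,z)=c_\alpha\big((1-4wz)^{-1/2}+(1+4wz)^{-1/2}\big)$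 on $\Lambda_\alpha^-$. *)

theory Defs
  imports "HOL-Analysis.Analysis" "HOL-Library.Infinite_Set"
begin

definition gauss_map :: "real \<Rightarrow> real" where
  "gauss_map x = frac (1 / x)"

text \<open>The partial quotient \<open>a\<^sub>n\<close> of \<open>x \<in> (0,1)\<close>, indexed from \<open>n = 1\<close>.\<close>

definition cf_digit :: "real \<Rightarrow> nat \<Rightarrow> int" where
  "cf_digit x n = \<lfloor>1 / (gauss_map ^^ (n - 1)) x\<rfloor>"

text \<open>\<open>cf_value [a\<^sub>1, \<dots>, a\<^sub>n] = 1 / (a\<^sub>1 + 1 / (a\<^sub>2 + \<dots> + 1 / a\<^sub>n))\<close>.\<close>

fun cf_value :: "int list \<Rightarrow> rat" where
  "cf_value [] = 0"
| "cf_value (a # as) = 1 / (of_int a + cf_value as)"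

definition cf_convergent :: "real \<Rightarrow> nat \<Rightarrow> rat" where
  "cf_convergent x n = cf_value (map (cf_digit x) [1..<n + 1])"

text \<open>\<open>p\<^sub>n\<close> and \<open>q\<^sub>n\<close> are the numerator and denominator in lowest terms, with \<open>q\<^sub>n > 0\<close>.\<close>

definition cf_num :: "real \<Rightarrow> nat \<Rightarrow> int" where
  "cf_num x n = fst (quotient_of (cf_convergent x n))"

definition cf_den :: "real \<Rightarrow> nat \<Rightarrow> int" where
  "cf_den x n = snd (quotient_of (cf_convergent x n))"

definition theta :: "real \<Rightarrow> nat \<Rightarrow> real" where
  "theta x n = of_int (cf_den x n) * \<bar>of_int (cf_den x n) * x - of_int (cf_num x n)\<bar>"

text \<open>The subsequence is indexed from \<open>k = 1\<close>, whereas \<^const>\<open>enumerate\<close> starts at \<open>0\<close>.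
  The set enumerated is infinite for every irrational \<open>x \<in> (0,1)\<close> if \<open>\<alpha> \<ge> 1/2\<close>: by Vahlen's
  theorem, one of any two consecutive \<open>theta x n\<close> is below \<open>1/2\<close>.\<close>

definition theta_bar :: "real \<Rightarrow> real \<Rightarrow> nat \<Rightarrow> real" where
  "theta_bar \<alpha> x k = theta x (enumerate {n. 0 < n \<and> theta x n < \<alpha>} (k - 1))"

definition Lambda :: "real \<Rightarrow> (real \<times> real) set" where
  "Lambda \<alpha> = {(w, z). 0 < w \<and> w < \<alpha> \<and> 0 < z \<and> z < \<alpha> \<and> w + z < 1}"

text \<open>The square root is a real number only for \<open>4 * \<alpha> * w \<le> 1\<close>; points violating this belong
  to \<open>Lambda_plus\<close>. (The conjunct is logically redundant, as \<^const>\<open>sqrt\<close> is negative on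
  negative arguments.)\<close>

definition Lambda_minus :: "real \<Rightarrow> (real \<times> real) set" where
  "Lambda_minus \<alpha> =
     {(w, z) \<in> Lambda \<alpha>. 4 * \<alpha> * w \<le> 1 \<and> z < w - \<alpha> + sqrt (1 - 4 * \<alpha> * w)}"

definition Lambda_plus :: "real \<Rightarrow> (real \<times> real) set" where
  "Lambda_plus \<alpha> = Lambda \<alpha> - Lambda_minus \<alpha>"

definition Omega :: "real \<Rightarrow> (real \<times> real) set" where
  "Omega \<alpha> = {(x, y). 0 < x \<and> x < 1 \<and> y < -1 \<and> x - y > 1 / \<alpha>}"

definition c_const :: "real \<Rightarrow> real" where
  "c_const \<alpha> = inverse (LINT p:Omega \<alpha>|lborel. 1 / (fst p - snd p)\<^sup>2)"

definition lambda_density :: "real \<Rightarrow> real \<times> real \<Rightarrow> real" where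
  "lambda_density \<alpha> = (\<lambda>(w, z).
     if (w, z) \<in> Lambda_plus \<alpha> then
       c_const \<alpha> * (1 - 4 * w * z) powr (- 1 / 2)
     else if (w, z) \<in> Lambda_minus \<alpha> then
       c_const \<alpha> * ((1 - 4 * w * z) powr (- 1 / 2) + (1 + 4 * w * z) powr (- 1 / 2))
     else 0)"

end

theory Submission
  imports Defs "HOL-Probability.Probability_Measure" "HOL-Real_Asymp.Real_Asymp"
    "HOL-Library.Discrete_Functions"
begin

text \<open>
  Write \<open>T\<close> for the Gauss map, \<open>t\<^sub>n = T\<^sup>n x\<close> and \<open>v\<^sub>n = q\<^sub>n\<^sub>-\<^sub>1 / q\<^sub>n\<close>. The transfer operator of \<open>T\<close>
  with respect to Gauss measure reverses monotonicity and halves the oscillation of monotone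
  functions, so the events \<open>T\<^sup>n x < s\<close> are exponentially mixing. A variance bound and
  interpolation along the squares then give their limiting frequencies for almost every \<open>x\<close>,
  and hence those of all cylinders. A block of \<open>2 k\<close> consecutive digits confines
  \<open>(t\<^sub>n, v\<^sub>n)\<close> at the middle of the block to a rectangle; its frequency is the logarithm of a
  cross ratio of the endpoints, which is the area of the rectangle in the coordinates
  \<open>(t, w)\<close> with \<open>w = v / (1 + t v)\<close>. Thus the points \<open>(t\<^sub>m\<^sub>+\<^sub>1, \<theta>\<^sub>m)\<close> are equidistributed with
  respect to Lebesgue measure on \<open>0 < t < 1\<close>, \<open>0 < w < 1 / (1 + t)\<close>.

  In these coordinates \<open>\<theta>\<^sub>m\<^sub>+\<^sub>1 = t - w t\<^sup>2\<close>. If \<open>\<theta>\<^sub>m\<^sub>+\<^sub>1 \<ge> \<alpha> \<ge> 1/2\<close>, then \<open>t > 1/2\<close>, the next digit is \<open>1\<close>,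
  and the successor of \<open>\<theta>\<^sub>m\<close> among the values below \<open>\<alpha>\<close> is \<open>\<theta>\<^sub>m\<^sub>+\<^sub>2 = s + w s\<^sup>2\<close> with \<open>s = 1 - t\<close>.
  For fixed \<open>w\<close> the derivatives of \<open>z = t - w t\<^sup>2\<close> and \<open>z = s + w s\<^sup>2\<close> are \<open>(1 - 4 w z)\<^sup>1\<^sup>/\<^sup>2\<close> and
  \<open>(1 + 4 w z)\<^sup>1\<^sup>/\<^sup>2\<close>, which explains the two terms of the density.
\<close>

subsection \<open>The transfer operator of the Gauss map\<close>

text \<open>The exceptional null set must be fixed before the set B is chosen. Probability therefore
  enters only through countably many conditions, the limiting frequencies of T^n x < s for rational
  s; what follows from \<open>gauss_generic\<close> concerns a single x. Half-lines are used because
  their indicators are monotone, and monotonicity is what the transfer operator controls. Cylinder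
  regions in the (t, w) plane give only lower bounds for the frequency of visits to an open set. Two
  disjoint open sets that fill the domain up to a null set have areas adding up to ln 2, so the
  lower bound for one is an upper bound for the other. This is where the null boundary of B enters.
  The pairs are indexed by k, the orbit by m. The pairs in B and the values below \<alpha> are both
  counted up to a common m from the subsequence; the ratio tends to a quotient of areas, in which ln
  2 cancels and the denominator is the reciprocal of \<open>c_const \<alpha>\<close>.\<close>

definition gauss_weight :: "nat \<Rightarrow> real \<Rightarrow> real" where
  "gauss_weight k x = (1 + x) / ((real k + 1 + x) * (real k + 2 + x))"

text \<open>Index \<open>k\<close> stands for the branch with digit k + 1. The weight is the Gauss
  density at the preimage 1 / (k + 1 + x), times the absolute derivative of that inverse branch,
  divided by the density at x.\<close>

definition gauss_transfer :: "(real \<Rightarrow> real) \<Rightarrow> real \<Rightarrow> real" where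
  "gauss_transfer f x = (\<Sum>k. gauss_weight k x * f (1 / (real k + 1 + x)))"

lemma gauss_weight_nonneg: "0 \<le> x \<Longrightarrow> 0 \<le> gauss_weight k x"
  by (simp add: gauss_weight_def)

text \<open>The weight equals (k + 1) / (k + 2 + x) - k / (k + 1 + x), so the sum telescopes. The
  closed form also compares partial sums at two points in
  \<open>gauss_transfer_antimono\<close>.\<close>

lemma sum_gauss_weight:
  assumes "0 \<le> x"
  shows "(\<Sum>k<K. gauss_weight k x) = real K / (real K + 1 + x)"
proof (induction K)
  case (Suc K)
  have "real K + 1 + x \<noteq> 0" "real K + 2 + x \<noteq> 0" using assms by linarith+
  then have "real K / (K + 1 + x) + gauss_weight K x = real (Suc K) / (Suc K + 1 + x)"
    unfolding gauss_weight_def by (simp add: divide_simps) (simp add: algebra_simps)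
  with Suc show ?case by (simp add: add_ac)
qed simp

lemma gauss_weight_sums:
  assumes "0 \<le> x"
  shows "(\<lambda>k. gauss_weight k x) sums 1"
proof -
  have "(\<lambda>K. real K / (real K + 1 + x)) \<longlonglongrightarrow> 1"
    by real_asymp
  then show ?thesis
    unfolding sums_def sum_gauss_weight[OF assms] .
qed

lemma gauss_point_in_unit: "0 \<le> (x::real) \<Longrightarrow> 1 / (real k + 1 + x) \<in> {0..1}"
  by (simp add: divide_simps)

lemma gauss_transfer_summable:
  assumes x: "0 \<le> x" and f: "\<And>y. y \<in> {0..1} \<Longrightarrow> \<bar>f y\<bar> \<le> B"
  shows "summable (\<lambda>k. gauss_weight k x * f (1 / (real k + 1 + x)))"
proof (rule summable_comparison_test')
  show "summable (\<lambda>k. gauss_weight k x * B)"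
    using gauss_weight_sums[OF x] by (intro summable_mult2) (rule sums_summable)
  show "norm (gauss_weight k x * f (1 / (real k + 1 + x))) \<le> gauss_weight k x * B" for k
    using f[OF gauss_point_in_unit[OF x]] gauss_weight_nonneg[OF x, of k]
    by (simp add: abs_mult mult_left_mono)
qed

lemma mono_on_unit_bounded:
  fixes f :: "real \<Rightarrow> real"
  assumes "mono_on {0..1} f" "y \<in> {0..1}"
  shows "\<bar>f y\<bar> \<le> \<bar>f 0\<bar> + \<bar>f 1\<bar>"
proof -
  have "f 0 \<le> f y" "f y \<le> f 1"
    using assms by (auto intro!: mono_onD[OF assms(1)])
  then show ?thesis by linarith
qed

lemma gauss_transfer_uminus:
  assumes "0 \<le> x" and "\<And>y. y \<in> {0..1} \<Longrightarrow> \<bar>f y\<bar> \<le> B"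
  shows "gauss_transfer (\<lambda>x. - f x) x = - gauss_transfer f x"
  unfolding gauss_transfer_def
  using suminf_minus[OF gauss_transfer_summable[OF assms]] by simp

text \<open>Summation by parts. If \<open>d\<close> is the difference of two weight sequences,
  nonnegative partial sums say that the second one sits at larger indices, where \<open>F\<close> is
  smaller.\<close>

lemma sum_mult_antimono_ge:
  fixes d F :: "nat \<Rightarrow> real"
  assumes D: "\<And>n. (\<Sum>k<n. d k) \<ge> 0" and F: "\<And>k. F (Suc k) \<le> F k"
  shows "(\<Sum>k<Suc n. d k * F k) \<ge> (\<Sum>k<Suc n. d k) * F n"
proof (induction n)
  case (Suc n)
  have "(\<Sum>k<Suc (Suc n). d k) * F (Suc n) = (\<Sum>k<Suc n. d k) * F (Suc n) + d (Suc n) * F (Suc n)"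
    by (simp add: algebra_simps)
  also have "\<dots> \<le> (\<Sum>k<Suc n. d k) * F n + d (Suc n) * F (Suc n)"
    using D[of "Suc n"] F[of n] by (intro add_right_mono mult_left_mono)
  finally show ?case using Suc by simp
qed simp

text \<open>As \<open>x\<close> grows, the points \<open>1 / (k + 1 + x)\<close> decrease and the weights move towards large \<open>k\<close>.\<close>

lemma gauss_transfer_antimono:
  assumes f: "mono_on {0..1} f"
  shows "antimono_on {0..1} (gauss_transfer f)"
proof (rule monotone_onI)
  fix x y :: real
  assume x: "x \<in> {0..1}" and y: "y \<in> {0..1}" and xy: "x \<le> y"
  define F where "F k = f (1 / (real k + 1 + x))" for k
  define d where "d k = gauss_weight k x - gauss_weight k y" for k
  note bnd = mono_on_unit_bounded[OF f]
  have x0: "0 \<le> x" and y0: "0 \<le> y" using x y by auto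
  have sx: "summable (\<lambda>k. gauss_weight k x * F k)"
    unfolding F_def by (rule gauss_transfer_summable[OF x0 bnd])
  have sy: "summable (\<lambda>k. gauss_weight k y * F k)"
  proof (rule summable_comparison_test')
    show "summable (\<lambda>k. gauss_weight k y * (\<bar>f 0\<bar> + \<bar>f 1\<bar>))"
      using gauss_weight_sums[OF y0] by (intro summable_mult2) (rule sums_summable)
    show "norm (gauss_weight k y * F k) \<le> gauss_weight k y * (\<bar>f 0\<bar> + \<bar>f 1\<bar>)" for k
      unfolding F_def using bnd[OF gauss_point_in_unit[OF x0]] gauss_weight_nonneg[OF y0, of k]
      by (simp add: abs_mult mult_left_mono)
  qed
  \<comment> \<open>The intermediate sum takes the weights at \<open>y\<close> and the points at
    \<open>x\<close>, which separates the two effects.\<close>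
  have "gauss_transfer f y \<le> (\<Sum>k. gauss_weight k y * F k)"
    unfolding gauss_transfer_def
  proof (rule suminf_le[OF _ gauss_transfer_summable[OF y0 bnd] sy])
    fix k
    have "1 / (real k + 1 + y) \<le> 1 / (real k + 1 + x)"
      using x0 y0 xy by (intro divide_left_mono) auto
    then have "f (1 / (real k + 1 + y)) \<le> F k"
      unfolding F_def using gauss_point_in_unit[OF x0] gauss_point_in_unit[OF y0]
      by (intro mono_onD[OF f])
    then show "gauss_weight k y * f (1 / (real k + 1 + y)) \<le> gauss_weight k y * F k"
      using gauss_weight_nonneg[OF y0] by (intro mult_left_mono)
  qed
  also have "\<dots> \<le> (\<Sum>k. gauss_weight k x * F k)"
  proof -
    have dsum: "(\<Sum>k<n. d k) = real n / (real n + 1 + x) - real n / (real n + 1 + y)" for n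
      by (simp add: d_def sum_subtractf sum_gauss_weight x0 y0)
    have D: "(\<Sum>k<n. d k) \<ge> 0" for n
      unfolding dsum using x0 y0 xy by (simp add: frac_le)
    have Fdec: "F (Suc k) \<le> F k" for k
      unfolding F_def
      using gauss_point_in_unit[OF x0, of k] gauss_point_in_unit[OF x0, of "Suc k"] x0
      by (intro mono_onD[OF f]) (auto intro!: divide_left_mono)
    have F0: "f 0 \<le> F k" for k
      unfolding F_def using gauss_point_in_unit[OF x0, of k] by (intro mono_onD[OF f]) auto
    have ge: "(\<Sum>k<Suc n. d k) * f 0 \<le> (\<Sum>k<Suc n. d k * F k)" for n
      using sum_mult_antimono_ge[of d F n, OF D Fdec] mult_left_mono[OF F0[of n] D[of "Suc n"]]
      by linarith
    \<comment> \<open>Both weight sequences have mass 1, so the partial sums of \<open>d\<close>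
      vanish in the limit, and with them the lower bound in \<open>ge\<close>.\<close>
    have "(\<lambda>n. \<Sum>k<n. d k) \<longlonglongrightarrow> 1 - 1"
      using sums_diff[OF gauss_weight_sums[OF x0] gauss_weight_sums[OF y0]]
      unfolding d_def sums_def by simp
    then have l1: "(\<lambda>n. (\<Sum>k<Suc n. d k) * f 0) \<longlonglongrightarrow> (1 - 1) * f 0"
      by (intro tendsto_intros) (rule LIMSEQ_Suc)
    have "(\<lambda>k. d k * F k) sums ((\<Sum>k. gauss_weight k x * F k) - (\<Sum>k. gauss_weight k y * F k))"
      using sums_diff[OF summable_sums[OF sx] summable_sums[OF sy]]
      by (simp add: d_def left_diff_distrib)
    then have l2: "(\<lambda>n. \<Sum>k<Suc n. d k * F k) \<longlonglongrightarrow>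
        (\<Sum>k. gauss_weight k x * F k) - (\<Sum>k. gauss_weight k y * F k)"
      unfolding sums_def by (rule LIMSEQ_Suc)
    have "(1 - 1) * f 0 \<le> (\<Sum>k. gauss_weight k x * F k) - (\<Sum>k. gauss_weight k y * F k)"
      using ge by (intro LIMSEQ_le[OF l1 l2]) auto
    then show ?thesis by simp
  qed
  also have "\<dots> = gauss_transfer f x" by (simp add: gauss_transfer_def F_def)
  finally show "gauss_transfer f y \<le> gauss_transfer f x" .
qed

text \<open>The points 1 / (k + 2) for x = 1 are those for x = 0 without the first, and each carries
  twice the weight. With S = \<open>suminf h\<close> the values at 1 and 0 are 2 S and f 1 / 2 + S,
  and S >= f 0 / 2 because the weights at 1 have mass 1.\<close>

lemma gauss_transfer_oscillation:
  assumes f: "mono_on {0..1} f"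
  shows "gauss_transfer f 0 - gauss_transfer f 1 \<le> (f 1 - f 0) / 2"
proof -
  note bnd = mono_on_unit_bounded[OF f]
  define h where "h k = f (1 / (real k + 2)) / ((real k + 2) * (real k + 3))" for k
  have s0: "summable (\<lambda>k. gauss_weight k 0 * f (1 / (real k + 1 + 0)))"
    by (rule gauss_transfer_summable[OF order_refl bnd])
  have "gauss_transfer f 0 = (\<Sum>k. gauss_weight (Suc k) 0 * f (1 / (real (Suc k) + 1 + 0)))
      + gauss_weight 0 0 * f (1 / (real 0 + 1 + 0))"
    unfolding gauss_transfer_def using suminf_split_initial_segment[OF s0, of 1] by simp
  also have "(\<lambda>k. gauss_weight (Suc k) 0 * f (1 / (real (Suc k) + 1 + 0))) = h"
    by (auto simp: gauss_weight_def h_def add_ac fun_eq_iff)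
  finally have U0: "gauss_transfer f 0 = suminf h + f 1 / 2"
    by (simp add: gauss_weight_def)
  have sh: "summable h"
    using s0 \<open>(\<lambda>k. gauss_weight (Suc k) 0 * f (1 / (real (Suc k) + 1 + 0))) = h\<close>
    by (subst (asm) summable_Suc_iff[symmetric]) simp
  have "gauss_transfer f 1 = (\<Sum>k. 2 * h k)"
    unfolding gauss_transfer_def by (auto simp: gauss_weight_def h_def add_ac intro!: suminf_cong)
  then have U1: "gauss_transfer f 1 = 2 * suminf h"
    using suminf_mult[OF sh, of 2] by simp
  have "(\<lambda>k. gauss_weight k 1 * (f 0 / 2)) sums (1 * (f 0 / 2))"
    by (rule sums_mult2) (rule gauss_weight_sums, simp)
  then have "(\<Sum>k. gauss_weight k 1 * (f 0 / 2)) = f 0 / 2"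
    and sw: "summable (\<lambda>k. gauss_weight k 1 * (f 0 / 2))"
    by (auto simp: sums_iff)
  moreover have "(\<Sum>k. gauss_weight k 1 * (f 0 / 2)) \<le> suminf h"
  proof (rule suminf_le[OF _ sw sh])
    fix k
    have "f 0 \<le> f (1 / (real k + 2))"
      using gauss_point_in_unit[of 1 k] by (intro mono_onD[OF f]) (auto simp: add_ac)
    then show "gauss_weight k 1 * (f 0 / 2) \<le> h k"
      by (simp add: gauss_weight_def h_def add_ac divide_right_mono)
  qed
  ultimately show ?thesis using U0 U1 by simp
qed

subsection \<open>Gauss measure and exponential mixing\<close>

definition gauss_measure :: "real measure" where
  "gauss_measure = density lborel (\<lambda>x. ennreal (indicator {0..1} x / ((1 + x) * ln 2)))"

lemma sets_gauss_measure [simp, measurable_cong]: "sets gauss_measure = sets borel"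
  by (simp add: gauss_measure_def)

lemma space_gauss_measure [simp]: "space gauss_measure = UNIV"
  by (simp add: gauss_measure_def)

lemma measurable_gauss_map [measurable]: "gauss_map \<in> borel_measurable borel"
  unfolding gauss_map_def[abs_def] frac_def by measurable

lemma measurable_gauss_transfer [measurable]:
  assumes [measurable]: "f \<in> borel_measurable borel"
  shows "gauss_transfer f \<in> borel_measurable borel"
  unfolding gauss_transfer_def[abs_def] gauss_weight_def by measurable

lemma measurable_funpow_gauss_map [measurable]: "gauss_map ^^ n \<in> borel_measurable borel"
  by (induction n) auto

lemma gauss_map_branch:
  assumes "0 \<le> y" "y < 1"
  shows "gauss_map (1 / (real k + 1 + y)) = y"
proof -
  have "\<lfloor>real k + 1 + y\<rfloor> = int k + 1" using assms by linarith
  then show ?thesis by (simp add: gauss_map_def frac_def)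
qed

lemma nn_integral_gauss_branch:
  fixes F :: "real \<Rightarrow> real"
  assumes [measurable]: "F \<in> borel_measurable borel"
  shows "(\<integral>\<^sup>+x. ennreal (F x) * indicator {1 / (real k + 2)..1 / (real k + 1)} x \<partial>lborel)
    = (\<integral>\<^sup>+y. ennreal (F (1 / (real k + 1 + y)) / (real k + 1 + y)\<^sup>2) * indicator {0..1} y \<partial>lborel)"
proof -
  \<comment> \<open>The substitution rule wants an increasing map, so the decreasing inverse branch
    is composed with y -> 1 - y; the reflection is undone afterwards.\<close>
  define \<phi> where "\<phi> y = 1 / (real k + 2 - y)" for y :: real
  have ends: "\<phi> 0 = 1 / (real k + 2)" "\<phi> 1 = 1 / (real k + 1)"
    by (simp_all add: \<phi>_def)
  have "(\<integral>\<^sup>+x. ennreal (F x) * indicator {1 / (real k + 2)..1 / (real k + 1)} x \<partial>lborel)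
      = (\<integral>\<^sup>+x. ennreal (F x * indicator {\<phi> 0..\<phi> 1} x) \<partial>lborel)"
    by (intro nn_integral_cong) (simp add: ends split: split_indicator)
  also have "\<dots> = (\<integral>\<^sup>+y. ennreal (F (\<phi> y) * (1 / (real k + 2 - y)\<^sup>2) * indicator {0..1} y) \<partial>lborel)"
  proof (rule nn_integral_substitution)
    show "set_borel_measurable borel {\<phi> 0..\<phi> 1} F"
      unfolding set_borel_measurable_def by measurable
    show "(\<phi> has_real_derivative 1 / (real k + 2 - x)\<^sup>2) (at x)" if "x \<in> {0..1}" for x
      unfolding \<phi>_def using that
      by (auto intro!: derivative_eq_intros simp: power2_eq_square)
    show "continuous_on {0..1} (\<lambda>y. 1 / (real k + 2 - y)\<^sup>2)"
      by (intro continuous_intros) auto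
  qed auto
  also have "\<dots> = (\<integral>\<^sup>+y. ennreal (F (\<phi> (1 - y)) * (1 / (real k + 2 - (1 - y))\<^sup>2) * indicator {0..1} (1 - y)) \<partial>lborel)"
    unfolding \<phi>_def by (subst nn_integral_real_affine[where c = "-1" and t = 1]) auto
  also have "\<dots> = (\<integral>\<^sup>+y. ennreal (F (1 / (real k + 1 + y)) / (real k + 1 + y)\<^sup>2) * indicator {0..1} y \<partial>lborel)"
  proof (intro nn_integral_cong)
    fix y :: real
    have "real k + 2 - (1 - y) = real k + 1 + y" by simp
    then have "\<phi> (1 - y) = 1 / (real k + 1 + y)" by (simp only: \<phi>_def)
    then show "ennreal (F (\<phi> (1 - y)) * (1 / (real k + 2 - (1 - y))\<^sup>2) * indicator {0..1} (1 - y))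
      = ennreal (F (1 / (real k + 1 + y)) / (real k + 1 + y)\<^sup>2) * indicator {0..1} y"
      unfolding \<open>real k + 2 - (1 - y) = real k + 1 + y\<close> by (simp split: split_indicator)
  qed
  finally show ?thesis .
qed

lemma gauss_branch_unique:
  fixes x :: real
  assumes x: "0 < x" "x < 1" and nr: "x \<notin> \<rat>"
  shows "x \<in> {1 / (real k + 2)..1 / (real k + 1)} \<longleftrightarrow> k = nat \<lfloor>1 / x\<rfloor> - 1"
proof -
  have ni: "1 / x \<noteq> real_of_int m" for m
  proof
    assume "1 / x = of_int m"
    then have "x = 1 / of_int m" by (metis div_by_1 divide_divide_eq_right mult_1)
    then have "x \<in> \<rat>" by (metis Rats_1 Rats_divide Rats_of_int)
    with nr show False by simp
  qed
  have "x \<in> {1 / (real k + 2)..1 / (real k + 1)} \<longleftrightarrow> real k + 1 \<le> 1 / x \<and> 1 / x \<le> real k + 2"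
    using x by (auto simp: field_simps)
  also have "\<dots> \<longleftrightarrow> real k + 1 \<le> 1 / x \<and> 1 / x < real k + 2"
    using ni[of "int k + 2"] by auto
  also have "\<dots> \<longleftrightarrow> \<lfloor>1 / x\<rfloor> = int k + 1" by linarith
  also have "\<dots> \<longleftrightarrow> k = nat \<lfloor>1 / x\<rfloor> - 1"
  proof -
    have "\<lfloor>1 / x\<rfloor> \<ge> 1" using x by simp
    then show ?thesis by linarith
  qed
  finally show ?thesis .
qed

lemma AE_lborel_irrational: "AE x in lborel. (x::real) \<notin> \<rat>"
  by (intro AE_not_in countable_imp_null_set_lborel countable_rat)

text \<open>Duality of \<open>gauss_transfer\<close> with composition by the Gauss map: cut (0, 1)
  into the branch intervals, which overlap in rational points only, substitute on each and
  interchange sum and integral.\<close>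

lemma nn_integral_gauss_transfer:
  fixes f g :: "real \<Rightarrow> real"
  assumes [measurable]: "f \<in> borel_measurable borel" "g \<in> borel_measurable borel"
    and f: "\<And>x. x \<in> {0..1} \<Longrightarrow> 0 \<le> f x" "\<And>x. x \<in> {0..1} \<Longrightarrow> f x \<le> B"
    and g: "\<And>x. 0 \<le> g x"
  shows "(\<integral>\<^sup>+x. ennreal (f x * g (gauss_map x)) \<partial>gauss_measure)
    = (\<integral>\<^sup>+x. ennreal (gauss_transfer f x * g x) \<partial>gauss_measure)"
proof -
  define F where "F x = f x * g (gauss_map x) / ((1 + x) * ln 2)" for x
  have [measurable]: "F \<in> borel_measurable borel" unfolding F_def by measurable
  have "(\<integral>\<^sup>+x. ennreal (f x * g (gauss_map x)) \<partial>gauss_measure)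
      = (\<integral>\<^sup>+x. ennreal (F x) * indicator {0..1} x \<partial>lborel)"
    unfolding gauss_measure_def F_def
    by (subst nn_integral_density)
      (auto intro!: nn_integral_cong simp: ennreal_mult'[symmetric] f g split: split_indicator)
  also have "\<dots> = (\<integral>\<^sup>+x. (\<Sum>k. ennreal (F x) * indicator {1 / (real k + 2)..1 / (real k + 1)} x) \<partial>lborel)"
  proof (intro nn_integral_cong_AE, use AE_lborel_irrational in eventually_elim)
    fix x :: real assume nr: "x \<notin> \<rat>"
    show "ennreal (F x) * indicator {0..1} x
        = (\<Sum>k. ennreal (F x) * indicator {1 / (real k + 2)..1 / (real k + 1)} x)"
    proof (cases "0 < x \<and> x < 1")
      case True
      have "(\<Sum>k. ennreal (F x) * indicator {1 / (real k + 2)..1 / (real k + 1)} x)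
        = (\<Sum>k\<in>{nat \<lfloor>1 / x\<rfloor> - 1}. ennreal (F x) * indicator {1 / (real k + 2)..1 / (real k + 1)} x)"
        using gauss_branch_unique[OF _ _ nr] True by (intro suminf_finite) (auto simp: indicator_def)
      also have "\<dots> = ennreal (F x)"
        using gauss_branch_unique[OF _ _ nr, of "nat \<lfloor>1 / x\<rfloor> - 1"] True by (simp add: indicator_def)
      finally show ?thesis using True by simp
    next
      case False
      have "x \<noteq> 0" "x \<noteq> 1" using nr by auto
      then have F: "x < 0 \<or> x > 1" using False by auto
      have "x \<notin> {1 / (real k + 2)..1 / (real k + 1)}" for k
      proof -
        have "0 \<le> 1 / (real k + 2)" "1 / (real k + 1) \<le> 1" by (simp_all add: divide_simps)
        with F show ?thesis by (meson atLeastAtMost_iff not_le order_trans)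
      qed
      then have "(\<Sum>k. ennreal (F x) * indicator {1 / (real k + 2)..1 / (real k + 1)} x) = 0"
        by simp
      with F show ?thesis by auto
    qed
  qed
  also have "\<dots> = (\<Sum>k. \<integral>\<^sup>+x. ennreal (F x) * indicator {1 / (real k + 2)..1 / (real k + 1)} x \<partial>lborel)"
    by (rule nn_integral_suminf) measurable
  also have "\<dots> = (\<Sum>k. \<integral>\<^sup>+y. ennreal (F (1 / (real k + 1 + y)) / (real k + 1 + y)\<^sup>2) * indicator {0..1} y \<partial>lborel)"
    by (subst nn_integral_gauss_branch) auto
  also have "\<dots> = (\<integral>\<^sup>+y. (\<Sum>k. ennreal (F (1 / (real k + 1 + y)) / (real k + 1 + y)\<^sup>2) * indicator {0..1} y) \<partial>lborel)"
    by (rule nn_integral_suminf[symmetric]) measurable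
  also have "\<dots> = (\<integral>\<^sup>+y. ennreal (gauss_transfer f y * g y / ((1 + y) * ln 2)) * indicator {0..1} y \<partial>lborel)"
  proof (intro nn_integral_cong_AE, use AE_lborel_irrational in eventually_elim)
    fix y :: real assume "y \<notin> \<rat>"
    then have "y \<noteq> 0" "y \<noteq> 1" by auto
    show "(\<Sum>k. ennreal (F (1 / (real k + 1 + y)) / (real k + 1 + y)\<^sup>2) * indicator {0..1} y)
       = ennreal (gauss_transfer f y * g y / ((1 + y) * ln 2)) * indicator {0..1} y"
    proof (cases "y \<in> {0..1}")
      case True
      then have y: "0 < y" "y < 1" using \<open>y \<noteq> 0\<close> \<open>y \<noteq> 1\<close> by auto
      have "F (1 / (real k + 1 + y)) / (real k + 1 + y)\<^sup>2
          = gauss_weight k y * f (1 / (real k + 1 + y)) * (g y / ((1 + y) * ln 2))" for k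
      proof -
        have "F (1 / (real k + 1 + y)) = f (1 / (real k + 1 + y)) * g y / ((1 + 1 / (real k + 1 + y)) * ln 2)"
          using y by (simp add: F_def gauss_map_branch)
        moreover have "1 + 1 / (real k + 1 + y) = (real k + 2 + y) / (real k + 1 + y)"
          using y by (simp add: divide_simps)
        moreover have "real k + 1 + y > 0" "real k + 2 + y > 0" "1 + y > 0" using y by auto
        ultimately show ?thesis
          by (simp add: gauss_weight_def divide_simps power2_eq_square) (simp add: add_ac)
      qed
      moreover have "(\<Sum>k. ennreal (gauss_weight k y * f (1 / (real k + 1 + y)) * (g y / ((1 + y) * ln 2))))
          = ennreal (\<Sum>k. gauss_weight k y * f (1 / (real k + 1 + y)) * (g y / ((1 + y) * ln 2)))"
        using y f gauss_point_in_unit[of y] g[of y] gauss_weight_nonneg[of y]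
        by (intro suminf_ennreal2 summable_mult2 gauss_transfer_summable[where B = B] mult_nonneg_nonneg divide_nonneg_nonneg)
           (auto simp: abs_le_iff intro: order_trans[of _ 0])
      moreover have "(\<Sum>k. gauss_weight k y * f (1 / (real k + 1 + y)) * (g y / ((1 + y) * ln 2)))
          = gauss_transfer f y * (g y / ((1 + y) * ln 2))"
        unfolding gauss_transfer_def using y f
        by (intro suminf_mult2[symmetric] gauss_transfer_summable[where B = B]) (auto simp: abs_le_iff intro: order_trans[of _ 0])
      ultimately show ?thesis using True by simp
    qed simp
  qed
  also have "\<dots> = (\<integral>\<^sup>+x. ennreal (gauss_transfer f x * g x) \<partial>gauss_measure)"
    unfolding gauss_measure_def
    by (subst nn_integral_density)
      (auto intro!: nn_integral_cong simp: ennreal_mult'[symmetric] split: split_indicator)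
  finally show ?thesis .
qed

lemma AE_gauss_measure_unit: "AE x in gauss_measure. x \<in> {0..1}"
  unfolding gauss_measure_def by (subst AE_density) (auto simp: indicator_def)

lemma emeasure_gauss_lessThan:
  assumes "0 \<le> s" "s \<le> 1"
  shows "emeasure gauss_measure {..<s} = ennreal (ln (1 + s) / ln 2)"
proof -
  have "emeasure gauss_measure {..<s}
      = (\<integral>\<^sup>+x. ennreal (indicator {0..1} x / ((1 + x) * ln 2)) * indicator {..<s} x \<partial>lborel)"
    unfolding gauss_measure_def by (subst emeasure_density) auto
  also have "\<dots> = (\<integral>\<^sup>+x. ennreal (1 / ((1 + x) * ln 2)) * indicator {0..s} x \<partial>lborel)"
    by (intro nn_integral_cong_AE, use AE_lborel_singleton[of s] in eventually_elim)
      (use assms in \<open>auto split: split_indicator\<close>)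
  also have "\<dots> = ennreal (ln (1 + s) / ln 2 - ln (1 + 0) / ln 2)"
    using assms by (intro nn_integral_FTC_Icc) (auto intro!: derivative_eq_intros)
  finally show ?thesis by simp
qed

lemma measure_gauss_lessThan:
  "0 \<le> s \<Longrightarrow> s \<le> 1 \<Longrightarrow> measure gauss_measure {..<s} = ln (1 + s) / ln 2"
  unfolding measure_def by (subst emeasure_gauss_lessThan) auto

interpretation gauss: prob_space gauss_measure
proof
  have "AE x in gauss_measure. x \<noteq> 1"
    unfolding gauss_measure_def
    by (subst AE_density, simp, use AE_lborel_singleton[of 1] in eventually_elim) auto
  then have "emeasure gauss_measure UNIV = emeasure gauss_measure {..<1}"
    using AE_gauss_measure_unit by (intro emeasure_eq_AE) (auto elim!: eventually_elim2)
  then show "emeasure gauss_measure (space gauss_measure) = 1"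
    by (simp add: emeasure_gauss_lessThan)
qed

text \<open>Invariance of Gauss measure: the weights sum to 1, so the constant 1 is fixed by
  \<open>gauss_transfer\<close>.\<close>

lemma nn_integral_gauss_map:
  fixes g :: "real \<Rightarrow> real"
  assumes [measurable]: "g \<in> borel_measurable borel" and g: "\<And>x. 0 \<le> g x"
  shows "(\<integral>\<^sup>+x. ennreal (g (gauss_map x)) \<partial>gauss_measure) = (\<integral>\<^sup>+x. ennreal (g x) \<partial>gauss_measure)"
proof -
  have U: "gauss_transfer (\<lambda>_. 1) x = 1" if "x \<in> {0..1}" for x
    using gauss_weight_sums[of x] that by (simp add: gauss_transfer_def sums_iff)
  have "(\<integral>\<^sup>+x. ennreal (g (gauss_map x)) \<partial>gauss_measure)
      = (\<integral>\<^sup>+x. ennreal (gauss_transfer (\<lambda>_. 1) x * g x) \<partial>gauss_measure)"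
    using nn_integral_gauss_transfer[of "\<lambda>_. 1" g 1] g by simp
  also have "\<dots> = (\<integral>\<^sup>+x. ennreal (g x) \<partial>gauss_measure)"
    by (intro nn_integral_cong_AE, use AE_gauss_measure_unit in eventually_elim) (simp add: U)
  finally show ?thesis .
qed

lemma distr_gauss_map: "distr gauss_measure borel gauss_map = gauss_measure"
proof (rule measure_eqI)
  fix A :: "real set" assume "A \<in> sets (distr gauss_measure borel gauss_map)"
  then have [measurable]: "A \<in> sets borel" by simp
  have "emeasure (distr gauss_measure borel gauss_map) A = (\<integral>\<^sup>+x. indicator A (gauss_map x) \<partial>gauss_measure)"
    using nn_integral_distr[of gauss_map gauss_measure borel "indicator A"] by simp
  also have "\<dots> = emeasure gauss_measure A"
    using nn_integral_gauss_map[of "indicator A"] by (simp add: ennreal_indicator)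
  finally show "emeasure (distr gauss_measure borel gauss_map) A = emeasure gauss_measure A" .
qed simp

lemma distr_gauss_map_funpow: "distr gauss_measure borel (gauss_map ^^ n) = gauss_measure"
proof (induction n)
  case 0
  show ?case using distr_id2[of borel gauss_measure] by (simp add: id_def)
next
  case (Suc n)
  have "distr gauss_measure borel (gauss_map ^^ Suc n)
      = distr (distr gauss_measure borel (gauss_map ^^ n)) borel gauss_map"
    by (subst distr_distr) auto
  then show ?case using Suc distr_gauss_map by (simp add: comp_def)
qed

lemma nn_integral_gauss_transfer_funpow:
  fixes f g :: "real \<Rightarrow> real"
  assumes "f \<in> borel_measurable borel" and [measurable]: "g \<in> borel_measurable borel"
    and f: "\<And>x. x \<in> {0..1} \<Longrightarrow> f x \<in> {0..B}" and g: "\<And>x. 0 \<le> g x"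
  shows "(\<integral>\<^sup>+x. ennreal (f x * g ((gauss_map ^^ n) x)) \<partial>gauss_measure)
    = (\<integral>\<^sup>+x. ennreal ((gauss_transfer ^^ n) f x * g x) \<partial>gauss_measure)"
  using assms(1) f
proof (induction n arbitrary: f)
  case (Suc n)
  have range: "gauss_transfer f x \<in> {0..B}" if x: "x \<in> {0..1}" for x
  proof -
    have fp: "f (1 / (real k + 1 + x)) \<in> {0..B}" for k
      using Suc.prems(2) gauss_point_in_unit x by auto
    have s: "summable (\<lambda>k. gauss_weight k x * f (1 / (real k + 1 + x)))"
      using x Suc.prems(2) by (intro gauss_transfer_summable[where B = B]) (auto simp: abs_le_iff intro: order_trans[of _ 0])
    have sB: "(\<lambda>k. gauss_weight k x * B) sums (1 * B)"
      using gauss_weight_sums[of x] x by (intro sums_mult2) auto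
    have "0 \<le> gauss_transfer f x"
      unfolding gauss_transfer_def using s x fp by (intro suminf_nonneg) (auto simp: gauss_weight_nonneg)
    moreover have "gauss_transfer f x \<le> (\<Sum>k. gauss_weight k x * B)"
      unfolding gauss_transfer_def using s sB x fp
      by (intro suminf_le mult_left_mono) (auto simp: gauss_weight_nonneg sums_iff)
    ultimately show ?thesis using sB by (simp add: sums_iff)
  qed
  note [measurable] = Suc.prems(1)
  have "(\<integral>\<^sup>+x. ennreal (f x * g ((gauss_map ^^ Suc n) x)) \<partial>gauss_measure)
      = (\<integral>\<^sup>+x. ennreal (gauss_transfer f x * g ((gauss_map ^^ n) x)) \<partial>gauss_measure)"
    using nn_integral_gauss_transfer[of f "\<lambda>x. g ((gauss_map ^^ n) x)" B] g Suc.prems(2)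
    by (simp add: funpow_Suc_right del: funpow.simps)
  also have "\<dots> = (\<integral>\<^sup>+x. ennreal ((gauss_transfer ^^ Suc n) f x * g x) \<partial>gauss_measure)"
    using Suc.IH[of "gauss_transfer f"] range by (simp add: funpow_Suc_right del: funpow.simps)
  finally show ?case .
qed simp

text \<open>Each application flips the direction of monotonicity, hence the disjunction; the
  antimonotone case is reduced to the monotone one by a change of sign.\<close>

lemma gauss_transfer_funpow_monotone:
  fixes f :: "real \<Rightarrow> real"
  assumes "mono_on {0..1} f \<or> antimono_on {0..1} f"
  shows "(mono_on {0..1} ((gauss_transfer ^^ n) f) \<or> antimono_on {0..1} ((gauss_transfer ^^ n) f))
    \<and> \<bar>(gauss_transfer ^^ n) f 1 - (gauss_transfer ^^ n) f 0\<bar> \<le> \<bar>f 1 - f 0\<bar> / 2 ^ n"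
proof (induction n)
  case (Suc n)
  define h where "h = (gauss_transfer ^^ n) f"
  have "(mono_on {0..1} (gauss_transfer h) \<or> antimono_on {0..1} (gauss_transfer h))
    \<and> \<bar>gauss_transfer h 1 - gauss_transfer h 0\<bar> \<le> \<bar>h 1 - h 0\<bar> / 2"
  proof (cases "mono_on {0..1} h")
    case True
    have "gauss_transfer h 1 \<le> gauss_transfer h 0"
      using gauss_transfer_antimono[OF True] by (auto simp: monotone_on_def)
    then show ?thesis using gauss_transfer_antimono[OF True] gauss_transfer_oscillation[OF True]
      by (auto simp: abs_if)
  next
    case False
    then have m: "mono_on {0..1} (\<lambda>x. - h x)"
      using Suc.IH by (auto simp: h_def monotone_on_def)
    have U: "gauss_transfer (\<lambda>x. - h x) x = - gauss_transfer h x" if "x \<in> {0..1}" for x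
      using gauss_transfer_uminus[of x h "\<bar>- h 0\<bar> + \<bar>- h 1\<bar>"] mono_on_unit_bounded[OF m] that by auto
    have a: "mono_on {0..1} (gauss_transfer h)"
      using gauss_transfer_antimono[OF m] U by (auto simp: monotone_on_def)
    moreover have "gauss_transfer h 0 \<le> gauss_transfer h 1"
      using a by (auto simp: monotone_on_def)
    ultimately show ?thesis using gauss_transfer_oscillation[OF m] U[of 0] U[of 1]
      by (auto simp: abs_if)
  qed
  with Suc show ?case by (auto simp: h_def)
qed (use assms in simp)

text \<open>By duality the joint measure is the integral over B of \<open>h\<close>, the n-th
  transfer iterate of the indicator of \<open>{..<s}\<close>. The values of \<open>h\<close> spread
  by at most (1 / 2)^n, and both compared quantities lie between \<open>m\<close> and
  \<open>M\<close> times the measure of B.\<close>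

lemma gauss_map_mixing:
  assumes [measurable]: "B \<in> sets borel"
  shows "\<bar>measure gauss_measure {x. x < s \<and> (gauss_map ^^ n) x \<in> B}
    - measure gauss_measure {..<s} * measure gauss_measure B\<bar> \<le> (1 / 2) ^ n"
proof -
  define f :: "real \<Rightarrow> real" where "f = indicator {..<s}"
  define h where "h = (gauss_transfer ^^ n) f"
  have [measurable]: "f \<in> borel_measurable borel" unfolding f_def by simp
  have "(gauss_transfer ^^ n) f \<in> borel_measurable borel"
    by (induction n) auto
  then have [measurable]: "h \<in> borel_measurable borel" by (simp add: h_def)
  have "antimono_on {0..1} f" by (auto simp: f_def monotone_on_def indicator_def)
  then have h: "mono_on {0..1} h \<or> antimono_on {0..1} h" and osc: "\<bar>h 1 - h 0\<bar> \<le> \<bar>f 1 - f 0\<bar> / 2 ^ n"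
    unfolding h_def using gauss_transfer_funpow_monotone[of f n] by blast+
  define m where "m = min (h 0) (h 1)"
  define M where "M = max (h 0) (h 1)"
  have "\<bar>f 1 - f 0\<bar> \<le> 1" by (auto simp: f_def indicator_def)
  then have "\<bar>f 1 - f 0\<bar> / 2 ^ n \<le> 1 / 2 ^ n" by (rule divide_right_mono) simp
  moreover have "M - m = \<bar>h 1 - h 0\<bar>" by (auto simp: m_def M_def)
  ultimately have mM: "M - m \<le> (1 / 2) ^ n" using osc unfolding power_one_over by linarith
  have hm: "m \<le> h x" "h x \<le> M" if "x \<in> {0..1}" for x
    using h that unfolding m_def M_def by (auto simp: monotone_on_def)
  have h01: "integrable gauss_measure (\<lambda>x. h x * indicator C x)" if [measurable]: "C \<in> sets borel" for C
  proof (rule gauss.integrable_const_bound)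
    show "AE x in gauss_measure. norm (h x * indicator C x) \<le> \<bar>m\<bar> + \<bar>M\<bar>"
      using AE_gauss_measure_unit by eventually_elim (use hm in \<open>force split: split_indicator\<close>)
  qed simp
  have h0: "0 \<le> h x" if "x \<in> {0..1}" for x
  proof -
    have "(\<forall>x\<in>{0..1}. 0 \<le> (gauss_transfer ^^ n) f x)"
    proof (induction n)
      case (Suc n)
      let ?h = "(gauss_transfer ^^ n) f"
      have b: "\<bar>?h y\<bar> \<le> \<bar>?h 0\<bar> + \<bar>?h 1\<bar>" if "y \<in> {0..1}" for y
        using gauss_transfer_funpow_monotone[of f n] \<open>antimono_on {0..1} f\<close> that
        by (fastforce simp: monotone_on_def abs_le_iff abs_if)
      show ?case
        unfolding funpow.simps o_def gauss_transfer_def[of ?h] using Suc gauss_point_in_unit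
        by (intro ballI suminf_nonneg gauss_transfer_summable[OF _ b] mult_nonneg_nonneg gauss_weight_nonneg)
           auto
    qed (simp add: f_def)
    with that show ?thesis by (simp add: h_def)
  qed
  have eq: "measure gauss_measure {x. x < s \<and> (gauss_map ^^ n) x \<in> C} = (\<integral>x. h x * indicator C x \<partial>gauss_measure)"
    if [measurable]: "C \<in> sets borel" for C
  proof -
    have "(gauss_map ^^ n) -` C \<inter> space borel \<in> sets borel" by measurable
    then have "{..<s} \<inter> (gauss_map ^^ n) -` C \<in> sets gauss_measure" by simp
    moreover have "{x. x < s \<and> (gauss_map ^^ n) x \<in> C} = {..<s} \<inter> (gauss_map ^^ n) -` C" by auto
    ultimately have "emeasure gauss_measure {x. x < s \<and> (gauss_map ^^ n) x \<in> C}
        = (\<integral>\<^sup>+x. indicator ({..<s} \<inter> (gauss_map ^^ n) -` C) x \<partial>gauss_measure)"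
      by (simp only: nn_integral_indicator)
    also have "\<dots> = (\<integral>\<^sup>+x. ennreal (f x * indicator C ((gauss_map ^^ n) x)) \<partial>gauss_measure)"
      by (intro nn_integral_cong) (simp add: f_def split: split_indicator)
    also have "\<dots> = (\<integral>\<^sup>+x. ennreal (h x * indicator C x) \<partial>gauss_measure)"
      unfolding h_def by (rule nn_integral_gauss_transfer_funpow[where B = 1]) (auto simp: f_def split: split_indicator)
    also have "\<dots> = ennreal (\<integral>x. h x * indicator C x \<partial>gauss_measure)"
      using h01[OF that]
      by (intro nn_integral_eq_integral) (auto intro!: eventually_mono[OF AE_gauss_measure_unit] simp: h0)
    finally have E: "emeasure gauss_measure {x. x < s \<and> (gauss_map ^^ n) x \<in> C}
        = ennreal (\<integral>x. h x * indicator C x \<partial>gauss_measure)" .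
    have "0 \<le> (\<integral>x. h x * indicator C x \<partial>gauss_measure)"
      by (intro integral_nonneg_AE eventually_mono[OF AE_gauss_measure_unit]) (auto simp: h0)
    then show ?thesis by (simp add: measure_def E)
  qed
  have bnd: "m * measure gauss_measure C \<le> (\<integral>x. h x * indicator C x \<partial>gauss_measure)"
    "(\<integral>x. h x * indicator C x \<partial>gauss_measure) \<le> M * measure gauss_measure C" if [measurable]: "C \<in> sets borel" for C
  proof -
    have "(\<integral>x. m * indicator C x \<partial>gauss_measure) \<le> (\<integral>x. h x * indicator C x \<partial>gauss_measure)"
      by (intro integral_mono_AE h01) (auto intro!: eventually_mono[OF AE_gauss_measure_unit] hm split: split_indicator simp: gauss.emeasure_eq_measure)
    then show "m * measure gauss_measure C \<le> (\<integral>x. h x * indicator C x \<partial>gauss_measure)" by simp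
    have "(\<integral>x. h x * indicator C x \<partial>gauss_measure) \<le> (\<integral>x. M * indicator C x \<partial>gauss_measure)"
      by (intro integral_mono_AE h01) (auto intro!: eventually_mono[OF AE_gauss_measure_unit] hm split: split_indicator simp: gauss.emeasure_eq_measure)
    then show "(\<integral>x. h x * indicator C x \<partial>gauss_measure) \<le> M * measure gauss_measure C" by simp
  qed
  define p where "p = measure gauss_measure {..<s}"
  define b where "b = measure gauss_measure B"
  define q where "q = measure gauss_measure {x. x < s \<and> (gauss_map ^^ n) x \<in> B}"
  \<comment> \<open>The case of the whole line shows that the mean of \<open>h\<close> is
    \<open>p\<close>, so \<open>p\<close> lies between \<open>m\<close> and
    \<open>M\<close>.\<close>
  have "{x. x < s \<and> (gauss_map ^^ n) x \<in> UNIV} = {..<s}" by auto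
  then have p: "m \<le> p" "p \<le> M"
    using eq[of UNIV] bnd[of UNIV] gauss.prob_space by (simp_all add: p_def)
  have q: "m * b \<le> q" "q \<le> M * b" using eq[of B] bnd[of B] by (simp_all add: q_def b_def)
  have b: "0 \<le> b" "b \<le> 1" by (simp_all add: b_def)
  have "m * b \<le> p * b" "p * b \<le> M * b" using p b by (auto intro: mult_right_mono)
  then have "\<bar>q - p * b\<bar> \<le> (M - m) * b" using q by (simp add: abs_le_iff algebra_simps)
  also have "\<dots> \<le> (M - m) * 1" using b p by (intro mult_left_mono) auto
  finally show ?thesis using mM by (simp add: p_def q_def b_def)
qed

section \<open>Averages along the squares and a strong law from a variance bound\<close>

text \<open>Between k^2 and the next square there are at most 2 k further terms, each bounded by 1:
  a negligible share of k^2.\<close>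

lemma cesaro_along_squares:
  fixes y :: "nat \<Rightarrow> real"
  assumes y: "\<And>n. \<bar>y n\<bar> \<le> 1"
    and lim: "(\<lambda>k. (\<Sum>j<k\<^sup>2. y j) / real (k\<^sup>2)) \<longlonglongrightarrow> 0"
  shows "(\<lambda>n. (\<Sum>j<n. y j) / real n) \<longlonglongrightarrow> 0"
proof -
  define r where "r k = \<bar>(\<Sum>j<k\<^sup>2. y j) / real (k\<^sup>2)\<bar> + 2 / real k" for k
  have r: "r \<longlonglongrightarrow> 0"
  proof -
    have "r \<longlonglongrightarrow> \<bar>0\<bar> + 0"
      unfolding r_def[abs_def] by (intro tendsto_add tendsto_rabs lim) real_asymp
    then show ?thesis by simp
  qed
  have top: "filterlim floor_sqrt at_top sequentially"
    unfolding filterlim_at_top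
  proof
    fix Z :: nat
    show "eventually (\<lambda>n. Z \<le> floor_sqrt n) sequentially"
      using eventually_ge_at_top[of "Z\<^sup>2"] by eventually_elim (rule le_floor_sqrtI)
  qed
  have bound: "\<bar>(\<Sum>j<n. y j) / real n\<bar> \<le> r (floor_sqrt n)" if n: "n > 0" for n
  proof -
    define k where "k = floor_sqrt n"
    have k: "k\<^sup>2 \<le> n" "n < (Suc k)\<^sup>2" "0 < k"
      using n Suc_floor_sqrt_power2_gt[of n] by (simp_all add: k_def)
    then have "n - k\<^sup>2 \<le> 2 * k" by (simp add: power2_eq_square)
    then have nk: "real (n - k\<^sup>2) \<le> 2 * real k" by linarith
    have "(\<Sum>j<n. y j) = (\<Sum>j<k\<^sup>2. y j) + (\<Sum>j=k\<^sup>2..<n. y j)"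
      using k(1) by (simp add: lessThan_atLeast0 sum.atLeastLessThan_concat)
    moreover have "\<bar>\<Sum>j=k\<^sup>2..<n. y j\<bar> \<le> (\<Sum>j=k\<^sup>2..<n. 1)"
      by (intro order_trans[OF sum_abs] sum_mono y)
    ultimately have "\<bar>\<Sum>j<n. y j\<bar> \<le> \<bar>\<Sum>j<k\<^sup>2. y j\<bar> + 2 * real k"
      using nk by simp
    then have "\<bar>(\<Sum>j<n. y j) / real n\<bar> \<le> (\<bar>\<Sum>j<k\<^sup>2. y j\<bar> + 2 * real k) / real n"
      by (simp add: divide_right_mono)
    also have "\<dots> \<le> (\<bar>\<Sum>j<k\<^sup>2. y j\<bar> + 2 * real k) / real (k\<^sup>2)"
      using k n by (intro divide_left_mono) (auto simp flip: of_nat_power)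
    also have "\<dots> = r k"
      using k by (simp add: r_def add_divide_distrib power2_eq_square)
    finally show ?thesis by (simp add: k_def)
  qed
  show ?thesis
  proof (rule Lim_null_comparison)
    show "eventually (\<lambda>n. norm ((\<Sum>j<n. y j) / real n) \<le> r (floor_sqrt n)) sequentially"
      using eventually_gt_at_top[of 0] by eventually_elim (use bound in simp)
    show "(\<lambda>n. r (floor_sqrt n)) \<longlonglongrightarrow> 0"
      by (rule filterlim_compose[OF r top])
  qed
qed

text \<open>Along the squares the second moments of the averages are O(1 / k^2), hence summable. The
  sum of the squared averages then has finite expectation, so almost surely it is finite and its
  terms tend to 0.\<close>

lemma (in prob_space) AE_cesaro_of_variance_bound:
  fixes Y :: "nat \<Rightarrow> 'a \<Rightarrow> real"
  assumes [measurable]: "\<And>n. Y n \<in> borel_measurable M" and Y: "\<And>n x. \<bar>Y n x\<bar> \<le> 1"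
    and var: "\<And>n. expectation (\<lambda>x. (\<Sum>j<n. Y j x)\<^sup>2) \<le> C * real n"
  shows "AE x in M. (\<lambda>n. (\<Sum>j<n. Y j x) / real n) \<longlonglongrightarrow> 0"
proof -
  define Z where "Z k x = ((\<Sum>j<(Suc k)\<^sup>2. Y j x) / real ((Suc k)\<^sup>2))\<^sup>2" for k x
  have [measurable]: "Z k \<in> borel_measurable M" for k unfolding Z_def by measurable
  have S: "\<bar>\<Sum>j<n. Y j x\<bar> \<le> real n" for n x
  proof -
    have "\<bar>\<Sum>j<n. Y j x\<bar> \<le> (\<Sum>j<n. 1)"
      by (intro order_trans[OF sum_abs] sum_mono Y)
    then show ?thesis by simp
  qed
  have EZ: "(\<integral>\<^sup>+x. ennreal (Z k x) \<partial>M) \<le> ennreal (\<bar>C\<bar> * (1 / real ((Suc k)\<^sup>2)))" for k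
  proof -
    let ?n = "(Suc k)\<^sup>2"
    have int: "integrable M (\<lambda>x. (\<Sum>j<?n. Y j x)\<^sup>2)"
    proof (rule integrable_const_bound)
      have "(\<Sum>j<?n. Y j x)\<^sup>2 \<le> (real ?n)\<^sup>2" for x
        using power_mono[OF S[of x ?n], of 2] by (simp only: power2_abs abs_ge_zero)
      then show "AE x in M. norm ((\<Sum>j<?n. Y j x)\<^sup>2) \<le> (real ?n)\<^sup>2" by simp
    qed simp
    have "(\<integral>\<^sup>+x. ennreal (Z k x) \<partial>M) = ennreal (expectation (\<lambda>x. (\<Sum>j<?n. Y j x)\<^sup>2 / (real ?n)\<^sup>2))"
      unfolding Z_def power_divide by (intro nn_integral_eq_integral) (use int in auto)
    also have "expectation (\<lambda>x. (\<Sum>j<?n. Y j x)\<^sup>2 / (real ?n)\<^sup>2) \<le> C * real ?n / (real ?n)\<^sup>2"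
      using var[of ?n] by (simp add: divide_right_mono)
    also have "C * real ?n / (real ?n)\<^sup>2 = C * (1 / real ?n)"
      by (simp add: power2_eq_square)
    also have "\<dots> \<le> \<bar>C\<bar> * (1 / real ?n)" by (intro mult_right_mono) auto
    finally show ?thesis by (simp add: ennreal_leI)
  qed
  have sum: "summable (\<lambda>k. \<bar>C\<bar> * (1 / real ((Suc k)\<^sup>2)))"
  proof (rule summable_mult)
    have "summable (\<lambda>k. 1 / real k ^ 2)"
      using inverse_power_summable[of 2, where 'a = real] by (simp add: inverse_eq_divide)
    then show "summable (\<lambda>k. 1 / real ((Suc k)\<^sup>2))"
      using summable_Suc_iff[of "\<lambda>k. 1 / real k ^ 2"] by (simp only: of_nat_power)
  qed
  have "(\<integral>\<^sup>+x. (\<Sum>k. ennreal (Z k x)) \<partial>M) = (\<Sum>k. \<integral>\<^sup>+x. ennreal (Z k x) \<partial>M)"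
    by (rule nn_integral_suminf) measurable
  also have "\<dots> \<le> (\<Sum>k. ennreal (\<bar>C\<bar> * (1 / real ((Suc k)\<^sup>2))))"
    by (intro suminf_le EZ) auto
  also have "\<dots> < \<infinity>"
    using sum by (subst suminf_ennreal2) (auto simp: less_top)
  finally have "AE x in M. (\<Sum>k. ennreal (Z k x)) \<noteq> \<infinity>"
    by (intro nn_integral_PInf_AE) auto
  then show ?thesis
  proof eventually_elim
    case (elim x)
    have "summable (\<lambda>k. Z k x)"
      using elim by (intro summable_suminf_not_top) (auto simp: Z_def)
    then have "(\<lambda>k. Z k x) \<longlonglongrightarrow> 0" by (rule summable_LIMSEQ_zero)
    then have "(\<lambda>k. sqrt (Z k x)) \<longlonglongrightarrow> sqrt 0" by (rule tendsto_real_sqrt)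
    then have "(\<lambda>k. \<bar>(\<Sum>j<(Suc k)\<^sup>2. Y j x) / real ((Suc k)\<^sup>2)\<bar>) \<longlonglongrightarrow> 0"
      by (simp add: Z_def del: of_nat_power of_nat_Suc)
    then have "(\<lambda>k. (\<Sum>j<(Suc k)\<^sup>2. Y j x) / real ((Suc k)\<^sup>2)) \<longlonglongrightarrow> 0"
      by (simp only: tendsto_rabs_zero_iff)
    then have "(\<lambda>k. (\<Sum>j<k\<^sup>2. Y j x) / real (k\<^sup>2)) \<longlonglongrightarrow> 0"
      by (rule LIMSEQ_imp_Suc)
    then show ?case by (rule cesaro_along_squares[rotated]) (rule Y)
  qed
qed

lemma AE_gauss_frequency_lessThan:
  assumes s: "0 \<le> s" "s \<le> 1"
  shows "AE x in gauss_measure.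
    (\<lambda>n. real (card {j. j < n \<and> (gauss_map ^^ j) x < s}) / real n) \<longlonglongrightarrow> ln (1 + s) / ln 2"
proof -
  define p where "p = measure gauss_measure {..<s}"
  define Y where "Y j x = indicator {..<s} ((gauss_map ^^ j) x) - p" for j :: nat and x
  have p: "0 \<le> p" "p \<le> 1" by (simp_all add: p_def)
  have [measurable]: "Y j \<in> borel_measurable gauss_measure" for j
    unfolding Y_def by measurable
  have Y1: "\<bar>Y j x\<bar> \<le> 1" for j x
    using p by (auto simp: Y_def indicator_def)
  have intY: "integrable gauss_measure (\<lambda>x. Y i x * Y j x)" for i j
  proof (rule gauss.integrable_const_bound)
    show "AE x in gauss_measure. norm (Y i x * Y j x) \<le> 1"
      using Y1 by (auto simp: abs_mult intro!: mult_le_one)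
  qed simp
  have cor0: "(\<integral>x. Y 0 x * Y n x \<partial>gauss_measure) \<le> (1 / 2) ^ n" for n
  proof -
    let ?A = "{x. x < s \<and> (gauss_map ^^ n) x \<in> {..<s}}" and ?B = "{x. (gauss_map ^^ n) x \<in> {..<s}}"
    have [measurable]: "?B \<in> sets borel" "?A \<in> sets borel"
    proof -
      have "(gauss_map ^^ n) -` {..<s} \<inter> space borel \<in> sets borel" by measurable
      moreover have "?B = (gauss_map ^^ n) -` {..<s} \<inter> space borel" "?A = {..<s} \<inter> ?B" by auto
      ultimately show "?B \<in> sets borel" "?A \<in> sets borel" by auto
    qed
    have B: "measure gauss_measure ?B = p"
    proof -
      have "measure (distr gauss_measure borel (gauss_map ^^ n)) {..<s} = measure gauss_measure ?B"
        by (subst measure_distr) (auto simp: vimage_def)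
      then show ?thesis by (simp add: distr_gauss_map_funpow p_def)
    qed
    have "(\<integral>x. Y 0 x * Y n x \<partial>gauss_measure)
        = (\<integral>x. indicator ?A x - p * indicator {..<s} x - p * indicator ?B x + p * p \<partial>gauss_measure)"
      by (intro Bochner_Integration.integral_cong) (auto simp: Y_def indicator_def algebra_simps)
    also have "\<dots> = measure gauss_measure ?A - p * p - p * p + p * p"
      using gauss.prob_space by (simp add: gauss.emeasure_eq_measure B[simplified] p_def)
    also have "\<dots> \<le> (1 / 2) ^ n"
      using gauss_map_mixing[of "{..<s}" s n] by (simp add: p_def)
    finally show ?thesis .
  qed
  have cor: "(\<integral>x. Y i x * Y j x \<partial>gauss_measure) \<le> (1 / 2) ^ (j - i)" if "i \<le> j" for i j
  proof -
    \<comment> \<open>By invariance a correlation depends only on the time lag.\<close>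
    have sh: "Y i x = Y 0 ((gauss_map ^^ i) x)" "Y j x = Y (j - i) ((gauss_map ^^ i) x)" for x
      using that by (auto simp: Y_def funpow_add[of "j - i" i, THEN fun_cong, symmetric, unfolded o_def])
    have "(\<integral>x. Y i x * Y j x \<partial>gauss_measure)
        = (\<integral>x. Y 0 x * Y (j - i) x \<partial>distr gauss_measure borel (gauss_map ^^ i))"
      unfolding sh by (rule integral_distr[symmetric]) measurable
    then show ?thesis using cor0[of "j - i"] by (simp add: distr_gauss_map_funpow)
  qed
  \<comment> \<open>The constant 3: each new term adds its own second moment, at most 1, and twice a
    geometric sum of correlations, at most 2.\<close>
  have var: "(\<integral>x. (\<Sum>j<n. Y j x)\<^sup>2 \<partial>gauss_measure) \<le> 3 * real n" for n
  proof (induction n)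
    case (Suc n)
    have "(\<lambda>x. (\<Sum>j<Suc n. Y j x)\<^sup>2)
        = (\<lambda>x. (\<Sum>j<n. Y j x)\<^sup>2 + 2 * (\<Sum>j<n. Y j x * Y n x) + Y n x * Y n x)"
      by (auto simp: fun_eq_iff power2_eq_square algebra_simps sum_distrib_left sum_distrib_right)
    moreover have "integrable gauss_measure (\<lambda>x. (\<Sum>j<n. Y j x)\<^sup>2)"
      unfolding power2_eq_square sum_product by (intro Bochner_Integration.integrable_sum intY)
    ultimately have "(\<integral>x. (\<Sum>j<Suc n. Y j x)\<^sup>2 \<partial>gauss_measure)
        = (\<integral>x. (\<Sum>j<n. Y j x)\<^sup>2 \<partial>gauss_measure)
          + 2 * (\<Sum>j<n. \<integral>x. Y j x * Y n x \<partial>gauss_measure) + (\<integral>x. Y n x * Y n x \<partial>gauss_measure)"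
      using intY by (simp add: Bochner_Integration.integral_sum)
    also have "\<dots> \<le> 3 * real n + 2 * (\<Sum>j<n. (1 / 2) ^ (n - j)) + (1 / 2) ^ (n - n)"
      by (intro add_mono mult_left_mono sum_mono cor Suc) auto
    also have "(\<Sum>j<n. (1 / 2 :: real) ^ (n - j)) = 1 - (1 / 2) ^ n"
    proof -
      have "(\<Sum>j<n. (1 / 2 :: real) ^ (n - j)) = (\<Sum>j<n. (1 / 2) ^ Suc j)"
        by (subst sum.nat_diff_reindex[symmetric]) (auto intro!: sum.cong simp: Suc_diff_Suc)
      also have "\<dots> = 1 - (1 / 2) ^ n" by (induction n) auto
      finally show ?thesis .
    qed
    finally have "(\<integral>x. (\<Sum>j<Suc n. Y j x)\<^sup>2 \<partial>gauss_measure)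
        \<le> 3 * real n + 2 * (1 - (1 / 2) ^ n) + (1 / 2) ^ (n - n)" .
    also have "3 * real n + 2 * (1 - (1 / 2) ^ n) + (1 / 2) ^ (n - n) \<le> 3 * real (Suc n)"
      by simp
    finally show ?case .
  qed simp
  have "AE x in gauss_measure. (\<lambda>n. (\<Sum>j<n. Y j x) / real n) \<longlonglongrightarrow> 0"
    by (rule gauss.AE_cesaro_of_variance_bound[OF _ Y1 var]) measurable
  then show ?thesis
  proof eventually_elim
    case (elim x)
    have sum: "(\<Sum>j<n. Y j x) = real (card {j. j < n \<and> (gauss_map ^^ j) x < s}) - real n * p" for n
    proof -
      have "(\<Sum>j<n. indicator {..<s} ((gauss_map ^^ j) x) :: real)
          = (\<Sum>j\<in>{j. j < n \<and> (gauss_map ^^ j) x < s}. 1)"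
        by (intro sum.mono_neutral_cong_right) (auto simp: indicator_def)
      then show ?thesis by (simp add: Y_def sum_subtractf)
    qed
    have "(\<lambda>n. (\<Sum>j<n. Y j x) / real n + p) \<longlonglongrightarrow> 0 + p"
      by (intro tendsto_add elim tendsto_const)
    moreover have "eventually (\<lambda>n. (\<Sum>j<n. Y j x) / real n + p
        = real (card {j. j < n \<and> (gauss_map ^^ j) x < s}) / real n) sequentially"
      using eventually_gt_at_top[of 0] by eventually_elim (simp add: sum field_simps)
    ultimately show ?case
      using tendsto_cong measure_gauss_lessThan[OF s] by (force simp: p_def)
  qed
qed

subsection \<open>Cylinders\<close>

fun cf_word :: "nat \<Rightarrow> real \<Rightarrow> int list" where
  "cf_word 0 y = []"
| "cf_word (Suc k) y = \<lfloor>1 / y\<rfloor> # cf_word k (gauss_map y)"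

text \<open>Endpoints of the interval of points whose expansion starts with the given digits. Each
  digit acts by an orientation-reversing branch, so lower and upper endpoints exchange roles in the
  recursion; the empty word stands for (0, 1).\<close>

fun cf_lo :: "int list \<Rightarrow> real" and cf_hi :: "int list \<Rightarrow> real" where
  "cf_lo [] = 0"
| "cf_lo (a # as) = 1 / (of_int a + cf_hi as)"
| "cf_hi [] = 1"
| "cf_hi (a # as) = 1 / (of_int a + cf_lo as)"

text \<open>The exponential of the integral of (1 + t v)^(-2) over the rectangle of the cylinders of
  \<open>c\<close> (future, t) and \<open>b\<close> (past, v), since ln (1 + t v) has that mixed
  derivative. For empty \<open>b\<close> its logarithm is ln 2 times the Gauss measure of the
  cylinder of \<open>c\<close>.\<close>

definition cf_cross :: "int list \<Rightarrow> int list \<Rightarrow> real" where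
  "cf_cross c b = (1 + cf_hi c * cf_hi b) * (1 + cf_lo c * cf_lo b)
    / ((1 + cf_lo c * cf_hi b) * (1 + cf_hi c * cf_lo b))"

lemma irrational_unit_imp:
  assumes "x \<in> {0<..<1} - \<rat>"
  shows "gauss_map x \<in> {0<..<1} - \<rat>" "1 \<le> \<lfloor>1 / x\<rfloor>" "1 / x = of_int \<lfloor>1 / x\<rfloor> + gauss_map x"
proof -
  show e: "1 / x = of_int \<lfloor>1 / x\<rfloor> + gauss_map x" by (simp add: gauss_map_def frac_def)
  show "1 \<le> \<lfloor>1 / x\<rfloor>" using assms by simp
  have "gauss_map x \<notin> \<rat>"
  proof
    assume "gauss_map x \<in> \<rat>"
    then have "1 / x \<in> \<rat>" by (subst e) (intro Rats_add Rats_of_int)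
    then have "1 / (1 / x) \<in> \<rat>" by (rule Rats_divide[OF Rats_1])
    with assms show False by simp
  qed
  moreover from this have "gauss_map x \<noteq> 0" by auto
  moreover have "0 \<le> gauss_map x" "gauss_map x < 1" by (simp_all add: gauss_map_def frac_lt_1)
  ultimately show "gauss_map x \<in> {0<..<1} - \<rat>" by auto
qed

lemma irrational_unit_funpow:
  "x \<in> {0<..<1} - \<rat> \<Longrightarrow> (gauss_map ^^ n) x \<in> {0<..<1} - \<rat>"
proof (induction n)
  case (Suc n)
  show ?case using irrational_unit_imp(1)[OF Suc.IH[OF Suc.prems]] by simp
qed simp

lemma length_cf_word [simp]: "length (cf_word k y) = k"
  by (induction k y rule: cf_word.induct) auto

lemma cf_word_add: "cf_word (k + l) y = cf_word k y @ cf_word l ((gauss_map ^^ k) y)"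
  by (induction k y rule: cf_word.induct) (auto simp: funpow_swap1)

lemma cf_word_pos: "x \<in> {0<..<1} - \<rat> \<Longrightarrow> a \<in> set (cf_word k x) \<Longrightarrow> 1 \<le> a"
proof (induction k x rule: cf_word.induct)
  case (2 k y)
  then show ?case using irrational_unit_imp[OF 2(2)] by auto
qed simp

lemma cf_cylinder_bounds:
  "(\<And>a. a \<in> set as \<Longrightarrow> 1 \<le> a) \<Longrightarrow> 0 \<le> cf_lo as \<and> cf_lo as < cf_hi as \<and> cf_hi as \<le> 1"
proof (induction as)
  case (Cons a as)
  then have "0 \<le> cf_lo as" "cf_lo as < cf_hi as" "cf_hi as \<le> 1" "1 \<le> real_of_int a" by auto
  then show ?case by (simp add: divide_simps)
qed simp

lemma cf_endpoints_rational: "cf_lo as \<in> \<rat>" "cf_hi as \<in> \<rat>"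
  by (induction as) auto

lemma cf_word_eq_iff:
  assumes "\<And>a. a \<in> set as \<Longrightarrow> 1 \<le> a" and "y \<in> {0<..<1} - \<rat>"
  shows "cf_word (length as) y = as \<longleftrightarrow> cf_lo as < y \<and> y < cf_hi as"
  using assms
proof (induction as arbitrary: y)
  case (Cons a as)
  define t where "t = gauss_map y"
  note y = irrational_unit_imp[OF Cons.prems(2), folded t_def]
  have t: "0 < t" "t < 1" and y0: "0 < y" using y(1) Cons.prems(2) by auto
  have b: "0 \<le> cf_lo as" "cf_lo as < cf_hi as" "cf_hi as \<le> 1"
    using cf_cylinder_bounds[of as] Cons.prems(1) by auto
  have a: "1 \<le> real_of_int a" using Cons.prems(1)[of a] by simp
  have "cf_word (length (a # as)) y = a # as \<longleftrightarrow> \<lfloor>1 / y\<rfloor> = a \<and> cf_lo as < t \<and> t < cf_hi as"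
    using Cons.IH[of t] Cons.prems y(1) by (simp add: t_def)
  also have "\<dots> \<longleftrightarrow> of_int a + cf_lo as < 1 / y \<and> 1 / y < of_int a + cf_hi as"
  proof
    assume "\<lfloor>1 / y\<rfloor> = a \<and> cf_lo as < t \<and> t < cf_hi as"
    then show "of_int a + cf_lo as < 1 / y \<and> 1 / y < of_int a + cf_hi as"
      using y(3) by auto
  next
    assume A: "of_int a + cf_lo as < 1 / y \<and> 1 / y < of_int a + cf_hi as"
    then have "\<lfloor>1 / y\<rfloor> = a" using b by linarith
    then show "\<lfloor>1 / y\<rfloor> = a \<and> cf_lo as < t \<and> t < cf_hi as" using A y(3) by auto
  qed
  also have "\<dots> \<longleftrightarrow> cf_lo (a # as) < y \<and> y < cf_hi (a # as)"
    using y0 a b by (auto simp: field_simps)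
  finally show ?case .
qed simp

lemma cf_word_bounds:
  "y \<in> {0<..<1} - \<rat> \<Longrightarrow> cf_lo (cf_word k y) < y \<and> y < cf_hi (cf_word k y)"
  using cf_word_eq_iff[of "cf_word k y" y] cf_word_pos[of y _ k] by simp

text \<open>The induction takes two digits at a time: the branch of digit 1 hardly contracts near 0,
  whereas two inverse branches together divide the length by (a (b + h) + 1) (a (b + l) + 1) >=
  4.\<close>

lemma cf_cylinder_width:
  "(\<And>a. a \<in> set as \<Longrightarrow> 1 \<le> a) \<Longrightarrow> cf_hi as - cf_lo as \<le> (1 / 4) ^ (length as div 2)"
proof (induction as rule: induct_list012)
  case (2 a)
  then have "0 \<le> cf_lo [a]" "cf_hi [a] \<le> 1" using cf_cylinder_bounds[of "[a]"] by blast+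
  then show ?case by (simp del: cf_lo.simps cf_hi.simps)
next
  case (3 a b as)
  define l h where "l = cf_lo as" and "h = cf_hi as"
  have lh: "0 \<le> l" "l < h" and IH: "h - l \<le> (1 / 4) ^ (length as div 2)"
    using 3 cf_cylinder_bounds[of as] by (auto simp: l_def h_def)
  have ab: "1 \<le> real_of_int a" "1 \<le> real_of_int b" using 3(3)[of a] 3(3)[of b] by simp_all
  have m: "1 * 1 \<le> a * (b + l)" "1 * 1 \<le> a * (b + h)"
    using ab lh by (intro mult_mono; simp)+
  have e: "1 / (a + 1 / (b + s)) = (b + s) / (a * (b + s) + 1)" if "0 \<le> s" for s :: real
    using that ab by (simp add: divide_simps)
  have "cf_hi (a # b # as) - cf_lo (a # b # as) = (b + h) / (a * (b + h) + 1) - (b + l) / (a * (b + l) + 1)"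
    using e[of l] e[of h] lh by (simp add: l_def h_def)
  also have "\<dots> = (h - l) / ((a * (b + h) + 1) * (a * (b + l) + 1))"
    using m by (simp add: divide_simps) (simp add: algebra_simps)
  also have "\<dots> \<le> (h - l) / (2 * 2)"
    using m lh by (intro divide_left_mono mult_mono mult_pos_pos) auto
  also have "\<dots> \<le> (1 / 4) ^ (length (a # b # as) div 2)"
    using IH by simp
  finally show ?case .
qed simp

text \<open>Invariance of (1 + t v)^(-2) dt dv when the first future digit becomes the latest past
  digit. Writing 1 + r / (A + q) as (A + q + r) / (A + q) in every factor, the denominators cancel
  and the remaining sums are symmetric in past and future.\<close>

lemma cf_cross_shift:
  assumes "1 \<le> a" "\<And>a. a \<in> set b \<Longrightarrow> 1 \<le> a" "\<And>a. a \<in> set c \<Longrightarrow> 1 \<le> a"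
  shows "cf_cross (a # c) b = cf_cross c (a # b)"
proof -
  define A l h l' h' where "A = real_of_int a" and "l = cf_lo c" and "h = cf_hi c"
    and "l' = cf_lo b" and "h' = cf_hi b"
  note defs = A_def[symmetric] l_def[symmetric] h_def[symmetric] l'_def[symmetric] h'_def[symmetric]
  have nn: "0 \<le> l" "0 \<le> h" "0 \<le> l'" "0 \<le> h'" "1 \<le> A"
    using cf_cylinder_bounds[of b] cf_cylinder_bounds[of c] assms
    unfolding A_def l_def h_def l'_def h'_def by fastforce+
  have e: "1 + r / (A + q) = (A + q + r) / (A + q)" if "0 \<le> q" for q r
    using that nn by (simp add: field_simps)
  have "cf_cross (a # c) b = ((A + l + h') / (A + l)) * ((A + h + l') / (A + h))
      / (((A + h + h') / (A + h)) * ((A + l + l') / (A + l)))"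
    unfolding cf_cross_def cf_lo.simps cf_hi.simps defs
    using nn by (simp add: e)
  also have "\<dots> = ((A + l + h') * (A + h + l')) / ((A + h + h') * (A + l + l'))"
    using nn by simp
  also have "\<dots> = ((A + l' + h) / (A + l')) * ((A + h' + l) / (A + h'))
      / (((A + l' + l) / (A + l')) * ((A + h' + h) / (A + h')))"
    using nn by (simp add: ac_simps)
  also have "\<dots> = cf_cross c (a # b)"
    unfolding cf_cross_def cf_lo.simps cf_hi.simps defs
    using nn by (simp add: e mult.commute)
  finally show ?thesis .
qed

text \<open>A rectangle in (t, v) has the mass of the one-sided cylinder of the whole block, so
  two-sided frequencies follow from Gauss measure. The past is stored with its latest digit first,
  hence \<open>rev\<close>.\<close>

lemma cf_cross_rev_append:
  "(\<And>a. a \<in> set b \<Longrightarrow> 1 \<le> a) \<Longrightarrow> (\<And>a. a \<in> set c \<Longrightarrow> 1 \<le> a)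
    \<Longrightarrow> cf_cross (rev b @ c) [] = cf_cross c b"
proof (induction b arbitrary: c)
  case (Cons a b)
  have "cf_cross (rev b @ (a # c)) [] = cf_cross (a # c) b"
    by (rule Cons.IH) (use Cons.prems in auto)
  also have "\<dots> = cf_cross c (a # b)" by (rule cf_cross_shift) (use Cons.prems in auto)
  finally show ?case by simp
qed simp

text \<open>Rational thresholds keep the number of conditions countable and still include all
  cylinder endpoints (\<open>cf_endpoints_rational\<close>).\<close>

definition gauss_generic :: "real \<Rightarrow> bool" where
  "gauss_generic x \<longleftrightarrow> x \<in> {0<..<1} - \<rat> \<and> (\<forall>s\<in>\<rat> \<inter> {0..1}.
    (\<lambda>n. real (card {j. j < n \<and> (gauss_map ^^ j) x < s}) / real n) \<longlonglongrightarrow> ln (1 + s) / ln 2)"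

lemma AE_gauss_generic: "AE x in lborel. x \<in> {0<..<1} - \<rat> \<longrightarrow> gauss_generic x"
proof -
  have "AE x in gauss_measure. \<forall>s\<in>\<rat> \<inter> {0..1}.
    (\<lambda>n. real (card {j. j < n \<and> (gauss_map ^^ j) x < s}) / real n) \<longlonglongrightarrow> ln (1 + s) / ln 2"
    by (intro AE_ball_countable[THEN iffD2] ballI AE_gauss_frequency_lessThan countable_Int1 countable_rat) auto
  then show ?thesis
    unfolding gauss_measure_def
    by (subst (asm) AE_density) (auto simp: gauss_generic_def elim!: eventually_mono)
qed

text \<open>A cylinder is a difference of two half-lines; its lower endpoint is rational and never
  met by the orbit, so the strict inequalities lose no visit.\<close>

lemma gauss_generic_word_frequency:
  assumes x: "gauss_generic x" and c: "\<And>a. a \<in> set c \<Longrightarrow> 1 \<le> a"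
  shows "(\<lambda>n. real (card {j. j < n \<and> cf_word (length c) ((gauss_map ^^ j) x) = c}) / real n)
    \<longlonglongrightarrow> ln (cf_cross c []) / ln 2"
proof -
  have irr: "(gauss_map ^^ j) x \<in> {0<..<1} - \<rat>" for j
    using x irrational_unit_funpow by (simp add: gauss_generic_def)
  have b: "0 \<le> cf_lo c" "cf_lo c < cf_hi c" "cf_hi c \<le> 1" using cf_cylinder_bounds[of c] c by auto
  have eq: "real (card {j. j < n \<and> cf_word (length c) ((gauss_map ^^ j) x) = c})
      = real (card {j. j < n \<and> (gauss_map ^^ j) x < cf_hi c})
        - real (card {j. j < n \<and> (gauss_map ^^ j) x < cf_lo c})" for n
  proof -
    have ne: "(gauss_map ^^ j) x \<noteq> cf_lo c" for j
      using irr[of j] cf_endpoints_rational(1)[of c] by auto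
    have "{j. j < n \<and> cf_word (length c) ((gauss_map ^^ j) x) = c}
      = {j. j < n \<and> (gauss_map ^^ j) x < cf_hi c} - {j. j < n \<and> (gauss_map ^^ j) x < cf_lo c}"
      using cf_word_eq_iff[OF c irr] ne by (auto simp: not_less less_le)
    moreover have "{j. j < n \<and> (gauss_map ^^ j) x < cf_lo c} \<subseteq> {j. j < n \<and> (gauss_map ^^ j) x < cf_hi c}"
      using b by auto
    ultimately show ?thesis
      by (simp add: card_Diff_subset card_mono of_nat_diff)
  qed
  have "(\<lambda>n. real (card {j. j < n \<and> (gauss_map ^^ j) x < cf_hi c}) / real n
        - real (card {j. j < n \<and> (gauss_map ^^ j) x < cf_lo c}) / real n)
      \<longlonglongrightarrow> ln (1 + cf_hi c) / ln 2 - ln (1 + cf_lo c) / ln 2"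
    using x b cf_endpoints_rational[of c] unfolding gauss_generic_def
    by (intro tendsto_diff) auto
  moreover have "ln (1 + cf_hi c) / ln 2 - ln (1 + cf_lo c) / ln 2 = ln (cf_cross c []) / ln 2"
    using b by (simp add: cf_cross_def ln_div diff_divide_distrib)
  ultimately show ?thesis by (simp add: eq diff_divide_distrib)
qed

section \<open>The ratio of consecutive denominators\<close>

text \<open>This is v_n = q_{n-1} / q_n, by q_{n+1} = a_{n+1} q_n + q_{n-1}; the start value 0
  reflects q_{-1} = 0.\<close>

fun cf_ratio :: "real \<Rightarrow> nat \<Rightarrow> real" where
  "cf_ratio x 0 = 0"
| "cf_ratio x (Suc n) = 1 / (of_int \<lfloor>1 / (gauss_map ^^ n) x\<rfloor> + cf_ratio x n)"

lemma cf_ratio_bounds: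
  assumes "x \<in> {0<..<1} - \<rat>"
  shows "0 \<le> cf_ratio x n \<and> cf_ratio x n \<le> 1"
proof (induction n)
  case (Suc n)
  have "1 \<le> \<lfloor>1 / (gauss_map ^^ n) x\<rfloor>"
    by (rule irrational_unit_imp(2)[OF irrational_unit_funpow[OF assms]])
  then have "1 \<le> of_int \<lfloor>1 / (gauss_map ^^ n) x\<rfloor> + cf_ratio x n" using Suc by linarith
  then show ?case unfolding cf_ratio.simps by (meson divide_le_eq_1_pos zero_le_divide_1_iff order_trans less_le_trans zero_less_one zero_le_one)
qed simp

text \<open>Unfolding the recursion gives v_n = [a_n, ..., a_1], so the \<open>k\<close> latest
  digits in reverse order locate it. The bounds are weak because v_n is rational and can be an
  endpoint, as happens for j = 0.\<close>

lemma cf_ratio_mem_cylinder: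
  assumes "x \<in> {0<..<1} - \<rat>"
  shows "cf_lo (rev (cf_word k ((gauss_map ^^ j) x))) \<le> cf_ratio x (j + k)
    \<and> cf_ratio x (j + k) \<le> cf_hi (rev (cf_word k ((gauss_map ^^ j) x)))"
proof (induction k)
  case 0
  then show ?case using cf_ratio_bounds[OF assms] by simp
next
  case (Suc k)
  define y where "y = (gauss_map ^^ j) x"
  define a where "a = \<lfloor>1 / (gauss_map ^^ (j + k)) x\<rfloor>"
  have "1 \<le> a" unfolding a_def by (rule irrational_unit_imp(2)[OF irrational_unit_funpow[OF assms]])
  then have a: "1 \<le> real_of_int a" by simp
  have yk: "(gauss_map ^^ k) y = (gauss_map ^^ (j + k)) x"
    by (simp add: y_def add.commute[of j] funpow_add)
  have w: "rev (cf_word (Suc k) y) = a # rev (cf_word k y)"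
    using cf_word_add[of k 1 y] yk by (simp add: a_def)
  have pos: "1 \<le> a" if "a \<in> set (rev (cf_word k y))" for a
    using that cf_word_pos[OF irrational_unit_funpow[OF assms], of _ k j] by (simp add: y_def)
  have "0 \<le> cf_lo (rev (cf_word k y))" "0 \<le> cf_ratio x (j + k)" "0 \<le> cf_hi (rev (cf_word k y))"
    using cf_cylinder_bounds[OF pos, of "rev (cf_word k y)"] cf_ratio_bounds[OF assms] by auto
  with Suc a show ?case
    unfolding y_def[symmetric] w add_Suc_right cf_ratio.simps a_def[symmetric] cf_lo.simps cf_hi.simps
    by (auto intro!: divide_left_mono mult_pos_pos add_pos_nonneg)
qed

subsection \<open>The approximation coefficients\<close>

text \<open>A real tail \<open>s\<close> is added to the last digit: on the first n digits of x, s =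
  T^n x recovers x and s = 0 gives the n-th convergent.\<close>

fun cf_eval :: "int list \<Rightarrow> real \<Rightarrow> real" where
  "cf_eval [] s = s"
| "cf_eval (a # as) s = 1 / (of_int a + cf_eval as s)"

lemma cf_eval_snoc: "cf_eval (as @ [a]) s = cf_eval as (1 / (of_int a + s))"
  by (induction as) auto

lemma of_rat_cf_value: "of_rat (cf_value as) = cf_eval as 0"
  by (induction as) (auto simp: of_rat_divide of_rat_add)

lemma cf_word_Suc_snoc: "cf_word (Suc n) x = cf_word n x @ [\<lfloor>1 / (gauss_map ^^ n) x\<rfloor>]"
  using cf_word_add[of n 1 x] by simp

lemma cf_word_eq_map_digit: "map (cf_digit x) [1..<n + 1] = cf_word n x"
  by (induction n) (simp_all add: cf_word_Suc_snoc cf_digit_def del: cf_word.simps(2))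

lemma cf_eval_cf_word:
  assumes "x \<in> {0<..<1} - \<rat>"
  shows "cf_eval (cf_word n x) ((gauss_map ^^ n) x) = x"
proof (induction n)
  case (Suc n)
  have "1 / (of_int \<lfloor>1 / (gauss_map ^^ n) x\<rfloor> + (gauss_map ^^ Suc n) x) = (gauss_map ^^ n) x"
    using irrational_unit_imp(3)[OF irrational_unit_funpow[OF assms, of n]] by (metis comp_apply div_by_1 divide_divide_eq_right funpow.simps(2) mult_1)
  then show ?case using Suc by (simp add: cf_word_Suc_snoc cf_eval_snoc del: cf_word.simps(2) funpow.simps(2))
qed simp

text \<open>The integers P, P', Q, Q' are p_n, p_{n-1}, q_n, q_{n-1}. Since numerators and
  denominators are defined through lowest terms and not by recursion, the determinant is carried
  along to identify them.\<close>

lemma cf_word_moebius: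
  assumes x: "x \<in> {0<..<1} - \<rat>"
  shows "\<exists>(P::int) (P'::int) (Q::int) (Q'::int). 0 < Q \<and> 0 \<le> Q' \<and> \<bar>P * Q' - P' * Q\<bar> = 1 \<and> cf_ratio x n = of_int Q' / of_int Q
    \<and> (\<forall>s::real. 0 \<le> s \<longrightarrow>
        cf_eval (cf_word n x) s = (of_int P + s * of_int P') / (of_int Q + s * of_int Q'))"
proof (induction n)
  case 0
  \<comment> \<open>The values p_0 = 0, p_{-1} = 1, q_0 = 1, q_{-1} = 0.\<close>
  show ?case by (intro exI[of _ 0] exI[of _ 1] conjI) auto
next
  case (Suc n)
  then obtain P P' Q Q' :: int where Q: "0 < Q" "0 \<le> Q'" and det: "\<bar>P * Q' - P' * Q\<bar> = 1"
    and v: "cf_ratio x n = of_int Q' / of_int Q"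
    and ev: "\<And>s::real. 0 \<le> s \<Longrightarrow>
        cf_eval (cf_word n x) s = (of_int P + s * of_int P') / (of_int Q + s * of_int Q')"
    by blast
  define a where "a = \<lfloor>1 / (gauss_map ^^ n) x\<rfloor>"
  have a: "1 \<le> a" unfolding a_def by (rule irrational_unit_imp(2)[OF irrational_unit_funpow[OF x]])
  have "0 < a * Q" using a Q by simp
  then have Qn: "0 < a * Q + Q'" using Q by simp
  have "cf_eval (cf_word (Suc n) x) s = (of_int (a * P + P') + s * P) / (of_int (a * Q + Q') + s * Q)"
    if s: "0 \<le> s" for s :: real
  proof -
    define d where "d = of_int a + s"
    have d: "d > 0" using a s by (simp add: d_def)
    have "cf_eval (cf_word (Suc n) x) s = (P + 1 / d * P') / (Q + 1 / d * Q')"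
      using ev[of "1 / d"] d by (simp add: cf_word_Suc_snoc cf_eval_snoc a_def d_def del: cf_word.simps(2))
    also have "\<dots> = (d * (P + 1 / d * P')) / (d * (Q + 1 / d * Q'))"
      using d by simp
    also have "d * (P + 1 / d * P') = of_int (a * P + P') + s * P"
      using d by (simp add: distrib_left) (simp add: d_def algebra_simps)
    also have "d * (Q + 1 / d * Q') = of_int (a * Q + Q') + s * Q"
      using d by (simp add: distrib_left) (simp add: d_def algebra_simps)
    finally show ?thesis .
  qed
  moreover have "\<bar>(a * P + P') * Q - P * (a * Q + Q')\<bar> = 1"
    using det by (simp add: algebra_simps abs_minus_commute)
  moreover have "cf_ratio x (Suc n) = Q / of_int (a * Q + Q')"
  proof -
    have "of_int a + Q' / of_int Q = of_int (a * Q + Q') / (of_int Q :: real)" using Q by (simp add: field_simps)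
    then show ?thesis by (simp add: v a_def)
  qed
  ultimately show ?case using Qn Q
    by (intro exI[of _ "a * P + P'"] exI[of _ P] exI[of _ "a * Q + Q'"] exI[of _ Q]) auto
qed

text \<open>From x = (P + t P') / (Q + t Q') one gets Q x - P = - t (P Q' - P' Q) / (Q + t Q'). The
  determinant serves twice: its modulus is 1, and it makes P and Q coprime, so that
  \<open>quotient_of\<close> returns them.\<close>

lemma theta_eq:
  assumes x: "x \<in> {0<..<1} - \<rat>"
  shows "theta x n = (gauss_map ^^ n) x / (1 + (gauss_map ^^ n) x * cf_ratio x n)"
proof -
  obtain P P' Q Q' :: int where Q: "0 < Q" "0 \<le> Q'" and det: "\<bar>P * Q' - P' * Q\<bar> = 1"
    and v: "cf_ratio x n = of_int Q' / of_int Q"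
    and ev: "\<And>s::real. 0 \<le> s \<Longrightarrow>
        cf_eval (cf_word n x) s = (of_int P + s * of_int P') / (of_int Q + s * of_int Q')"
    using cf_word_moebius[OF x] by blast
  define t where "t = (gauss_map ^^ n) x"
  have t: "0 < t" using irrational_unit_funpow[OF x, of n] by (simp add: t_def)
  have "of_rat (cf_convergent x n) = (of_rat (Fract P Q) :: real)"
    using Q ev[of 0]
    unfolding cf_convergent_def cf_word_eq_map_digit of_rat_cf_value by (simp add: of_rat_rat)
  then have c: "cf_convergent x n = Fract P Q" by simp
  have "coprime P Q"
  proof (rule coprimeI)
    fix d assume "d dvd P" "d dvd Q"
    then have "d dvd \<bar>P * Q' - P' * Q\<bar>" by (auto intro!: dvd_diff dvd_mult dvd_mult2)
    then show "is_unit d" using det by simp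
  qed
  then have q: "cf_num x n = P" "cf_den x n = Q"
    using Q by (simp_all add: cf_num_def cf_den_def c quotient_of_Fract normalize_def)
  define D where "D = of_int Q + t * Q'"
  have D: "D > 0" using Q t by (simp add: D_def add_pos_nonneg)
  have "x = (P + t * P') / D"
    using ev[of t] t cf_eval_cf_word[OF x, of n] by (simp add: t_def D_def)
  then have Dx: "D * x = P + t * P'" using D by simp
  have "of_int Q * x - P = (Q * (D * x) - P * D) / D"
    using D by (simp add: field_simps)
  also have "Q * (D * x) - P * D = Q * (P + t * P') - P * D" unfolding Dx ..
  also have "Q * (P + t * P') - P * D = - t * of_int (P * Q' - P' * Q)"
    by (simp add: D_def algebra_simps)
  finally have "\<bar>of_int Q * x - P\<bar> = t * \<bar>of_int (P * Q' - P' * Q)\<bar> / D"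
    using D t by (simp add: abs_mult)
  also have "\<dots> = t / D" using det by (simp only: of_int_abs[symmetric] of_int_1 mult_1_right)
  finally have "theta x n = Q * t / D" by (simp add: theta_def q)
  also have "\<dots> = t / (1 + t * cf_ratio x n)"
    using D Q by (simp add: v D_def field_simps)
  finally show ?thesis by (simp add: t_def)
qed

text \<open>In terms of the pair (t, v) at time n + 1 the consecutive coefficients are v / (1 + t v)
  and t / (1 + t v); eliminating v leaves polynomials in t with \<open>theta x n\<close> as
  parameter.\<close>

lemma theta_eq_Suc:
  fixes n :: nat
  assumes x: "x \<in> {0<..<1} - \<rat>"
  defines "t \<equiv> (gauss_map ^^ Suc n) x" and "v \<equiv> cf_ratio x (Suc n)"
  shows "theta x n = v / (1 + t * v)" and "theta x (Suc n) = t - theta x n * t\<^sup>2"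
    and "1 / 2 < t \<Longrightarrow> theta x (Suc (Suc n)) = (1 - t) + theta x n * (1 - t)\<^sup>2"
    and "0 < t" "t < 1" "0 < theta x n"
proof -
  define t0 where "t0 = (gauss_map ^^ n) x"
  define v0 where "v0 = cf_ratio x n"
  define a where "a = real_of_int \<lfloor>1 / t0\<rfloor>"
  have irr: "t0 \<in> {0<..<1} - \<rat>" "t \<in> {0<..<1} - \<rat>"
    unfolding t0_def t_def by (rule irrational_unit_funpow[OF x])+
  have a: "1 \<le> a" using irrational_unit_imp(2)[OF irr(1)] by (simp add: a_def)
  have "1 / t0 = a + t" using irrational_unit_imp(3)[OF irr(1)] by (simp add: a_def t0_def t_def)
  then have t0: "t0 = 1 / (a + t)" by (metis div_by_1 divide_divide_eq_right mult_1)
  have v: "v = 1 / (a + v0)" by (simp add: v_def a_def t0_def v0_def)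
  have v0: "0 \<le> v0" "v0 \<le> 1" using cf_ratio_bounds[OF x] by (auto simp: v0_def)
  show t: "0 < t" "t < 1" using irr by auto
  have v01: "0 < v" "v \<le> 1" using v0 a by (simp_all add: v)
  have D: "1 + t * v > 0" using t v01 by (simp add: add_pos_pos)
  have "theta x n = t0 / (1 + t0 * v0)" using theta_eq[OF x] by (simp add: t0_def v0_def)
  \<comment> \<open>This form is symmetric in future and past, so the digit \<open>a\<close> can be
    attached to either side.\<close>
  also have "\<dots> = 1 / (a + t + v0)" using a t v0 by (simp add: t0 field_simps)
  also have "\<dots> = v / (1 + t * v)" using a t v0 by (simp add: v field_simps)
  finally show w: "theta x n = v / (1 + t * v)" .
  show "0 < theta x n" using v01 D by (simp add: w)
  have S: "theta x (Suc n) = t / (1 + t * v)"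
    using theta_eq[OF x] by (simp add: t_def v_def del: funpow.simps cf_ratio.simps)
  also have "\<dots> = t - theta x n * t\<^sup>2" using D by (simp add: w field_simps power2_eq_square)
  finally show "theta x (Suc n) = t - theta x n * t\<^sup>2" .
  assume th: "1 / 2 < t"
  have fl: "\<lfloor>1 / t\<rfloor> = 1"
  proof -
    have "1 \<le> 1 / t" "1 / t < 2" using t th by (auto simp: field_simps)
    then show ?thesis by linarith
  qed
  have t2: "(gauss_map ^^ Suc (Suc n)) x = 1 / t - 1"
    using irrational_unit_imp(3)[OF irr(2)] fl by (simp add: t_def)
  have v2: "cf_ratio x (Suc (Suc n)) = 1 / (1 + v)"
    using fl by (subst cf_ratio.simps) (simp add: v_def t_def del: cf_ratio.simps)
  have "theta x (Suc (Suc n)) = (1 / t - 1) / (1 + (1 / t - 1) * (1 / (1 + v)))"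
    unfolding theta_eq[OF x] t2 v2 ..
  also have "\<dots> = (1 - t) * (1 + v) / (1 + t * v)"
  proof -
    have "t + t * v > 0" using t v01 by (simp add: add_pos_pos)
    then have "1 + (1 / t - 1) * (1 / (1 + v)) = (1 + t * v) / (t * (1 + v))"
      using t v01 by (simp add: field_simps)
    moreover have "(1 / t - 1) / (d / (t * (1 + v))) = (1 - t) * (1 + v) / d" if "d > 0" for d
      using t v01 that by (simp add: field_simps)
    ultimately show ?thesis using D by simp
  qed
  also have "\<dots> = (1 - t) + theta x n * (1 - t)\<^sup>2"
    using D by (simp add: w field_simps power2_eq_square)
  finally show "theta x (Suc (Suc n)) = (1 - t) + theta x n * (1 - t)\<^sup>2" .
qed

subsection \<open>Equidistribution on open sets\<close>

lemma emeasure_lborel_fst_slices: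
  fixes X :: "(real \<times> real) set"
  assumes "X \<in> sets borel"
  shows "emeasure lborel X = (\<integral>\<^sup>+t. emeasure lborel {w. (t, w) \<in> X} \<partial>lborel)"
proof -
  have "X \<in> sets (lborel \<Otimes>\<^sub>M lborel)" using assms by (simp only: lborel_prod sets_lborel)
  from lborel.emeasure_pair_measure_alt[OF this] show ?thesis
    by (simp add: lborel_prod vimage_def)
qed

lemma emeasure_lborel_snd_slices:
  fixes X :: "(real \<times> real) set"
  assumes "X \<in> sets borel"
  shows "emeasure lborel X = (\<integral>\<^sup>+w. emeasure lborel {t. (t, w) \<in> X} \<partial>lborel)"
proof -
  have "X \<in> sets (lborel \<Otimes>\<^sub>M lborel)" using assms by (simp only: lborel_prod sets_lborel)
  from lborel_pair.emeasure_pair_measure_alt2[OF this] show ?thesis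
    by (simp add: lborel_prod vimage_def)
qed

lemma null_sets_lborel_fst_slices:
  fixes X :: "(real \<times> real) set"
  assumes "X \<in> sets borel" "\<And>t. countable {w. (t, w) \<in> X}"
  shows "X \<in> null_sets lborel"
proof -
  have "emeasure lborel X = (\<integral>\<^sup>+t. 0 \<partial>(lborel :: real measure))"
    unfolding emeasure_lborel_fst_slices[OF assms(1)]
    by (intro nn_integral_cong emeasure_lborel_countable assms(2))
  with assms(1) show ?thesis by (simp add: null_sets_def)
qed

lemma null_sets_lborel_snd_slices:
  fixes X :: "(real \<times> real) set"
  assumes "X \<in> sets borel" "\<And>w. countable {t. (t, w) \<in> X}"
  shows "X \<in> null_sets lborel"
proof -
  have "emeasure lborel X = (\<integral>\<^sup>+w. 0 \<partial>(lborel :: real measure))"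
    unfolding emeasure_lborel_snd_slices[OF assms(1)]
    by (intro nn_integral_cong emeasure_lborel_countable assms(2))
  then show ?thesis using assms(1) by (simp add: null_sets_def)
qed

lemma finite_union_emeasure_gt:
  assumes "countable I" and R: "\<And>i. i \<in> I \<Longrightarrow> R i \<in> sets M" and e: "e < emeasure M (\<Union>i\<in>I. R i)"
  shows "\<exists>F\<subseteq>I. finite F \<and> e < emeasure M (\<Union>i\<in>F. R i)"
proof (cases "I = {}")
  case True
  then show ?thesis using e by auto
next
  case False
  define f where "f = from_nat_into I"
  have range: "range f = I"
    using False assms(1) by (simp add: f_def range_from_nat_into)
  then have R': "R (f n) \<in> sets M" for n using R by auto
  define V where "V n = (\<Union>m<n. R (f m))" for n
  have "(SUP n. emeasure M (V n)) = emeasure M (\<Union>n. V n)"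
    using R' by (intro SUP_emeasure_incseq) (auto simp: V_def incseq_def intro: less_le_trans)
  also have "(\<Union>n. V n) = (\<Union>i\<in>I. R i)"
    unfolding V_def range[symmetric] by auto
  finally have "e < (SUP n. emeasure M (V n))" using e by simp
  then obtain n where "e < emeasure M (V n)" by (auto simp: less_SUP_iff)
  then have "e < emeasure M (\<Union>i\<in>f ` {..<n}. R i)" by (simp add: V_def)
  moreover have "f ` {..<n} \<subseteq> I" using range by auto
  ultimately show ?thesis by blast
qed

section \<open>Cylinder regions in the coordinates (t, w)\<close>

text \<open>Image of the open unit square under (t, v) -> (t, v / (1 + t v)); the bound v < 1 turns
  into w (1 + t) < 1.\<close>

definition cf_domain :: "(real \<times> real) set" where
  "cf_domain = {(t, w). 0 < t \<and> t < 1 \<and> 0 < w \<and> w * (1 + t) < 1}"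

text \<open>Image of a closed rectangle of cylinders under the same map. It is closed because v_n
  can be an endpoint of its cylinder; regions may meet in their boundaries, but occurrences are told
  apart by the words.\<close>

definition cf_region :: "int list \<Rightarrow> int list \<Rightarrow> (real \<times> real) set" where
  "cf_region c b = {(t, w). cf_lo c \<le> t \<and> t \<le> cf_hi c
    \<and> cf_lo b / (1 + t * cf_lo b) \<le> w \<and> w \<le> cf_hi b / (1 + t * cf_hi b)}"

lemma open_cf_domain: "open cf_domain"
proof -
  have "cf_domain = {p. 0 < fst p} \<inter> {p. fst p < 1} \<inter> {p. 0 < snd p} \<inter> {p. snd p * (1 + fst p) < 1}"
    by (auto simp: cf_domain_def)
  also have "open \<dots>"
    by (intro open_Int open_Collect_less continuous_intros)
  finally show ?thesis .
qed

lemma sets_cf_region [measurable]: "cf_region c b \<in> sets borel"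
proof -
  have "cf_region c b = {p \<in> space (borel \<Otimes>\<^sub>M borel). cf_lo c \<le> fst p \<and> fst p \<le> cf_hi c
    \<and> cf_lo b / (1 + fst p * cf_lo b) \<le> snd p \<and> snd p \<le> cf_hi b / (1 + fst p * cf_hi b)}"
    by (auto simp: cf_region_def space_pair_measure)
  also have "\<dots> \<in> sets (borel \<Otimes>\<^sub>M borel)"
    by measurable
  finally show ?thesis unfolding borel_prod .
qed

lemma cf_fraction_mono:
  fixes t u v :: real
  assumes "0 \<le> t" "0 \<le> u" "u \<le> v"
  shows "u / (1 + t * u) \<le> v / (1 + t * v)"
proof -
  have "1 + t * u > 0" "1 + t * v > 0" using assms by (auto intro!: add_pos_nonneg)
  then show ?thesis using assms by (simp add: frac_le_eq field_simps)
qed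

lemma cf_fraction_lipschitz:
  fixes t v t' v' :: real
  assumes "0 \<le> t" "0 \<le> v" "v \<le> 1" "0 \<le> t'" "0 \<le> v'" "v' \<le> 1"
  shows "\<bar>v / (1 + t * v) - v' / (1 + t' * v')\<bar> \<le> \<bar>v - v'\<bar> + \<bar>t - t'\<bar>"
proof -
  have D: "1 + t * v \<ge> 1" "1 + t' * v' \<ge> 1" using assms by auto
  then have DD: "1 * 1 \<le> (1 + t * v) * (1 + t' * v')" by (intro mult_mono) auto
  have "v / (1 + t * v) - v' / (1 + t' * v')
      = ((v - v') + v * v' * (t' - t)) / ((1 + t * v) * (1 + t' * v'))"
    using D by (subst diff_frac_eq) (auto simp: algebra_simps)
  also have "\<bar>\<dots>\<bar> \<le> \<bar>(v - v') + v * v' * (t' - t)\<bar> / 1"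
    unfolding abs_divide using DD by (intro divide_left_mono) (auto simp: abs_of_pos)
  also have "\<dots> \<le> \<bar>v - v'\<bar> + \<bar>v * v'\<bar> * \<bar>t' - t\<bar>"
    by (simp add: abs_mult[symmetric] abs_triangle_ineq del: abs_mult)
  also have "\<bar>v * v'\<bar> * \<bar>t' - t\<bar> \<le> 1 * \<bar>t' - t\<bar>"
    using assms by (intro mult_right_mono) (auto simp: abs_mult mult_le_one)
  finally show ?thesis by (simp add: abs_minus_commute)
qed

text \<open>The slice at t has length h' / (1 + t h') - l' / (1 + t l'), the t-derivative of ln (1 +
  t h') - ln (1 + t l'). The cross ratio is at least 1 because numerator minus denominator is (h -
  l) (h' - l').\<close>

lemma emeasure_cf_region:
  assumes c: "\<And>a. a \<in> set c \<Longrightarrow> 1 \<le> a" and b: "\<And>a. a \<in> set b \<Longrightarrow> 1 \<le> a"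
  shows "emeasure lborel (cf_region c b) = ennreal (ln (cf_cross c b))" and "1 \<le> cf_cross c b"
proof -
  define l h l' h' where "l = cf_lo c" and "h = cf_hi c" and "l' = cf_lo b" and "h' = cf_hi b"
  have n: "0 \<le> l" "l < h" "h \<le> 1" "0 \<le> l'" "l' < h'" "h' \<le> 1"
    using cf_cylinder_bounds[of c] cf_cylinder_bounds[of b] b c by (auto simp: l_def h_def l'_def h'_def)
  have D: "0 < 1 + p * q" if "0 \<le> p" "0 \<le> q" for p q :: real
    using that by (auto intro!: add_pos_nonneg)
  define f where "f t = h' / (1 + t * h') - l' / (1 + t * l')" for t
  define F where "F t = ln (1 + t * h') - ln (1 + t * l')" for t
  have f0: "0 \<le> f t" if "0 \<le> t" for t
    unfolding f_def using cf_fraction_mono[of t l' h'] n that by simp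
  have "emeasure lborel {w. (t, w) \<in> cf_region c b} = ennreal (f t) * indicator {l..h} t" for t
  proof (cases "t \<in> {l..h}")
    case True
    then have "{w. (t, w) \<in> cf_region c b} = {l' / (1 + t * l')..h' / (1 + t * h')}"
      by (auto simp: cf_region_def l_def h_def l'_def h'_def)
    then show ?thesis using True f0[of t] n by (simp add: f_def)
  next
    case False
    then have "{w. (t, w) \<in> cf_region c b} = {}"
      by (auto simp: cf_region_def l_def h_def)
    then show ?thesis using False by simp
  qed
  then have "emeasure lborel (cf_region c b) = (\<integral>\<^sup>+t. ennreal (f t) * indicator {l..h} t \<partial>lborel)"
    by (simp add: emeasure_lborel_fst_slices)
  also have "\<dots> = F h - F l"
  proof (rule nn_integral_FTC_Icc)
    show "f \<in> borel_measurable borel" unfolding f_def by measurable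
    show "(F has_real_derivative f x) (at x)" if "x \<in> {l..h}" for x
      unfolding F_def f_def using that n D[of x h'] D[of x l']
      by (auto intro!: derivative_eq_intros)
  qed (use f0 n in auto)
  also have Fl: "F h - F l = ln (cf_cross c b)"
    unfolding F_def cf_cross_def l_def[symmetric] h_def[symmetric] l'_def[symmetric] h'_def[symmetric]
    using n D[of l l'] D[of h h'] D[of l h'] D[of h l'] by (simp add: ln_div ln_mult)
  finally show "emeasure lborel (cf_region c b) = ennreal (ln (cf_cross c b))" .
  have "(1 + h * h') * (1 + l * l') - (1 + l * h') * (1 + h * l') = (h - l) * (h' - l')"
    by (simp add: algebra_simps)
  moreover have "0 \<le> (h - l) * (h' - l')" using n by simp
  ultimately have "(1 + l * h') * (1 + h * l') \<le> (1 + h * h') * (1 + l * l')" by linarith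
  then show "1 \<le> cf_cross c b"
    unfolding cf_cross_def l_def[symmetric] h_def[symmetric] l'_def[symmetric] h'_def[symmetric]
    using n D[of l h'] D[of h l'] by (simp add: divide_simps)
qed

lemma cf_word_cylinder:
  assumes "x \<in> {0<..<1} - \<rat>"
  shows "0 \<le> cf_lo (cf_word k x)" "cf_hi (cf_word k x) \<le> 1"
    "cf_hi (cf_word k x) - cf_lo (cf_word k x) \<le> (1 / 4) ^ (k div 2)"
  using cf_cylinder_bounds[of "cf_word k x"] cf_cylinder_width[of "cf_word k x"] cf_word_pos[OF assms, of _ k]
  by auto

lemma eventually_cf_region_subset:
  assumes G: "open G" "(t, w) \<in> G" and t: "t \<in> {0<..<1} - \<rat>"
    and v: "v \<in> {0<..<1} - \<rat>" and w: "w = v / (1 + t * v)"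
  shows "eventually (\<lambda>k. cf_region (cf_word k t) (cf_word k v) \<subseteq> G) sequentially"
proof -
  obtain e where e: "e > 0" "ball (t, w) e \<subseteq> G" using G open_contains_ball by blast
  define \<delta> :: "nat \<Rightarrow> real" where "\<delta> k = (1 / 4) ^ (k div 2)" for k
  have "\<delta> \<longlonglongrightarrow> 0"
  proof -
    have "filterlim (\<lambda>k::nat. k div 2) at_top sequentially"
      unfolding filterlim_at_top
    proof
      fix Z :: nat
      show "eventually (\<lambda>k. Z \<le> k div 2) sequentially"
        using eventually_ge_at_top[of "2 * Z"] by eventually_elim auto
    qed
    then show ?thesis unfolding \<delta>_def
      by (rule filterlim_compose[rotated]) (rule LIMSEQ_realpow_zero; simp)
  qed
  then have "eventually (\<lambda>k. \<delta> k < e / 3) sequentially"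
    using e(1) by (intro order_tendstoD(2)) auto
  then show ?thesis
  proof eventually_elim
    case (elim k)
    show ?case
    proof
      fix p assume "p \<in> cf_region (cf_word k t) (cf_word k v)"
      then obtain t' w' where p: "p = (t', w')" and in_r: "(t', w') \<in> cf_region (cf_word k t) (cf_word k v)"
        by (cases p) auto
      define l h l' h' where "l = cf_lo (cf_word k t)" and "h = cf_hi (cf_word k t)"
        and "l' = cf_lo (cf_word k v)" and "h' = cf_hi (cf_word k v)"
      have n: "0 \<le> l" "h \<le> 1" "0 \<le> l'" "h' \<le> 1"
        using cf_word_cylinder[OF t, of k] cf_word_cylinder[OF v, of k]
        by (simp_all add: l_def h_def l'_def h'_def)
      have w1: "h - l \<le> \<delta> k" "h' - l' \<le> \<delta> k"
        using cf_word_cylinder[OF t, of k] cf_word_cylinder[OF v, of k]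
        by (simp_all add: l_def h_def l'_def h'_def \<delta>_def)
      have tv: "l < t" "t < h" "l' < v" "v < h'"
        using cf_word_bounds[OF t] cf_word_bounds[OF v] by (auto simp: l_def h_def l'_def h'_def)
      have r: "l \<le> t'" "t' \<le> h" "l' / (1 + t' * l') \<le> w'" "w' \<le> h' / (1 + t' * h')"
        using in_r by (auto simp: cf_region_def l_def h_def l'_def h'_def)
      have tt: "\<bar>t' - t\<bar> \<le> \<delta> k" using r tv w1 by auto
      have "\<bar>h' / (1 + t' * h') - w\<bar> \<le> \<bar>h' - v\<bar> + \<bar>t' - t\<bar>"
        unfolding w using n r tv v t by (intro cf_fraction_lipschitz) auto
      moreover have "\<bar>l' / (1 + t' * l') - w\<bar> \<le> \<bar>l' - v\<bar> + \<bar>t' - t\<bar>"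
        unfolding w using n r tv v t by (intro cf_fraction_lipschitz) auto
      ultimately have ww: "\<bar>w' - w\<bar> \<le> 2 * \<delta> k" using r(3,4) tt tv w1 by linarith
      have "dist (t, w) p \<le> \<bar>t' - t\<bar> + \<bar>w' - w\<bar>"
        unfolding p dist_Pair_Pair using sqrt_sum_squares_le_sum_abs[of "dist t t'" "dist w w'"]
        by (simp add: dist_real_def abs_minus_commute)
      also have "\<dots> < e" using tt ww elim by linarith
      finally show "p \<in> G" using e(2) by auto
    qed
  qed
qed

text \<open>Almost every point of \<open>G\<close> in the domain lies in a region inside
  \<open>G\<close> at every sufficiently high level. Hence the sets \<open>V m\<close> increase and
  a single level captures measure above \<open>r\<close>; words of one common length can then be
  counted without repetition.\<close>

lemma cf_region_exhaust:
  assumes G: "open G" and r: "r < emeasure lborel (G \<inter> cf_domain)"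
  shows "\<exists>k F. finite F \<and> r < emeasure lborel (\<Union>(c, b)\<in>F. cf_region c b)
    \<and> (\<forall>(c, b)\<in>F. length c = Suc k \<and> length b = Suc k \<and> (\<forall>a\<in>set c \<union> set b. 1 \<le> a) \<and> cf_region c b \<subseteq> G)"
proof -
  define W where "W k = {(c, b). length c = Suc k \<and> length b = Suc k \<and> (\<forall>a\<in>set c \<union> set b. 1 \<le> a)
    \<and> cf_region c b \<subseteq> G}" for k
  define U where "U k = (\<Union>(c, b)\<in>W k. cf_region c b)" for k
  have cW: "countable (W k)" for k by (rule countable_subset[of _ UNIV]) auto
  have [measurable]: "U k \<in> sets borel" for k
    unfolding U_def using cW by (intro sets.countable_UN'') auto
  define V where "V m = (\<Inter>k\<in>{m..}. U k)" for m
  have V[measurable]: "V m \<in> sets borel" for m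
    unfolding V_def by (intro sets.countable_INT') auto
  \<comment> \<open>Points with rational t or v lack an infinite expansion; they lie on countably
    many lines and curves.\<close>
  define N1 where "N1 = {p :: real \<times> real. fst p \<in> \<rat>}"
  define N2 where "N2 = (\<Union>r\<in>\<rat>. {p :: real \<times> real. 0 < 1 + fst p * r \<and> snd p = r / (1 + fst p * r)})"
  have N1: "N1 \<in> null_sets lborel"
  proof (rule null_sets_lborel_snd_slices)
    have "N1 = (\<Union>r\<in>\<rat>. {p. fst p = r})" by (auto simp: N1_def)
    also have "\<dots> \<in> sets borel"
    proof (intro sets.countable_UN'' countable_rat)
      show "{p :: real \<times> real. fst p = r} \<in> sets borel" for r
        by (intro borel_closed closed_Collect_eq continuous_intros)
    qed
    finally show "N1 \<in> sets borel" .
    show "countable {t. (t, w) \<in> N1}" for w using countable_rat by (simp add: N1_def Rats_def)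
  qed
  have N2: "N2 \<in> null_sets lborel"
  proof (rule null_sets_lborel_fst_slices)
    have "{p :: real \<times> real. 0 < 1 + fst p * r \<and> snd p = r / (1 + fst p * r)} \<in> sets borel" for r
    proof -
      have "{p :: real \<times> real. 0 < 1 + fst p * r \<and> snd p = r / (1 + fst p * r)}
         = {p \<in> space (borel \<Otimes>\<^sub>M borel). 0 < 1 + fst p * r \<and> snd p = r / (1 + fst p * r)}"
        by (simp add: space_pair_measure)
      also have "\<dots> \<in> sets (borel \<Otimes>\<^sub>M borel)" by measurable
      finally show ?thesis unfolding borel_prod .
    qed
    then show "N2 \<in> sets borel" unfolding N2_def by (intro sets.countable_UN'' countable_rat) auto
    show "countable {w. (t, w) \<in> N2}" for t
      by (rule countable_subset[of _ "(\<lambda>r. r / (1 + t * r)) ` \<rat>"]) (auto simp: N2_def countable_rat)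
  qed
  have sub: "G \<inter> cf_domain \<subseteq> (\<Union>m. V m) \<union> (N1 \<union> N2)"
  proof
    fix p assume p: "p \<in> G \<inter> cf_domain"
    obtain t w where tw: "p = (t, w)" by (cases p)
    have dom: "(t, w) \<in> G" "0 < t" "t < 1" "0 < w" "w * (1 + t) < 1" using p tw by (auto simp: cf_domain_def)
    have d: "t * w < 1 - w" using dom(5) by (simp add: algebra_simps)
    define v where "v = w / (1 - t * w)"
    have tw1: "t * w < 1" using d dom by linarith
    have v: "0 < v" "v < 1" using dom d by (simp_all add: v_def)
    have vv: "1 + t * v = 1 / (1 - t * w)" using tw1 by (simp add: v_def field_simps)
    then have wv: "w = v / (1 + t * v)" and pos: "0 < 1 + t * v" using tw1 by (simp_all add: v_def)
    show "p \<in> (\<Union>m. V m) \<union> (N1 \<union> N2)"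
    proof (cases "t \<in> \<rat> \<or> v \<in> \<rat>")
      case True
      then show ?thesis using wv pos by (auto simp: tw N1_def N2_def)
    next
      case False
      then have irr: "t \<in> {0<..<1} - \<rat>" "v \<in> {0<..<1} - \<rat>" using dom v by auto
      obtain m where m: "\<And>k. k \<ge> m \<Longrightarrow> cf_region (cf_word k t) (cf_word k v) \<subseteq> G"
        using eventually_cf_region_subset[OF G dom(1) irr wv] by (auto simp: eventually_sequentially)
      have "p \<in> U k" if "k \<ge> m" for k
      proof -
        have "(cf_word (Suc k) t, cf_word (Suc k) v) \<in> W k"
          unfolding W_def using m[of "Suc k"] that cf_word_pos[OF irr(1), of _ "Suc k"] cf_word_pos[OF irr(2), of _ "Suc k"]
          by (auto simp del: cf_word.simps)
        moreover have "p \<in> cf_region (cf_word (Suc k) t) (cf_word (Suc k) v)"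
        proof -
          have "0 \<le> cf_lo (cf_word (Suc k) v)"
            by (rule cf_word_cylinder(1)[OF irr(2)])
          then show ?thesis
            using cf_word_bounds[OF irr(1), of "Suc k"] cf_word_bounds[OF irr(2), of "Suc k"] dom v
            unfolding tw cf_region_def wv
            by (auto intro!: cf_fraction_mono simp del: cf_word.simps)
        qed
        ultimately show ?thesis unfolding U_def by blast
      qed
      then show ?thesis by (auto simp: V_def)
    qed
  qed
  have "r < emeasure lborel ((\<Union>m. V m) \<union> (N1 \<union> N2))"
    using r by (rule less_le_trans) (intro emeasure_mono sub; use N1 N2 in \<open>auto simp: null_sets_def\<close>)
  also have "\<dots> = emeasure lborel (\<Union>m. V m)"
    using N1 N2 by (intro emeasure_Un_null_set null_sets.Un) auto
  also have "\<dots> = (SUP m. emeasure lborel (V m))"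
    by (intro SUP_emeasure_incseq[symmetric]) (auto simp: V_def incseq_def)
  finally obtain m where "r < emeasure lborel (V m)" by (auto simp: less_SUP_iff)
  also have "\<dots> \<le> emeasure lborel (U m)" by (intro emeasure_mono) (auto simp: V_def)
  finally have "r < emeasure lborel (\<Union>i\<in>W m. case i of (c, b) \<Rightarrow> cf_region c b)" by (simp add: U_def)
  then have "\<exists>F\<subseteq>W m. finite F \<and> r < emeasure lborel (\<Union>i\<in>F. case i of (c, b) \<Rightarrow> cf_region c b)"
    by (intro finite_union_emeasure_gt cW) auto
  then obtain F where "F \<subseteq> W m" "finite F" "r < emeasure lborel (\<Union>i\<in>F. case i of (c, b) \<Rightarrow> cf_region c b)"
    by blast
  then show ?thesis by (intro exI[of _ m] exI[of _ F]) (auto simp: W_def)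
qed

section \<open>Visits of an orbit to open sets\<close>

definition theta_point :: "real \<Rightarrow> nat \<Rightarrow> real \<times> real" where
  "theta_point x m = ((gauss_map ^^ Suc m) x, theta x m)"

text \<open>The first half of the block, read backwards, locates v at time j + k + 1, and the second
  half locates t at the same time. Halves of length k + 1 match the index shift in
  \<open>theta_point\<close>.\<close>

lemma theta_point_mem_cf_region:
  assumes x: "x \<in> {0<..<1} - \<rat>"
    and word: "cf_word (Suc k + Suc k) ((gauss_map ^^ j) x) = rev b @ c"
    and len: "length b = Suc k" "length c = Suc k"
  shows "theta_point x (j + k) \<in> cf_region c b"
proof -
  have f: "(gauss_map ^^ Suc k) ((gauss_map ^^ j) x) = (gauss_map ^^ Suc (j + k)) x"
    by (metis add.commute add_Suc_right comp_apply funpow_add)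
  have "cf_word (Suc k) ((gauss_map ^^ j) x) @ cf_word (Suc k) ((gauss_map ^^ Suc (j + k)) x) = rev b @ c"
    using word unfolding cf_word_add f .
  then have b: "b = rev (cf_word (Suc k) ((gauss_map ^^ j) x))"
    and c: "c = cf_word (Suc k) ((gauss_map ^^ Suc (j + k)) x)"
    using len by (auto simp del: cf_word.simps funpow.simps)
  define t where "t = (gauss_map ^^ Suc (j + k)) x"
  have t: "t \<in> {0<..<1} - \<rat>" unfolding t_def by (rule irrational_unit_funpow[OF x])
  have v: "cf_lo b \<le> cf_ratio x (Suc (j + k))" "cf_ratio x (Suc (j + k)) \<le> cf_hi b"
    using cf_ratio_mem_cylinder[OF x, where j = j and k = "Suc k"]
    unfolding b[symmetric] by (auto simp del: cf_ratio.simps)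
  have "0 \<le> cf_lo b"
  proof -
    have "1 \<le> a" if "a \<in> set b" for a
      using that cf_word_pos[OF irrational_unit_funpow[OF x, of j], of a "Suc k"]
      unfolding b by (simp del: cf_word.simps)
    then show ?thesis using cf_cylinder_bounds[of b] by blast
  qed
  moreover have "cf_lo c \<le> t" "t \<le> cf_hi c"
    using cf_word_bounds[OF t, of "Suc k"] unfolding c t_def[symmetric] by auto
  ultimately show ?thesis
    using v t cf_fraction_mono[of t "cf_lo b" "cf_ratio x (Suc (j + k))"]
      cf_fraction_mono[of t "cf_ratio x (Suc (j + k))" "cf_hi b"]
    unfolding theta_point_def t_def[symmetric] theta_eq_Suc(1)[OF x] cf_region_def
    by (auto simp del: cf_ratio.simps)
qed

text \<open>Finitely many regions inside \<open>G\<close> have total area \<open>S\<close>, which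
  exceeds \<open>r\<close> by subadditivity, and their words occur with total frequency S / ln
  2.\<close>

lemma theta_point_open_frequency_ge:
  assumes x: "gauss_generic x" and G: "open G" and r: "ennreal r < emeasure lborel (G \<inter> cf_domain)"
  shows "eventually (\<lambda>N. r / ln 2 < real (card {m. m < N \<and> theta_point x m \<in> G}) / real N) sequentially"
proof -
  have irr: "x \<in> {0<..<1} - \<rat>" using x by (simp add: gauss_generic_def)
  obtain k F where F: "finite F" and rF: "ennreal r < emeasure lborel (\<Union>(c, b)\<in>F. cf_region c b)"
    and len: "\<And>c b. (c, b) \<in> F \<Longrightarrow> length c = Suc k \<and> length b = Suc k"
    and pos: "\<And>c b a. (c, b) \<in> F \<Longrightarrow> a \<in> set c \<union> set b \<Longrightarrow> 1 \<le> a"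
    and sub: "\<And>c b. (c, b) \<in> F \<Longrightarrow> cf_region c b \<subseteq> G"
    using cf_region_exhaust[OF G r] by blast
  define w where "w j = cf_word (Suc k + Suc k) ((gauss_map ^^ j) x)" for j
  define C where "C N i = {j. j < N \<and> w j = (case i of (c, b) \<Rightarrow> rev b @ c)}" for N i
  define S where "S = (\<Sum>(c, b)\<in>F. ln (cf_cross c b))"
  have "emeasure lborel (\<Union>i\<in>F. case i of (c, b) \<Rightarrow> cf_region c b)
      \<le> (\<Sum>i\<in>F. emeasure lborel (case i of (c, b) \<Rightarrow> cf_region c b))"
    by (intro emeasure_subadditive_finite F) auto
  also have "\<dots> = (\<Sum>(c, b)\<in>F. ennreal (ln (cf_cross c b)))"
    using pos by (intro sum.cong refl) (auto intro!: emeasure_cf_region)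
  also have "\<dots> = ennreal S"
    unfolding S_def using pos emeasure_cf_region(2)
    by (subst sum_ennreal[symmetric]) (auto simp: case_prod_beta intro!: sum.cong ln_ge_zero)
  finally have "ennreal r < ennreal S" using rF by (simp add: case_prod_beta)
  then have rS: "r < S" by (meson ennreal_leI not_le)
  have lim: "(\<lambda>N. (\<Sum>i\<in>F. real (card (C N i)) / real N) - real k / real N) \<longlonglongrightarrow> S / ln 2 - 0"
  proof (rule tendsto_diff)
    have "(\<lambda>N. real (card (C N i)) / real N) \<longlonglongrightarrow> (case i of (c, b) \<Rightarrow> ln (cf_cross c b)) / ln 2"
      if i: "i \<in> F" for i
    proof -
      obtain c b where cb: "i = (c, b)" by (cases i)
      have p: "1 \<le> a" if "a \<in> set (rev b @ c)" for a using that pos i cb by auto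
      have l: "length (rev b @ c) = Suc k + Suc k" using len i cb by auto
      have cr: "cf_cross (rev b @ c) [] = cf_cross c b"
        using pos i cb by (intro cf_cross_rev_append) auto
      show ?thesis
        using gauss_generic_word_frequency[of x "rev b @ c", OF x p] unfolding l cr C_def w_def cb
        by (simp del: cf_word.simps)
    qed
    then have "(\<lambda>N. \<Sum>i\<in>F. real (card (C N i)) / real N) \<longlonglongrightarrow> (\<Sum>i\<in>F. (case i of (c, b) \<Rightarrow> ln (cf_cross c b)) / ln 2)"
      by (rule tendsto_sum)
    also have "(\<Sum>i\<in>F. (case i of (c, b) \<Rightarrow> ln (cf_cross c b)) / ln 2) = S / ln 2"
      by (simp add: S_def sum_divide_distrib case_prod_beta)
    finally show "(\<lambda>N. \<Sum>i\<in>F. real (card (C N i)) / real N) \<longlonglongrightarrow> S / ln 2" .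
    show "(\<lambda>N. real k / real N) \<longlonglongrightarrow> 0" by (rule lim_const_over_n)
  qed
  \<comment> \<open>Distinct words of equal length cannot occur at the same place, so the counts
    add. A block starting at j belongs to the point with index j + k, and at most k of these indices
    lie beyond N.\<close>
  have le: "(\<Sum>i\<in>F. real (card (C N i))) - real k \<le> real (card {m. m < N \<and> theta_point x m \<in> G})" for N
  proof -
    have fin: "finite (C N i)" for i by (simp add: C_def)
    have "(\<Sum>i\<in>F. card (C N i)) = card (\<Union>i\<in>F. C N i)"
    proof (rule card_UN_disjoint[symmetric])
      show "\<forall>i\<in>F. \<forall>j\<in>F. i \<noteq> j \<longrightarrow> C N i \<inter> C N j = {}"
      proof (intro ballI impI)
        fix i j assume ij: "i \<in> F" "j \<in> F" "i \<noteq> j"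
        obtain c b c' b' where cb: "i = (c, b)" "j = (c', b')" by (cases i, cases j)
        have "rev b @ c \<noteq> rev b' @ c'" using ij len[of c b] len[of c' b'] by (auto simp: cb)
        then show "C N i \<inter> C N j = {}" by (auto simp: C_def cb)
      qed
    qed (use F fin in auto)
    also have "\<dots> \<le> card ({m. m < N \<and> theta_point x m \<in> G} \<union> {N..<N + k})"
    proof (rule card_inj_on_le)
      show "inj_on (\<lambda>j. j + k) (\<Union>i\<in>F. C N i)" by simp
      show "(\<lambda>j. j + k) ` (\<Union>i\<in>F. C N i) \<subseteq> {m. m < N \<and> theta_point x m \<in> G} \<union> {N..<N + k}"
      proof
        fix m assume "m \<in> (\<lambda>j. j + k) ` (\<Union>i\<in>F. C N i)"
        then obtain j c b where j: "m = j + k" "(c, b) \<in> F" "j < N" "w j = rev b @ c"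
          by (auto simp: C_def)
        have "theta_point x m \<in> cf_region c b"
          unfolding j(1) using j(2,4) len by (intro theta_point_mem_cf_region[OF irr]) (auto simp: w_def)
        then show "m \<in> {m. m < N \<and> theta_point x m \<in> G} \<union> {N..<N + k}"
          using sub[OF j(2)] j by auto
      qed
    qed auto
    also have "\<dots> \<le> card {m. m < N \<and> theta_point x m \<in> G} + k"
      using card_Un_le[of "{m. m < N \<and> theta_point x m \<in> G}" "{N..<N + k}"] by simp
    finally have "real (\<Sum>i\<in>F. card (C N i)) \<le> real (card {m. m < N \<and> theta_point x m \<in> G} + k)"
      by (simp only: of_nat_le_iff)
    then show ?thesis by simp
  qed
  have "r / ln 2 < S / ln 2 - 0" using rS by (simp add: divide_strict_right_mono)
  from order_tendstoD(1)[OF lim this] show ?thesis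
  proof eventually_elim
    case (elim N)
    have "(\<Sum>i\<in>F. real (card (C N i)) / real N) - real k / real N
        = ((\<Sum>i\<in>F. real (card (C N i))) - real k) / real N"
      by (simp add: sum_divide_distrib diff_divide_distrib)
    also have "\<dots> \<le> real (card {m. m < N \<and> theta_point x m \<in> G}) / real N"
      using le[of N] by (intro divide_right_mono) auto
    finally show ?case using elim by linarith
  qed
qed

lemma emeasure_cf_domain: "emeasure lborel cf_domain = ennreal (ln 2)"
proof -
  have "emeasure lborel {w. (t, w) \<in> cf_domain} = ennreal (1 / (1 + t)) * indicator {0..1} t"
    if "t \<noteq> 0" "t \<noteq> 1" for t :: real
  proof (cases "t \<in> {0..1}")
    case True
    then have "{w. (t, w) \<in> cf_domain} = {0<..<1 / (1 + t)}"
      using that by (auto simp: cf_domain_def field_simps)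
    then show ?thesis using True by simp
  next
    case False
    then have "{w. (t, w) \<in> cf_domain} = {}" by (auto simp: cf_domain_def)
    then show ?thesis using False by simp
  qed
  then have "emeasure lborel cf_domain = (\<integral>\<^sup>+t. ennreal (1 / (1 + t)) * indicator {0..1} t \<partial>lborel)"
    unfolding emeasure_lborel_fst_slices[OF borel_open[OF open_cf_domain]]
    by (intro nn_integral_cong_AE)
      (use AE_lborel_singleton[of "0::real"] AE_lborel_singleton[of "1::real"] in eventually_elim, simp)
  also have "\<dots> = ennreal (ln (1 + 1) - ln (1 + 0))"
    by (intro nn_integral_FTC_Icc) (auto intro!: derivative_eq_intros)
  finally show ?thesis by simp
qed

text \<open>The lower bound for visits to \<open>H\<close> bounds visits to \<open>G\<close> from
  above, because the two areas sum to ln 2. Nothing is assumed about \<open>P\<close> at visits to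
  the uncovered null set, which an individual orbit may well meet.\<close>

lemma theta_point_frequency:
  assumes x: "gauss_generic x" and G: "open G" and H: "open H"
    and dis: "G \<inter> H = {}" and cover: "cf_domain - (G \<union> H) \<in> null_sets lborel"
    and E: "\<And>m. theta_point x m \<in> G \<Longrightarrow> P m" "\<And>m. theta_point x m \<in> H \<Longrightarrow> \<not> P m"
  shows "(\<lambda>N. real (card {m. m < N \<and> P m}) / real N) \<longlonglongrightarrow> measure lborel (G \<inter> cf_domain) / ln 2"
proof -
  define g where "g = measure lborel (G \<inter> cf_domain)"
  define h where "h = measure lborel (H \<inter> cf_domain)"
  have fin: "emeasure lborel (A \<inter> cf_domain) < \<infinity>" for A
    using emeasure_mono[of "A \<inter> cf_domain" cf_domain lborel] open_cf_domain
    by (auto simp: emeasure_cf_domain intro: le_less_trans borel_open)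
  have g: "emeasure lborel (G \<inter> cf_domain) = ennreal g" and h: "emeasure lborel (H \<inter> cf_domain) = ennreal h"
    unfolding g_def h_def using less_imp_neq[OF fin] by (auto intro!: emeasure_eq_ennreal_measure)
  have [measurable]: "G \<in> sets borel" "H \<in> sets borel" "cf_domain \<in> sets borel"
    using G H open_cf_domain by auto
  have "emeasure lborel (G \<inter> cf_domain) + emeasure lborel (H \<inter> cf_domain)
      = emeasure lborel ((G \<inter> cf_domain) \<union> (H \<inter> cf_domain))"
    using dis by (intro plus_emeasure) auto
  also have "\<dots> = emeasure lborel ((G \<inter> cf_domain) \<union> (H \<inter> cf_domain) \<union> (cf_domain - (G \<union> H)))"
    using cover by (intro emeasure_Un_null_set[symmetric]) auto
  also have "(G \<inter> cf_domain) \<union> (H \<inter> cf_domain) \<union> (cf_domain - (G \<union> H)) = cf_domain" by auto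
  finally have "ennreal (g + h) = ennreal (ln 2)"
    by (simp add: g h emeasure_cf_domain ennreal_plus g_def h_def)
  then have gh: "g + h = ln 2"
    by (subst (asm) ennreal_inj) (auto simp: g_def h_def)
  have lower: "eventually (\<lambda>N. u < real (card {m. m < N \<and> theta_point x m \<in> A}) / real N) sequentially"
    if A: "open A" and u: "u < measure lborel (A \<inter> cf_domain) / ln 2" for u A
  \<comment> \<open>For negative u, \<open>ennreal\<close> truncates to 0 while the area of
    \<open>A\<close> may be 0 as well; the bound holds because frequencies are nonnegative.\<close>
  proof (cases "u < 0")
    case True
    then show ?thesis by (intro always_eventually allI) (auto intro: less_le_trans)
  next
    case False
    have "emeasure lborel (A \<inter> cf_domain) = ennreal (measure lborel (A \<inter> cf_domain))"
      using less_imp_neq[OF fin] by (auto intro!: emeasure_eq_ennreal_measure)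
    then have "ennreal (u * ln 2) < emeasure lborel (A \<inter> cf_domain)"
      using u False by (simp add: ennreal_less_iff field_simps)
    from theta_point_open_frequency_ge[OF x A this] show ?thesis by simp
  qed
  show ?thesis
    unfolding g_def[symmetric]
  proof (rule order_tendstoI)
    fix a assume "a < g / ln 2"
    from lower[OF G this[unfolded g_def]]
    show "eventually (\<lambda>N. a < real (card {m. m < N \<and> P m}) / real N) sequentially"
    proof eventually_elim
      case (elim N)
      have "card {m. m < N \<and> theta_point x m \<in> G} \<le> card {m. m < N \<and> P m}"
        using E by (intro card_mono) auto
      then have "real (card {m. m < N \<and> theta_point x m \<in> G}) / real N \<le> real (card {m. m < N \<and> P m}) / real N"
        by (intro divide_right_mono) auto
      with elim show ?case by linarith
    qed
  next
    fix a assume "g / ln 2 < a"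
    moreover have "h / ln 2 = 1 - g / ln 2" using gh by (simp add: field_simps)
    ultimately have "1 - a < h / ln 2" by linarith
    from lower[OF H this[unfolded h_def]] eventually_gt_at_top[of 0]
    show "eventually (\<lambda>N. real (card {m. m < N \<and> P m}) / real N < a) sequentially"
    proof eventually_elim
      case (elim N)
      have "card {m. m < N \<and> theta_point x m \<in> H} + card {m. m < N \<and> P m}
          = card ({m. m < N \<and> theta_point x m \<in> H} \<union> {m. m < N \<and> P m})"
        using E by (intro card_Un_disjoint[symmetric]) auto
      also have "\<dots> \<le> card {..<N}" by (intro card_mono) auto
      finally have "real (card {m. m < N \<and> theta_point x m \<in> H}) + real (card {m. m < N \<and> P m}) \<le> real N"
        by simp
      then have "real (card {m. m < N \<and> theta_point x m \<in> H}) / real N + real (card {m. m < N \<and> P m}) / real N \<le> 1"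
        using elim by (simp add: add_divide_distrib[symmetric])
      with elim show ?case by linarith
    qed
  qed
qed

subsection \<open>Change of variables\<close>

lemma nn_integral_lborel_pair:
  fixes h :: "real \<times> real \<Rightarrow> ennreal"
  assumes "h \<in> borel_measurable borel"
  shows "(\<integral>\<^sup>+p. h p \<partial>lborel) = (\<integral>\<^sup>+w. \<integral>\<^sup>+z. h (w, z) \<partial>lborel \<partial>lborel)"
proof -
  have "h \<in> borel_measurable (lborel \<Otimes>\<^sub>M lborel)" using assms by (simp add: lborel_prod)
  from lborel.nn_integral_fst[OF this] show ?thesis by (simp add: lborel_prod)
qed

text \<open>Strict inequalities on both sides of \<alpha> keep this set and \<open>skip_set\<close>
  open; the excluded curves are null by \<open>null_sets_curves\<close>.\<close>

definition direct_set :: "real \<Rightarrow> (real \<times> real) set" where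
  "direct_set \<alpha> = {(t, w). (t, w) \<in> cf_domain \<and> w < \<alpha> \<and> t - w * t\<^sup>2 < \<alpha>}"

definition skip_set :: "real \<Rightarrow> (real \<times> real) set" where
  "skip_set \<alpha> = {(t, w). (t, w) \<in> cf_domain \<and> w < \<alpha> \<and> \<alpha> < t - w * t\<^sup>2}"

definition direct_pair :: "real \<times> real \<Rightarrow> real \<times> real" where
  "direct_pair = (\<lambda>(t, w). (w, t - w * t\<^sup>2))"

definition skip_pair :: "real \<times> real \<Rightarrow> real \<times> real" where
  "skip_pair = (\<lambda>(t, w). (w, (1 - t) + w * (1 - t)\<^sup>2))"

lemma open_direct_set: "open (direct_set \<alpha>)"
proof -
  have "direct_set \<alpha> = cf_domain \<inter> {p. snd p < \<alpha>} \<inter> {p. fst p - snd p * (fst p)\<^sup>2 < \<alpha>}"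
    by (auto simp: direct_set_def)
  also have "open \<dots>" by (intro open_Int open_cf_domain open_Collect_less continuous_intros)
  finally show ?thesis .
qed

lemma open_skip_set: "open (skip_set \<alpha>)"
proof -
  have "skip_set \<alpha> = cf_domain \<inter> {p. snd p < \<alpha>} \<inter> {p. \<alpha> < fst p - snd p * (fst p)\<^sup>2}"
    by (auto simp: skip_set_def)
  also have "open \<dots>" by (intro open_Int open_cf_domain open_Collect_less continuous_intros)
  finally show ?thesis .
qed

lemma continuous_direct_pair: "continuous_on UNIV direct_pair"
  unfolding direct_pair_def case_prod_beta by (intro continuous_intros)

lemma continuous_skip_pair: "continuous_on UNIV skip_pair"
  unfolding skip_pair_def case_prod_beta by (intro continuous_intros)

lemma sets_direct_vimage:
  assumes "S \<in> sets borel"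
  shows "direct_set \<alpha> \<inter> direct_pair -` S \<in> sets borel"
  using borel_open[OF open_direct_set, of \<alpha>]
    measurable_sets_borel[OF borel_measurable_continuous_onI[OF continuous_direct_pair] assms]
  by auto

lemma sets_skip_vimage:
  assumes "S \<in> sets borel"
  shows "skip_set \<alpha> \<inter> skip_pair -` S \<in> sets borel"
  using borel_open[OF open_skip_set, of \<alpha>]
    measurable_sets_borel[OF borel_measurable_continuous_onI[OF continuous_skip_pair] assms]
  by auto

lemma open_Lambda: "open (Lambda \<alpha>)"
proof -
  have "Lambda \<alpha> = {p. 0 < fst p} \<inter> {p. fst p < \<alpha>} \<inter> {p. 0 < snd p} \<inter> {p. snd p < \<alpha>} \<inter> {p. fst p + snd p < 1}"
    by (auto simp: Lambda_def)
  also have "open \<dots>" by (intro open_Int open_Collect_less continuous_intros)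
  finally show ?thesis .
qed

lemma sets_Lambda [measurable]: "Lambda \<alpha> \<in> sets borel"
  by (intro borel_open open_Lambda)

lemma sets_Lambda_minus [measurable]: "Lambda_minus \<alpha> \<in> sets borel"
proof -
  have "Lambda_minus \<alpha> = Lambda \<alpha> \<inter> {p. 4 * \<alpha> * fst p \<le> 1} \<inter> {p. snd p < fst p - \<alpha> + sqrt (1 - 4 * \<alpha> * fst p)}"
    by (auto simp: Lambda_minus_def)
  also have "\<dots> \<in> sets borel"
    by (intro sets.Int sets_Lambda borel_closed[OF closed_Collect_le] borel_open[OF open_Collect_less] continuous_intros)
  finally show ?thesis .
qed

lemma powr_minus_half_square: "0 < (r::real) \<Longrightarrow> (r\<^sup>2) powr (- 1 / 2) = 1 / r"
  by (simp add: powr_minus powr_half_sqrt inverse_eq_divide flip: powr_half_sqrt)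

text \<open>Substitution z = g t, where 1 - 4 w z = (1 - 2 w t)^2 makes the Jacobian cancel the
  density. By 1 - w - g t = (1 - t) (1 - w (1 + t)) the slice of the domain is mapped onto 0 < z < 1
  - w, the constraint w + z < 1 of \<open>Lambda\<close>.\<close>

lemma direct_slice:
  assumes \<alpha>: "\<alpha> \<le> 1" and S[measurable]: "S \<in> sets borel"
  shows "emeasure lborel {t. (t, w) \<in> direct_set \<alpha> \<inter> direct_pair -` S}
    = (\<integral>\<^sup>+z. ennreal (indicator (S \<inter> Lambda \<alpha>) (w, z) * (1 - 4 * w * z) powr (- 1 / 2)) \<partial>lborel)"
proof (cases "0 < w \<and> w < \<alpha>")
  case False
  then have e: "{t. (t, w) \<in> direct_set \<alpha> \<inter> direct_pair -` S} = {}" and "\<And>z. (w, z) \<notin> Lambda \<alpha>"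
    by (auto simp: direct_set_def cf_domain_def Lambda_def)
  then show ?thesis unfolding e by simp
next
  case True
  \<comment> \<open>The upper end of the slice of \<open>cf_domain\<close> at height w. By
    \<open>wb\<close> it does not pass 1 / (2 w), the vertex of the parabola g, so g is increasing
    up to \<open>b\<close>.\<close>
  define b where "b = min 1 (1 / w - 1)"
  define g where "g t = t - w * t\<^sup>2" for t :: real
  define F where "F z = indicator (S \<inter> Lambda \<alpha>) (w, z) * (1 - 4 * w * z) powr (- 1 / 2)" for z
  have w: "0 < w" "w < 1" using True \<alpha> by auto
  have b0: "0 < b" using w by (simp add: b_def)
  have tb: "t < b \<longleftrightarrow> t < 1 \<and> w * (1 + t) < 1" for t
    using w by (auto simp: b_def field_simps)
  have wb: "2 * w * b \<le> 1"
  proof -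
    have "w * b \<le> w * 1" "w * b \<le> w * (1 / w - 1)" using w by (auto simp: b_def intro!: mult_left_mono)
    moreover have "w * (1 / w - 1) = 1 - w" using w by (simp add: field_simps)
    ultimately show ?thesis by linarith
  qed
  have g_sq: "1 - 4 * w * g t = (1 - 2 * w * t)\<^sup>2" for t
    by (simp add: g_def power2_eq_square algebra_simps)
  have gf: "1 - w - g t = (1 - t) * (1 - w * (1 + t))" for t
    by (simp add: g_def power2_eq_square algebra_simps)
  have gb: "g b = 1 - w"
  proof -
    have "(1 - b) * (1 - w * (1 + b)) = 0"
      using w by (auto simp: b_def min_def field_simps)
    then have "1 - w - g b = 0" by (simp only: gf)
    then show ?thesis by simp
  qed
  have [measurable]: "F \<in> borel_measurable borel"
    unfolding F_def by measurable
  have "(\<integral>\<^sup>+z. ennreal (F z) \<partial>lborel) = (\<integral>\<^sup>+z. ennreal (F z * indicator {g 0..g b} z) \<partial>lborel)"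
    by (intro nn_integral_cong) (auto simp: F_def gb g_def[of 0] Lambda_def split: split_indicator)
  also have "\<dots> = (\<integral>\<^sup>+t. ennreal (F (g t) * (1 - 2 * w * t) * indicator {0..b} t) \<partial>lborel)"
  proof (rule nn_integral_substitution)
    show "set_borel_measurable borel {g 0..g b} F"
      unfolding set_borel_measurable_def by measurable
    show "(g has_real_derivative 1 - 2 * w * t) (at t)" for t
      unfolding g_def by (auto intro!: derivative_eq_intros simp: power2_eq_square)
    show "0 \<le> 1 - 2 * w * t" if "t \<in> {0..b}" for t
    proof -
      have "2 * w * t \<le> 2 * w * b" using that w by (intro mult_left_mono) auto
      then show ?thesis using wb by linarith
    qed
  qed (use b0 in \<open>auto intro!: continuous_intros\<close>)
  also have "\<dots> = (\<integral>\<^sup>+t. indicator {t. (t, w) \<in> direct_set \<alpha> \<inter> direct_pair -` S} t \<partial>lborel)"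
  proof (intro nn_integral_cong_AE,
      use AE_lborel_singleton[of "0::real"] AE_lborel_singleton[of b] in eventually_elim)
    fix t assume ne: "t \<noteq> 0" "t \<noteq> b"
    show "ennreal (F (g t) * (1 - 2 * w * t) * indicator {0..b} t)
        = indicator {t. (t, w) \<in> direct_set \<alpha> \<inter> direct_pair -` S} t"
    proof (cases "0 < t \<and> t < b")
      case True
      then have t: "0 < t" "t < 1" "w * (1 + t) < 1" using tb by auto
      have pos: "0 < 1 - 2 * w * t"
      proof -
        have "2 * w * t < 2 * w * b" using True w by (intro mult_strict_left_mono) auto
        then show ?thesis using wb by linarith
      qed
      have "0 < (1 - t) * (1 - w * (1 + t))" using t by simp
      then have "g t < 1 - w" using gf[of t] by simp
      moreover have "0 < g t"
      proof -
        have "t * w < 1" using t w by (auto simp: algebra_simps)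
        then have "0 < t * (1 - t * w)" using t by simp
        then show ?thesis by (simp add: g_def power2_eq_square algebra_simps)
      qed
      ultimately have iff: "(w, g t) \<in> S \<inter> Lambda \<alpha> \<longleftrightarrow> (t, w) \<in> direct_set \<alpha> \<inter> direct_pair -` S"
        using t w \<open>0 < w \<and> w < \<alpha>\<close>
        by (auto simp: Lambda_def direct_set_def direct_pair_def cf_domain_def g_def)
      have "(1 - 4 * w * g t) powr (- 1 / 2) * (1 - 2 * w * t) = 1"
        unfolding g_sq powr_minus_half_square[OF pos] using pos by simp
      then show ?thesis using True iff by (simp add: F_def indicator_def)
    next
      case False
      then have "t \<notin> {0..b}" using ne by auto
      moreover have "(t, w) \<notin> direct_set \<alpha>" using False tb[of t] by (auto simp: direct_set_def cf_domain_def)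
      ultimately show ?thesis by simp
    qed
  qed
  also have "\<dots> = emeasure lborel {t. (t, w) \<in> direct_set \<alpha> \<inter> direct_pair -` S}"
  proof (rule nn_integral_indicator)
    have "(\<lambda>t. (t, w)) \<in> borel_measurable borel"
      by (intro borel_measurable_continuous_onI continuous_intros)
    from measurable_sets_borel[OF this sets_direct_vimage[OF S]]
    show "{t. (t, w) \<in> direct_set \<alpha> \<inter> direct_pair -` S} \<in> sets lborel" by (simp add: vimage_def)
  qed
  finally show ?thesis by (simp add: F_def)
qed

text \<open>The second coordinate is u = w - z + sqrt (1 - 4 w z), decreasing in z, as long as 1 - 2
  w t is nonnegative. The bound defining \<open>Lambda_minus\<close> is its value at z = \<alpha>,
  so being below it means z > \<alpha>.\<close>

lemma skip_pair_mem_Lambda_minus_iff: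
  assumes \<alpha>: "1 / 2 \<le> \<alpha>" "\<alpha> \<le> 1" and w: "0 < w" "w < \<alpha>" and t: "0 < t" "t < 1"
  shows "(w, (1 - t) + w * (1 - t)\<^sup>2) \<in> Lambda_minus \<alpha> \<longleftrightarrow> w * (1 + t) < 1 \<and> \<alpha> < t - w * t\<^sup>2"
proof -
  define z where "z = t - w * t\<^sup>2"
  define u where "u = (1 - t) + w * (1 - t)\<^sup>2"
  have sq: "1 - 4 * w * z = (1 - 2 * w * t)\<^sup>2"
    by (simp add: z_def power2_eq_square algebra_simps)
  have u: "u = w + (1 - 2 * w * t) - z"
    by (simp add: u_def z_def power2_eq_square algebra_simps)
  have u0: "0 < u" using t w by (simp add: u_def add_pos_nonneg)
  have z1: "1 - w - z = (1 - t) * (1 - w * (1 + t))"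
    by (simp add: z_def power2_eq_square algebra_simps)
  show ?thesis
    unfolding u_def[symmetric] z_def[symmetric]
  proof
    assume "(w, u) \<in> Lambda_minus \<alpha>"
    then have L: "4 * \<alpha> * w \<le> 1" "u < w - \<alpha> + sqrt (1 - 4 * \<alpha> * w)"
      by (auto simp: Lambda_minus_def)
    \<comment> \<open>Positivity of u gives (\<alpha> + w)^2 < 1, hence w < 1 / 2, so that 1 - 2 w t
      is the nonnegative root.\<close>
    have "\<alpha> - w < sqrt (1 - 4 * \<alpha> * w)" using L u0 by linarith
    then have "(\<alpha> - w)\<^sup>2 < (sqrt (1 - 4 * \<alpha> * w))\<^sup>2"
      using w by (intro power_strict_mono) auto
    then have "(\<alpha> - w)\<^sup>2 < 1 - 4 * \<alpha> * w" using L(1) by simp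
    then have "(\<alpha> + w)\<^sup>2 < 1\<^sup>2" by (simp add: power2_eq_square algebra_simps)
    then have "\<alpha> + w < 1" by (rule power_less_imp_less_base) simp
    then have w2: "w < 1 / 2" using \<alpha> by linarith
    then have wt: "w * t < 1 / 2" using mult_strict_mono[of w "1 / 2" t 1] w t by simp
    have "w * (1 + t) < 1" using wt w2 by (simp add: algebra_simps)
    moreover have "\<alpha> < z"
    proof (rule ccontr)
      assume "\<not> \<alpha> < z"
      then have "w * z \<le> w * \<alpha>" using w by (intro mult_left_mono) auto
      then have "1 - 4 * \<alpha> * w \<le> (1 - 2 * w * t)\<^sup>2" using sq by (simp add: algebra_simps)
      then have "sqrt (1 - 4 * \<alpha> * w) \<le> 1 - 2 * w * t" using wt by (intro real_le_lsqrt) auto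
      then show False using L(2) u \<open>\<not> \<alpha> < z\<close> by linarith
    qed
    ultimately show "w * (1 + t) < 1 \<and> \<alpha> < z" ..
  next
    assume A: "w * (1 + t) < 1 \<and> \<alpha> < z"
    then have "0 < (1 - t) * (1 - w * (1 + t))" using t by simp
    then have zw: "z < 1 - w" using z1 by simp
    then have w2: "w < 1 - \<alpha>" "w < 1 / 2" using A \<alpha> by linarith+
    then have wt: "w * t < 1 / 2" using mult_strict_mono[of w "1 / 2" t 1] w t by simp
    have "0 \<le> w * t\<^sup>2" using w by simp
    then have "z \<le> t" by (simp add: z_def)
    then have t2: "1 / 2 < t" using A \<alpha> by linarith
    \<comment> \<open>This yields u < 1 - z < 1 - \<alpha>; together with w < 1 - \<alpha> and
      \<alpha> >= 1 / 2 it puts the point in \<open>Lambda \<alpha>\<close>.\<close>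
    have "w * (1 - t)\<^sup>2 < w * t\<^sup>2" using w t t2 by (intro mult_strict_left_mono power_strict_mono) auto
    then have uz: "u < 1 - z" by (simp add: u_def z_def)
    have "4 * \<alpha> * w \<le> 4 * \<alpha> * (1 - \<alpha>)" using w2 \<alpha> by (intro mult_left_mono) auto
    moreover have "4 * \<alpha> * (1 - \<alpha>) = 1 - (2 * \<alpha> - 1)\<^sup>2" by (simp add: power2_eq_square algebra_simps)
    ultimately have aw: "4 * \<alpha> * w \<le> 1" by (smt (verit) zero_le_power2)
    have "w * \<alpha> < w * z" using w A by simp
    then have "(1 - 2 * w * t)\<^sup>2 < 1 - 4 * \<alpha> * w" using sq by (simp add: algebra_simps)
    then have "1 - 2 * w * t < sqrt (1 - 4 * \<alpha> * w)" by (rule real_less_rsqrt)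
    then have "u < w - \<alpha> + sqrt (1 - 4 * \<alpha> * w)" using u A by linarith
    then show "(w, u) \<in> Lambda_minus \<alpha>"
      using aw uz w w2 u0 A \<alpha> by (auto simp: Lambda_minus_def Lambda_def)
  qed
qed

text \<open>Here 1 + 4 w z = (1 + 2 w s)^2 cancels the Jacobian of z = s + w s^2, and the reflection
  s = 1 - t returns to the coordinate t.\<close>

lemma skip_slice:
  assumes \<alpha>: "1 / 2 \<le> \<alpha>" "\<alpha> \<le> 1" and S[measurable]: "S \<in> sets borel"
  shows "emeasure lborel {t. (t, w) \<in> skip_set \<alpha> \<inter> skip_pair -` S}
    = (\<integral>\<^sup>+z. ennreal (indicator (S \<inter> Lambda_minus \<alpha>) (w, z) * (1 + 4 * w * z) powr (- 1 / 2)) \<partial>lborel)"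
proof (cases "0 < w \<and> w < \<alpha>")
  case False
  then have e: "{t. (t, w) \<in> skip_set \<alpha> \<inter> skip_pair -` S} = {}" and "\<And>z. (w, z) \<notin> Lambda_minus \<alpha>"
    by (auto simp: skip_set_def cf_domain_def Lambda_minus_def Lambda_def)
  then show ?thesis unfolding e by simp
next
  case True
  define g where "g s = s + w * s\<^sup>2" for s :: real
  define F where "F z = indicator (S \<inter> Lambda_minus \<alpha>) (w, z) * (1 + 4 * w * z) powr (- 1 / 2)" for z
  have w: "0 < w" "w < \<alpha>" using True by auto
  have g_sq: "1 + 4 * w * g s = (1 + 2 * w * s)\<^sup>2" for s
    by (simp add: g_def power2_eq_square algebra_simps)
  have [measurable]: "F \<in> borel_measurable borel"
    unfolding F_def by measurable
  have "(\<integral>\<^sup>+z. ennreal (F z) \<partial>lborel) = (\<integral>\<^sup>+z. ennreal (F z * indicator {g 0..g 1} z) \<partial>lborel)"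
    using w by (intro nn_integral_cong)
      (auto simp: F_def g_def Lambda_minus_def Lambda_def split: split_indicator)
  also have "\<dots> = (\<integral>\<^sup>+s. ennreal (F (g s) * (1 + 2 * w * s) * indicator {0..1} s) \<partial>lborel)"
  proof (rule nn_integral_substitution)
    show "set_borel_measurable borel {g 0..g 1} F"
      unfolding set_borel_measurable_def by measurable
    show "(g has_real_derivative 1 + 2 * w * s) (at s)" for s
      unfolding g_def by (auto intro!: derivative_eq_intros simp: power2_eq_square)
  qed (use w in \<open>auto intro!: continuous_intros\<close>)
  also have "\<dots> = (\<integral>\<^sup>+t. ennreal (F (g (1 - t)) * (1 + 2 * w * (1 - t)) * indicator {0..1} (1 - t)) \<partial>lborel)"
  proof -
    have [measurable]: "g \<in> borel_measurable borel" unfolding g_def by measurable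
    show ?thesis by (subst nn_integral_real_affine[where c = "-1" and t = 1]) auto
  qed
  also have "\<dots> = (\<integral>\<^sup>+t. indicator {t. (t, w) \<in> skip_set \<alpha> \<inter> skip_pair -` S} t \<partial>lborel)"
  proof (intro nn_integral_cong_AE,
      use AE_lborel_singleton[of "0::real"] AE_lborel_singleton[of 1] in eventually_elim)
    fix t :: real assume ne: "t \<noteq> 0" "t \<noteq> 1"
    show "ennreal (F (g (1 - t)) * (1 + 2 * w * (1 - t)) * indicator {0..1} (1 - t))
        = indicator {t. (t, w) \<in> skip_set \<alpha> \<inter> skip_pair -` S} t"
    proof (cases "0 < t \<and> t < 1")
      case True
      then have pos: "0 < 1 + 2 * w * (1 - t)" using w by (simp add: add_pos_nonneg)
      have iff: "(w, g (1 - t)) \<in> S \<inter> Lambda_minus \<alpha> \<longleftrightarrow> (t, w) \<in> skip_set \<alpha> \<inter> skip_pair -` S"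
        using skip_pair_mem_Lambda_minus_iff[OF \<alpha> w, of t] True w
        by (auto simp: skip_set_def skip_pair_def cf_domain_def g_def)
      have "(1 + 4 * w * g (1 - t)) powr (- 1 / 2) * (1 + 2 * w * (1 - t)) = 1"
        unfolding g_sq powr_minus_half_square[OF pos] using pos by simp
      then show ?thesis using True iff by (simp add: F_def indicator_def)
    next
      case False
      then have "1 - t \<notin> {0..1}" using ne by auto
      moreover have "(t, w) \<notin> skip_set \<alpha>" using False by (auto simp: skip_set_def cf_domain_def)
      ultimately show ?thesis by simp
    qed
  qed
  also have "\<dots> = emeasure lborel {t. (t, w) \<in> skip_set \<alpha> \<inter> skip_pair -` S}"
  proof (rule nn_integral_indicator)
    have "(\<lambda>t. (t, w)) \<in> borel_measurable borel"
      by (intro borel_measurable_continuous_onI continuous_intros)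
    from measurable_sets_borel[OF this sets_skip_vimage[OF S]]
    show "{t. (t, w) \<in> skip_set \<alpha> \<inter> skip_pair -` S} \<in> sets lborel" by (simp add: vimage_def)
  qed
  finally show ?thesis by (simp add: F_def)
qed

lemma borel_measurable_coordinate [measurable]:
  "fst \<in> borel_measurable (borel :: (real \<times> real) measure)"
  "snd \<in> borel_measurable (borel :: (real \<times> real) measure)"
  by (intro borel_measurable_continuous_onI continuous_intros)+

lemma emeasure_direct_vimage:
  assumes \<alpha>: "\<alpha> \<le> 1" and S[measurable]: "S \<in> sets borel"
  shows "emeasure lborel (direct_set \<alpha> \<inter> direct_pair -` S)
    = (\<integral>\<^sup>+p. ennreal (indicator (S \<inter> Lambda \<alpha>) p * (1 - 4 * fst p * snd p) powr (- 1 / 2)) \<partial>lborel)"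
proof -
  have "(\<lambda>p. ennreal (indicator (S \<inter> Lambda \<alpha>) p * (1 - 4 * fst p * snd p) powr (- 1 / 2))) \<in> borel_measurable borel"
    by measurable
  from nn_integral_lborel_pair[OF this] show ?thesis
    by (simp add: emeasure_lborel_snd_slices[OF sets_direct_vimage[OF S]] direct_slice[OF \<alpha> S, simplified])
qed

lemma emeasure_skip_vimage:
  assumes \<alpha>: "1 / 2 \<le> \<alpha>" "\<alpha> \<le> 1" and S[measurable]: "S \<in> sets borel"
  shows "emeasure lborel (skip_set \<alpha> \<inter> skip_pair -` S)
    = (\<integral>\<^sup>+p. ennreal (indicator (S \<inter> Lambda_minus \<alpha>) p * (1 + 4 * fst p * snd p) powr (- 1 / 2)) \<partial>lborel)"
proof -
  have "(\<lambda>p. ennreal (indicator (S \<inter> Lambda_minus \<alpha>) p * (1 + 4 * fst p * snd p) powr (- 1 / 2))) \<in> borel_measurable borel"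
    by measurable
  from nn_integral_lborel_pair[OF this] show ?thesis
    by (simp add: emeasure_lborel_snd_slices[OF sets_skip_vimage[OF S]] skip_slice[OF \<alpha> S, simplified])
qed

section \<open>The normalising constant as an area\<close>

lemma emeasure_cf_domain_below:
  assumes \<alpha>: "0 < \<alpha>"
  shows "emeasure lborel ({p. snd p < \<alpha>} \<inter> cf_domain)
    = (\<integral>\<^sup>+t. ennreal (min \<alpha> (1 / (1 + t))) * indicator {0<..<1} t \<partial>lborel)"
proof -
  have "{p. snd p < \<alpha>} \<inter> cf_domain \<in> sets borel"
    by (intro borel_open open_Int open_cf_domain open_Collect_less continuous_intros)
  moreover have "emeasure lborel {w. (t, w) \<in> {p. snd p < \<alpha>} \<inter> cf_domain}
      = ennreal (min \<alpha> (1 / (1 + t))) * indicator {0<..<1} t" for t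
  proof (cases "t \<in> {0<..<1}")
    case True
    then have e: "{w. (t, w) \<in> {p. snd p < \<alpha>} \<inter> cf_domain} = {0<..<min \<alpha> (1 / (1 + t))}"
      by (auto simp: cf_domain_def field_simps)
    show ?thesis unfolding e using True \<alpha> by simp
  next
    case False
    then have e: "{w. (t, w) \<in> {p. snd p < \<alpha>} \<inter> cf_domain} = {}" by (auto simp: cf_domain_def)
    show ?thesis unfolding e using False by simp
  qed
  ultimately show ?thesis by (simp add: emeasure_lborel_fst_slices)
qed

lemma nn_integral_inverse_square_tail:
  fixes x d :: real
  assumes "0 < d"
  shows "(\<integral>\<^sup>+y. ennreal (1 / (x - y)\<^sup>2) * indicator {y. d < x - y} y \<partial>lborel) = ennreal (1 / d)"
proof -
  have "(\<integral>\<^sup>+y. ennreal (1 / (x - y)\<^sup>2) * indicator {y. d < x - y} y \<partial>lborel)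
      = (\<integral>\<^sup>+y. ennreal (1 / (x - (x + (-1) * y))\<^sup>2) * indicator {y. d < x - y} (x + (-1) * y) \<partial>lborel)"
    by (subst nn_integral_real_affine[where c = "-1" and t = x]) auto
  also have "\<dots> = (\<integral>\<^sup>+y. ennreal (1 / y\<^sup>2) * indicator {d..} y \<partial>lborel)"
    by (intro nn_integral_cong_AE, use AE_lborel_singleton[of d] in eventually_elim)
      (auto split: split_indicator)
  also have "\<dots> = ennreal (0 - (- 1 / d))"
  proof (rule nn_integral_FTC_atLeast)
    show "((\<lambda>y. - 1 / y) has_real_derivative 1 / y\<^sup>2) (at y)" if "d \<le> y" for y
      using that assms by (auto intro!: derivative_eq_intros simp: power2_eq_square)
    show "((\<lambda>y :: real. - 1 / y) \<longlongrightarrow> 0) at_top" by real_asymp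
  qed auto
  finally show ?thesis by simp
qed

text \<open>The substitution \<open>w = 1 / (x - y)\<close> maps \<^term>\<open>Omega \<alpha>\<close> with density
  \<open>(x - y)\<^sup>-\<^sup>2\<close> to Lebesgue measure on the part of \<^const>\<open>cf_domain\<close> below \<open>\<alpha>\<close>.\<close>

lemma c_const_eq:
  assumes \<alpha>: "1 / 2 \<le> \<alpha>"
  shows "c_const \<alpha> = inverse (measure lborel ({p. snd p < \<alpha>} \<inter> cf_domain))"
    and "0 < measure lborel ({p. snd p < \<alpha>} \<inter> cf_domain)"
proof -
  let ?C = "{p. snd p < \<alpha>} \<inter> cf_domain"
  have [measurable]: "Omega \<alpha> \<in> sets borel"
  proof -
    have "Omega \<alpha> = {p. 0 < fst p} \<inter> {p. fst p < 1} \<inter> {p. snd p < -1} \<inter> {p. 1 / \<alpha> < fst p - snd p}"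
      by (auto simp: Omega_def)
    also have "\<dots> \<in> sets borel"
      by (intro borel_open open_Int open_Collect_less continuous_intros)
    finally show ?thesis .
  qed
  have [measurable]: "(\<lambda>p. indicator (Omega \<alpha>) p * (1 / (fst p - snd p)\<^sup>2)) \<in> borel_measurable borel"
    by measurable
  have "(\<integral>\<^sup>+p. ennreal (indicator (Omega \<alpha>) p * (1 / (fst p - snd p)\<^sup>2)) \<partial>lborel)
      = (\<integral>\<^sup>+x. \<integral>\<^sup>+y. ennreal (indicator (Omega \<alpha>) (x, y) * (1 / (x - y)\<^sup>2)) \<partial>lborel \<partial>lborel)"
    by (subst nn_integral_lborel_pair) auto
  also have "\<dots> = (\<integral>\<^sup>+t. ennreal (min \<alpha> (1 / (1 + t))) * indicator {0<..<1} t \<partial>lborel)"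
  proof (rule nn_integral_cong)
    fix x :: real
    show "(\<integral>\<^sup>+y. ennreal (indicator (Omega \<alpha>) (x, y) * (1 / (x - y)\<^sup>2)) \<partial>lborel)
        = ennreal (min \<alpha> (1 / (1 + x))) * indicator {0<..<1} x"
    proof (cases "x \<in> {0<..<1}")
      case True
      \<comment> \<open>Both constraints on y bound x - y from below: y < -1 says 1 + x < x -
        y.\<close>
      define d where "d = max (1 / \<alpha>) (1 + x)"
      have "(x, y) \<in> Omega \<alpha> \<longleftrightarrow> d < x - y" for y using True by (auto simp: Omega_def d_def)
      then have "(\<integral>\<^sup>+y. ennreal (indicator (Omega \<alpha>) (x, y) * (1 / (x - y)\<^sup>2)) \<partial>lborel)
          = (\<integral>\<^sup>+y. ennreal (1 / (x - y)\<^sup>2) * indicator {y. d < x - y} y \<partial>lborel)"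
        by (intro nn_integral_cong) (auto simp: indicator_def)
      also have "\<dots> = ennreal (1 / d)"
        using True by (intro nn_integral_inverse_square_tail) (auto simp: d_def)
      also have "1 / d = min \<alpha> (1 / (1 + x))"
        using True \<alpha> by (auto simp: d_def max_def min_def field_simps)
      finally show ?thesis using True by simp
    next
      case False
      then have "(x, y) \<notin> Omega \<alpha>" for y by (auto simp: Omega_def)
      then show ?thesis using False by simp
    qed
  qed
  also have "\<dots> = emeasure lborel ?C" using \<alpha> by (simp add: emeasure_cf_domain_below)
  finally have E: "(\<integral>\<^sup>+p. ennreal (indicator (Omega \<alpha>) p * (1 / (fst p - snd p)\<^sup>2)) \<partial>lborel) = emeasure lborel ?C" .
  have "(LINT p:Omega \<alpha>|lborel. 1 / (fst p - snd p)\<^sup>2)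
      = enn2real (\<integral>\<^sup>+p. ennreal (indicator (Omega \<alpha>) p * (1 / (fst p - snd p)\<^sup>2)) \<partial>lborel)"
    unfolding set_lebesgue_integral_def real_scaleR_def
    by (intro integral_eq_nn_integral) auto
  then show "c_const \<alpha> = inverse (measure lborel ?C)"
    unfolding c_const_def E measure_def by simp
  have "ennreal (1 / 2) = (\<integral>\<^sup>+t. ennreal (1 / 2) * indicator {0<..<1} (t :: real) \<partial>lborel)"
    by (subst nn_integral_cmult_indicator) auto
  also have "\<dots> \<le> (\<integral>\<^sup>+t. ennreal (min \<alpha> (1 / (1 + t))) * indicator {0<..<1} t \<partial>lborel)"
  proof (rule nn_integral_mono)
    fix t :: real
    have "1 / 2 \<le> min \<alpha> (1 / (1 + t))" if "t \<in> {0<..<1}"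
      using that \<alpha> by (auto simp: min_def field_simps)
    then show "ennreal (1 / 2) * indicator {0<..<1} t \<le> ennreal (min \<alpha> (1 / (1 + t))) * indicator {0<..<1} t"
      using ennreal_leI[of "1 / 2" "min \<alpha> (1 / (1 + t))"] by (simp split: split_indicator)
  qed
  also have "\<dots> = emeasure lborel ?C" using \<alpha> by (simp add: emeasure_cf_domain_below)
  finally have ge: "ennreal (1 / 2) \<le> emeasure lborel ?C" .
  have "emeasure lborel ?C \<le> emeasure lborel cf_domain"
    by (intro emeasure_mono) (auto intro: borel_open[OF open_cf_domain])
  then have "emeasure lborel ?C \<noteq> \<infinity>" by (auto simp: emeasure_cf_domain top_unique)
  then have "ennreal (1 / 2) \<le> ennreal (measure lborel ?C)" using ge by (simp add: emeasure_eq_ennreal_measure)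
  then have "1 / 2 \<le> measure lborel ?C" by (subst (asm) ennreal_le_iff) auto
  then show "0 < measure lborel ?C" by linarith
qed

subsection \<open>Counting along the subsequence\<close>

text \<open>Orbit statistics include m = 0, whereas the subsequence of coefficients starts at index
  1.\<close>

lemma tendsto_card_drop_zero:
  assumes "(\<lambda>N. real (card {m. m < N \<and> P m}) / real N) \<longlonglongrightarrow> L"
  shows "(\<lambda>N. real (card {m. m < N \<and> 0 < m \<and> P m}) / real N) \<longlonglongrightarrow> L"
proof -
  define \<delta> :: nat where "\<delta> = (if P 0 then 1 else 0)"
  have card: "card {m. m < N \<and> P m} = card {m. m < N \<and> 0 < m \<and> P m} + \<delta>" if "N > 0" for N
  proof (cases "P 0")
    case True
    then have "{m. m < N \<and> P m} = insert 0 {m. m < N \<and> 0 < m \<and> P m}" using that by auto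
    then show ?thesis using True by (simp add: \<delta>_def)
  next
    case False
    then have "{m. m < N \<and> P m} = {m. m < N \<and> 0 < m \<and> P m}" by (auto intro: gr0I)
    then show ?thesis using False by (simp add: \<delta>_def)
  qed
  have ev: "eventually (\<lambda>N. real (card {m. m < N \<and> P m}) / real N - real \<delta> / real N
      = real (card {m. m < N \<and> 0 < m \<and> P m}) / real N) sequentially"
    using eventually_gt_at_top[of 0] by eventually_elim (simp add: card add_divide_distrib)
  have "(\<lambda>N. real (card {m. m < N \<and> P m}) / real N - real \<delta> / real N) \<longlonglongrightarrow> L - 0"
    by (intro tendsto_diff assms lim_const_over_n)
  then show ?thesis using tendsto_cong[OF ev] by simp
qed

text \<open>When \<open>theta x m\<close> is below \<alpha> this pairs it with its successor in the
  subsequence: at most one index is skipped, by \<open>theta_below_consecutive\<close>.\<close>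

definition next_pair :: "real \<Rightarrow> real \<Rightarrow> nat \<Rightarrow> real \<times> real" where
  "next_pair \<alpha> x m = (theta x m, if theta x (Suc m) < \<alpha> then theta x (Suc m) else theta x (Suc (Suc m)))"

text \<open>Vahlen's theorem from \<open>theta_eq_Suc\<close>: two consecutive values of at least 1
  / 2 would give 1 / 2 <= t - t^2 / 2, that is (1 - t)^2 <= 0, against t < 1.\<close>

lemma theta_below_consecutive:
  assumes x: "x \<in> {0<..<1} - \<rat>" and \<alpha>: "1 / 2 \<le> \<alpha>"
  shows "theta x m < \<alpha> \<or> theta x (Suc m) < \<alpha>"
proof (rule ccontr)
  assume A: "\<not> (theta x m < \<alpha> \<or> theta x (Suc m) < \<alpha>)"
  define t where "t = (gauss_map ^^ Suc m) x"
  have t: "theta x (Suc m) = t - theta x m * t\<^sup>2" "0 < t" "t < 1"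
    using theta_eq_Suc[OF x, of m] by (simp_all add: t_def)
  have "1 / 2 * t\<^sup>2 \<le> theta x m * t\<^sup>2" using A \<alpha> by (intro mult_right_mono) auto
  then have "1 / 2 \<le> t - 1 / 2 * t\<^sup>2" using t(1) A \<alpha> by linarith
  then have "(1 - t)\<^sup>2 \<le> 0" by (simp add: power2_eq_square algebra_simps)
  then show False using t by (simp add: power2_eq_square mult_le_0_iff)
qed

text \<open>Since \<open>enumerate\<close> starts at 0, exactly n elements of \<open>A\<close> lie
  below \<open>enumerate A n\<close>, and the first n pairs begin at these. Counting pairs thus
  becomes counting orbit indices below a bound.\<close>

lemma theta_bar_pair_count:
  assumes x: "x \<in> {0<..<1} - \<rat>" and \<alpha>: "1 / 2 \<le> \<alpha>"
  defines "A \<equiv> {n. 0 < n \<and> theta x n < \<alpha>}"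
  shows "infinite A"
    and "card {j \<in> {1..n}. (theta_bar \<alpha> x j, theta_bar \<alpha> x (j + 1)) \<in> B}
      = card {m. m < enumerate A n \<and> 0 < m \<and> theta x m < \<alpha> \<and> next_pair \<alpha> x m \<in> B}"
    and "card {m. m < enumerate A n \<and> 0 < m \<and> theta x m < \<alpha>} = n"
proof -
  show inf: "infinite A"
    unfolding infinite_nat_iff_unbounded
  proof
    fix m
    show "\<exists>n>m. n \<in> A"
      using theta_below_consecutive[OF x \<alpha>, of "Suc m"] by (auto simp: A_def intro: exI[of _ "Suc m"] exI[of _ "Suc (Suc m)"])
  qed
  define e where "e = enumerate A"
  have mono: "strict_mono e" unfolding e_def by (intro strict_monoI enumerate_mono inf)
  have inA: "e k \<in> A" for k unfolding e_def by (rule enumerate_in_set[OF inf])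
  have below: "e ` {..<n} = {m. m < e n \<and> m \<in> A}" for n
  proof (intro equalityI subsetI)
    fix m assume "m \<in> e ` {..<n}"
    then show "m \<in> {m. m < e n \<and> m \<in> A}" using inA strict_monoD[OF mono] by auto
  next
    fix m assume m: "m \<in> {m. m < e n \<and> m \<in> A}"
    then obtain k where "e k = m" using enumerate_Ex[OF inf] by (auto simp: e_def)
    then show "m \<in> e ` {..<n}" using m strict_mono_less[OF mono] by auto
  qed
  have inj: "inj e" by (rule strict_mono_imp_inj_on[OF mono])
  have "card (e ` {..<n}) = n" using inj by (simp add: card_image inj_on_subset)
  then show "card {m. m < enumerate A n \<and> 0 < m \<and> theta x m < \<alpha>} = n"
    unfolding below by (simp add: A_def e_def)
  have succ: "(theta x (e k), theta x (e (Suc k))) = next_pair \<alpha> x (e k)" for k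
  proof -
    define m where "m = e k"
    have "e (Suc k) = (LEAST s. s \<in> A \<and> m < s)"
      unfolding e_def m_def by (rule enumerate_Suc''[OF inf])
    also have "\<dots> = (if theta x (Suc m) < \<alpha> then Suc m else Suc (Suc m))"
    proof (cases "theta x (Suc m) < \<alpha>")
      case True
      then show ?thesis by (auto simp: A_def intro!: Least_equality)
    next
      case False
      then have "theta x (Suc (Suc m)) < \<alpha>" using theta_below_consecutive[OF x \<alpha>, of "Suc m"] by simp
      with False show ?thesis
        by (auto simp: A_def intro!: Least_equality) (metis Suc_leI le_antisym not_less_eq_eq)
    qed
    finally show ?thesis by (simp add: next_pair_def m_def)
  qed
  have "card {m. m < e n \<and> 0 < m \<and> theta x m < \<alpha> \<and> next_pair \<alpha> x m \<in> B}
      = card ((\<lambda>j. e (j - 1)) ` {j \<in> {1..n}. (theta_bar \<alpha> x j, theta_bar \<alpha> x (j + 1)) \<in> B})"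
  proof (rule arg_cong[where f = card], intro equalityI subsetI)
    fix m assume m: "m \<in> {m. m < e n \<and> 0 < m \<and> theta x m < \<alpha> \<and> next_pair \<alpha> x m \<in> B}"
    then have "m \<in> e ` {..<n}" unfolding below by (auto simp: A_def)
    then obtain k where k: "k < n" "m = e k" by auto
    have "(theta_bar \<alpha> x (Suc k), theta_bar \<alpha> x (Suc k + 1)) = next_pair \<alpha> x m"
      unfolding k(2) succ[symmetric] by (simp add: theta_bar_def A_def e_def)
    then show "m \<in> (\<lambda>j. e (j - 1)) ` {j \<in> {1..n}. (theta_bar \<alpha> x j, theta_bar \<alpha> x (j + 1)) \<in> B}"
      using m k by (intro image_eqI[of _ _ "Suc k"]) auto
  next
    fix m assume "m \<in> (\<lambda>j. e (j - 1)) ` {j \<in> {1..n}. (theta_bar \<alpha> x j, theta_bar \<alpha> x (j + 1)) \<in> B}"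
    then obtain j where j: "m = e (j - 1)" "1 \<le> j" "j \<le> n"
      "(theta_bar \<alpha> x j, theta_bar \<alpha> x (j + 1)) \<in> B" by auto
    have "(theta_bar \<alpha> x j, theta_bar \<alpha> x (j + 1)) = next_pair \<alpha> x m"
      unfolding j(1) succ[symmetric] using j(2) by (simp add: theta_bar_def A_def e_def)
    moreover have "m \<in> e ` {..<n}" using j by auto
    ultimately show "m \<in> {m. m < e n \<and> 0 < m \<and> theta x m < \<alpha> \<and> next_pair \<alpha> x m \<in> B}"
      unfolding below using j(4) by (auto simp: A_def)
  qed
  also have "\<dots> = card {j \<in> {1..n}. (theta_bar \<alpha> x j, theta_bar \<alpha> x (j + 1)) \<in> B}"
    using inj by (intro card_image inj_onI) (auto dest!: injD)
  finally show "card {j \<in> {1..n}. (theta_bar \<alpha> x j, theta_bar \<alpha> x (j + 1)) \<in> B}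
      = card {m. m < enumerate A n \<and> 0 < m \<and> theta x m < \<alpha> \<and> next_pair \<alpha> x m \<in> B}"
    by (simp add: e_def)
qed

lemma next_pair_direct:
  assumes x: "x \<in> {0<..<1} - \<rat>" and p: "theta_point x m \<in> direct_set \<alpha>"
  shows "theta x m < \<alpha>" "next_pair \<alpha> x m = direct_pair (theta_point x m)"
  using p theta_eq_Suc(2)[OF x, of m]
  by (auto simp: direct_set_def theta_point_def next_pair_def direct_pair_def simp del: funpow.simps)

lemma next_pair_skip:
  assumes x: "x \<in> {0<..<1} - \<rat>" and \<alpha>: "1 / 2 \<le> \<alpha>" and p: "theta_point x m \<in> skip_set \<alpha>"
  shows "theta x m < \<alpha>" "next_pair \<alpha> x m = skip_pair (theta_point x m)"
proof -
  define t where "t = (gauss_map ^^ Suc m) x"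
  note eq = theta_eq_Suc[OF x, of m, folded t_def]
  have s: "theta x m < \<alpha>" "\<alpha> < theta x (Suc m)" "theta x m * t\<^sup>2 \<ge> 0"
    using p eq(2,6) by (auto simp: skip_set_def theta_point_def t_def simp del: funpow.simps)
  then have "1 / 2 < t" using eq(2) \<alpha> by linarith
  with eq(3) s show "theta x m < \<alpha>" "next_pair \<alpha> x m = skip_pair (theta_point x m)"
    by (auto simp: theta_point_def next_pair_def skip_pair_def t_def simp del: funpow.simps)
qed

lemma null_sets_curves:
  "cf_domain \<inter> {p. snd p = \<alpha>} \<in> null_sets lborel"
  "cf_domain \<inter> {p. fst p - snd p * (fst p)\<^sup>2 = \<alpha>} \<in> null_sets lborel"
proof -
  show "cf_domain \<inter> {p. snd p = \<alpha>} \<in> null_sets lborel"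
  proof (rule null_sets_lborel_fst_slices)
    show "cf_domain \<inter> {p. snd p = \<alpha>} \<in> sets borel"
      by (intro sets.Int borel_open[OF open_cf_domain] borel_closed[OF closed_Collect_eq] continuous_intros)
    show "countable {w. (t, w) \<in> cf_domain \<inter> {p. snd p = \<alpha>}}" for t
      by (rule countable_subset[of _ "{\<alpha>}"]) auto
  qed
  show "cf_domain \<inter> {p. fst p - snd p * (fst p)\<^sup>2 = \<alpha>} \<in> null_sets lborel"
  proof (rule null_sets_lborel_fst_slices)
    show "cf_domain \<inter> {p. fst p - snd p * (fst p)\<^sup>2 = \<alpha>} \<in> sets borel"
      by (intro sets.Int borel_open[OF open_cf_domain] borel_closed[OF closed_Collect_eq] continuous_intros)
    show "countable {w. (t, w) \<in> cf_domain \<inter> {p. fst p - snd p * (fst p)\<^sup>2 = \<alpha>}}" for t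
      by (rule countable_subset[of _ "{(t - \<alpha>) / t\<^sup>2}"]) (auto simp: cf_domain_def field_simps)
  qed
qed

text \<open>Carries the hypothesis on the frontier of B back to the (t, w) plane: both preimages
  have areas given by integrals over S.\<close>

lemma null_sets_pair_vimage:
  assumes \<alpha>: "1 / 2 \<le> \<alpha>" "\<alpha> \<le> 1" and S: "S \<in> null_sets lborel"
  shows "direct_set \<alpha> \<inter> direct_pair -` S \<in> null_sets lborel"
    and "skip_set \<alpha> \<inter> skip_pair -` S \<in> null_sets lborel"
proof -
  have [measurable]: "S \<in> sets borel" using S by auto
  have z: "(\<integral>\<^sup>+p. ennreal (indicator (S \<inter> T) p * f p) \<partial>lborel) = 0" for T and f :: "real \<times> real \<Rightarrow> real"
  proof -
    have "(\<integral>\<^sup>+p. ennreal (indicator (S \<inter> T) p * f p) \<partial>lborel) = (\<integral>\<^sup>+(p::real \<times> real). 0 \<partial>lborel)"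
      by (intro nn_integral_cong_AE, use AE_not_in[OF S] in eventually_elim) simp
    then show ?thesis by simp
  qed
  show "direct_set \<alpha> \<inter> direct_pair -` S \<in> null_sets lborel"
    using emeasure_direct_vimage[OF \<alpha>(2), of S] sets_direct_vimage[of S \<alpha>] by (simp add: null_sets_def z)
  show "skip_set \<alpha> \<inter> skip_pair -` S \<in> null_sets lborel"
    using emeasure_skip_vimage[OF \<alpha>, of S] sets_skip_vimage[of S \<alpha>] by (simp add: null_sets_def z)
qed

section \<open>Limiting frequency of the pairs and the density\<close>

text \<open>\<open>G\<close> and \<open>H\<close> decide the event: preimages of the interiors of B
  and of its complement, with w > \<alpha> added to \<open>H\<close>. What they leave uncovered lies
  on the curves w = \<alpha> and z = \<alpha> or over the frontier of B.\<close>

lemma theta_pair_frequency: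
  assumes x: "gauss_generic x" and \<alpha>: "1 / 2 \<le> \<alpha>" "\<alpha> \<le> 1"
    and B: "frontier B \<in> null_sets lborel"
  shows "(\<lambda>N. real (card {m. m < N \<and> theta x m < \<alpha> \<and> next_pair \<alpha> x m \<in> B}) / real N)
    \<longlonglongrightarrow> measure lborel (direct_set \<alpha> \<inter> direct_pair -` interior B \<union> skip_set \<alpha> \<inter> skip_pair -` interior B) / ln 2"
proof -
  have irr: "x \<in> {0<..<1} - \<rat>" using x by (simp add: gauss_generic_def)
  define E where "E S = direct_set \<alpha> \<inter> direct_pair -` S \<union> skip_set \<alpha> \<inter> skip_pair -` S" for S
  define G where "G = E (interior B)"
  define H where "H = E (interior (- B)) \<union> {p. \<alpha> < snd p}"
  have "open (direct_pair -` S)" "open (skip_pair -` S)" if "open S" for S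
    using that continuous_direct_pair continuous_skip_pair by (auto simp: continuous_on_open_vimage)
  then have oE: "open (E S)" if "open S" for S
    using that unfolding E_def by (intro open_Un open_Int open_direct_set open_skip_set) auto
  have oG: "open G" and oH: "open H"
    unfolding G_def H_def by (intro oE open_Un open_interior open_Collect_less continuous_intros)+
  have hit: "theta x m < \<alpha> \<and> next_pair \<alpha> x m \<in> S" if "theta_point x m \<in> E S" for S m
    using that next_pair_direct[OF irr] next_pair_skip[OF irr \<alpha>(1)] unfolding E_def by auto
  have dom: "G \<inter> cf_domain = G"
    unfolding G_def E_def by (auto simp: direct_set_def skip_set_def)
  have cover: "cf_domain - (G \<union> H) \<in> null_sets lborel"
  proof (rule null_sets_subset)
    show "(cf_domain \<inter> {p. snd p = \<alpha>}) \<union> (cf_domain \<inter> {p. fst p - snd p * (fst p)\<^sup>2 = \<alpha>})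
      \<union> ((direct_set \<alpha> \<inter> direct_pair -` frontier B) \<union> (skip_set \<alpha> \<inter> skip_pair -` frontier B)) \<in> null_sets lborel"
      by (intro null_sets.Un null_sets_curves null_sets_pair_vimage \<alpha> B)
    show "cf_domain - (G \<union> H) \<in> sets lborel"
      using oG oH open_cf_domain by (auto intro!: sets.Diff sets.Un)
    have cases: "q \<in> interior B \<or> q \<in> interior (- B) \<or> q \<in> frontier B" for q
      by (auto simp: frontier_def interior_closure)
    show "cf_domain - (G \<union> H) \<subseteq> (cf_domain \<inter> {p. snd p = \<alpha>}) \<union> (cf_domain \<inter> {p. fst p - snd p * (fst p)\<^sup>2 = \<alpha>})
      \<union> ((direct_set \<alpha> \<inter> direct_pair -` frontier B) \<union> (skip_set \<alpha> \<inter> skip_pair -` frontier B))"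
    proof
      fix p assume p: "p \<in> cf_domain - (G \<union> H)"
      obtain t w where tw: "p = (t, w)" by (cases p)
      consider "w = \<alpha>" | "t - w * t\<^sup>2 = \<alpha>" | "(t, w) \<in> direct_set \<alpha>" | "(t, w) \<in> skip_set \<alpha>"
        using p by (auto simp: tw H_def direct_set_def skip_set_def) linarith
      then show "p \<in> (cf_domain \<inter> {p. snd p = \<alpha>}) \<union> (cf_domain \<inter> {p. fst p - snd p * (fst p)\<^sup>2 = \<alpha>})
      \<union> ((direct_set \<alpha> \<inter> direct_pair -` frontier B) \<union> (skip_set \<alpha> \<inter> skip_pair -` frontier B))"
        using p cases[of "direct_pair p"] cases[of "skip_pair p"] by cases (auto simp: tw G_def H_def E_def)
    qed
  qed
  have "(\<lambda>N. real (card {m. m < N \<and> theta x m < \<alpha> \<and> next_pair \<alpha> x m \<in> B}) / real N)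
      \<longlonglongrightarrow> measure lborel (G \<inter> cf_domain) / ln 2"
  proof (rule theta_point_frequency[OF x oG oH _ cover])
    show "G \<inter> H = {}"
      using interior_subset[of B] interior_subset[of "- B"]
      by (auto simp: G_def H_def E_def direct_set_def skip_set_def)
    show "theta x m < \<alpha> \<and> next_pair \<alpha> x m \<in> B" if "theta_point x m \<in> G" for m
      using hit[of m "interior B"] that interior_subset[of B] by (auto simp: G_def)
    show "\<not> (theta x m < \<alpha> \<and> next_pair \<alpha> x m \<in> B)" if "theta_point x m \<in> H" for m
      using that hit[of m "interior (- B)"] interior_subset[of "- B"] by (auto simp: H_def theta_point_def)
  qed
  then show ?thesis unfolding dom unfolding G_def E_def .
qed

lemma theta_below_frequency:
  assumes x: "gauss_generic x"
  shows "(\<lambda>N. real (card {m. m < N \<and> theta x m < \<alpha>}) / real N)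
    \<longlonglongrightarrow> measure lborel ({p. snd p < \<alpha>} \<inter> cf_domain) / ln 2"
proof (rule theta_point_frequency[OF x])
  show "open {p :: real \<times> real. snd p < \<alpha>}" "open {p :: real \<times> real. \<alpha> < snd p}"
    by (intro open_Collect_less continuous_intros)+
  have "cf_domain - ({p. snd p < \<alpha>} \<union> {p. \<alpha> < snd p}) = cf_domain \<inter> {p. snd p = \<alpha>}" by auto
  then show "cf_domain - ({p. snd p < \<alpha>} \<union> {p. \<alpha> < snd p}) \<in> null_sets lborel"
    using null_sets_curves(1) by simp
qed (auto simp: theta_point_def)

text \<open>Because \<open>Lambda_minus\<close> is part of \<open>Lambda\<close>, the density splits
  into one term on all of \<open>Lambda\<close> and one on \<open>Lambda_minus\<close>; their
  integrals are the areas of the direct and the skip preimage. B and its interior agree up to the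
  null frontier.\<close>

lemma integral_lambda_density:
  assumes \<alpha>: "1 / 2 \<le> \<alpha>" "\<alpha> \<le> 1" and B: "B \<in> sets borel" "B \<subseteq> Lambda \<alpha>" "frontier B \<in> null_sets lborel"
  shows "(LINT p:B|lborel. lambda_density \<alpha> p)
    = c_const \<alpha> * measure lborel (direct_set \<alpha> \<inter> direct_pair -` interior B \<union> skip_set \<alpha> \<inter> skip_pair -` interior B)"
proof -
  define d :: "real \<times> real \<Rightarrow> real" where "d p = indicator (B \<inter> Lambda \<alpha>) p * (1 - 4 * fst p * snd p) powr (- 1 / 2)" for p
  define s :: "real \<times> real \<Rightarrow> real" where "s p = indicator (B \<inter> Lambda_minus \<alpha>) p * (1 + 4 * fst p * snd p) powr (- 1 / 2)" for p
  let ?D = "direct_set \<alpha> \<inter> direct_pair -` interior B" and ?S = "skip_set \<alpha> \<inter> skip_pair -` interior B"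
  note [measurable] = B(1)
  have [measurable]: "d \<in> borel_measurable borel" "s \<in> borel_measurable borel"
    unfolding d_def s_def by measurable
  have c: "0 \<le> c_const \<alpha>" using c_const_eq[OF \<alpha>(1)] by simp
  have dens: "indicator B p * lambda_density \<alpha> p = c_const \<alpha> * (d p + s p)" for p
    using B(2) by (cases p) (auto simp: d_def s_def lambda_density_def Lambda_plus_def Lambda_minus_def
      algebra_simps split: split_indicator)
  have int: "AE p in lborel. p \<in> interior B \<longleftrightarrow> p \<in> B"
    using AE_not_in[OF B(3)]
    by eventually_elim (use interior_subset[of B] closure_subset[of B] in \<open>auto simp: frontier_def\<close>)
  have "emeasure lborel ?D = (\<integral>\<^sup>+p. ennreal (d p) \<partial>lborel)"
    unfolding d_def
    by (subst emeasure_direct_vimage[OF \<alpha>(2)], simp, intro nn_integral_cong_AE, use int in eventually_elim)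
      (auto split: split_indicator)
  moreover have "emeasure lborel ?S = (\<integral>\<^sup>+p. ennreal (s p) \<partial>lborel)"
    unfolding s_def
    by (subst emeasure_skip_vimage[OF \<alpha>], simp, intro nn_integral_cong_AE, use int in eventually_elim)
      (auto split: split_indicator)
  moreover have "?D \<inter> ?S = {}" by (auto simp: direct_set_def skip_set_def)
  ultimately have "emeasure lborel (?D \<union> ?S) = (\<integral>\<^sup>+p. ennreal (d p) \<partial>lborel) + (\<integral>\<^sup>+p. ennreal (s p) \<partial>lborel)"
    using sets_direct_vimage[of "interior B" \<alpha>] sets_skip_vimage[of "interior B" \<alpha>]
    by (subst plus_emeasure[symmetric]) auto
  also have "\<dots> = (\<integral>\<^sup>+p. ennreal (d p) + ennreal (s p) \<partial>lborel)"
    by (rule nn_integral_add[symmetric]) measurable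
  also have "\<dots> = (\<integral>\<^sup>+p. ennreal (d p + s p) \<partial>lborel)"
    by (intro nn_integral_cong ennreal_plus[symmetric]) (auto simp: d_def s_def)
  finally have E: "emeasure lborel (?D \<union> ?S) = (\<integral>\<^sup>+p. ennreal (d p + s p) \<partial>lborel)" .
  have "(LINT p:B|lborel. lambda_density \<alpha> p) = (\<integral>p. c_const \<alpha> * (d p + s p) \<partial>lborel)"
    unfolding set_lebesgue_integral_def real_scaleR_def dens ..
  also have "\<dots> = c_const \<alpha> * (\<integral>p. d p + s p \<partial>lborel)" by simp
  also have "(\<integral>p. d p + s p \<partial>lborel) = measure lborel (?D \<union> ?S)"
    unfolding measure_def E by (intro integral_eq_nn_integral) (auto simp: d_def s_def)
  finally show ?thesis .
qed

theorem theorem3p1: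
  fixes \<alpha> :: real
  assumes "1 / 2 \<le> \<alpha>" and "\<alpha> \<le> 1"
  shows "AE x \<in> {0<..<1} - \<rat> in lebesgue.
    \<forall>B. B \<in> sets borel \<and> B \<subseteq> Lambda \<alpha> \<and> frontier B \<in> null_sets lborel \<longrightarrow>
      (\<lambda>n. real (card {j \<in> {1..n}. (theta_bar \<alpha> x j, theta_bar \<alpha> x (j + 1)) \<in> B}) / real n)
        \<longlonglongrightarrow> (LINT p:B|lborel. lambda_density \<alpha> p)"
\<comment> \<open>The exceptional set is the one of \<open>gauss_generic\<close>, fixed before B is
  introduced; completion passes from \<open>lborel\<close> to \<open>lebesgue\<close>.\<close>
proof (rule AE_completion, use AE_gauss_generic in eventually_elim, intro impI allI, elim conjE)
  fix x B
  assume imp: "x \<in> {0<..<1} - \<rat> \<longrightarrow> gauss_generic x" and irr: "x \<in> {0<..<1} - \<rat>"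
    and B: "B \<in> sets borel" "B \<subseteq> Lambda \<alpha>" "frontier B \<in> null_sets lborel"
  have x: "gauss_generic x" using imp irr by blast
  let ?e = "enumerate {n. 0 < n \<and> theta x n < \<alpha>}"
  let ?b = "\<lambda>N. real (card {m. m < N \<and> 0 < m \<and> theta x m < \<alpha> \<and> next_pair \<alpha> x m \<in> B}) / real N"
  let ?a = "\<lambda>N. real (card {m. m < N \<and> 0 < m \<and> theta x m < \<alpha>}) / real N"
  let ?\<beta> = "measure lborel (direct_set \<alpha> \<inter> direct_pair -` interior B \<union> skip_set \<alpha> \<inter> skip_pair -` interior B)"
  let ?\<kappa> = "measure lborel ({p. snd p < \<alpha>} \<inter> cf_domain)"
  note count = theta_bar_pair_count[OF irr assms(1)]
  have mono: "strict_mono ?e" by (intro strict_monoI enumerate_mono count(1))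
  then have top: "filterlim ?e at_top sequentially" by (rule filterlim_subseq)
  have b: "?b \<longlonglongrightarrow> ?\<beta> / ln 2"
    using tendsto_card_drop_zero[OF theta_pair_frequency[OF x assms B(3)]] .
  have a: "?a \<longlonglongrightarrow> ?\<kappa> / ln 2"
    using tendsto_card_drop_zero[OF theta_below_frequency[OF x]] .
  have \<kappa>: "0 < ?\<kappa>" by (rule c_const_eq(2)[OF assms(1)])
  \<comment> \<open>Both frequencies are taken at N = \<open>?e n\<close>, where exactly n values
    below \<alpha> have occurred; N and ln 2 cancel in the ratio.\<close>
  have "(\<lambda>n. ?b (?e n) / ?a (?e n)) \<longlonglongrightarrow> (?\<beta> / ln 2) / (?\<kappa> / ln 2)"
    using \<kappa> by (intro tendsto_divide filterlim_compose[OF a top] filterlim_compose[OF b top]) auto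
  moreover have "(?\<beta> / ln 2) / (?\<kappa> / ln 2) = (LINT p:B|lborel. lambda_density \<alpha> p)"
    unfolding integral_lambda_density[OF assms B] c_const_eq(1)[OF assms(1)] by (simp add: field_simps)
  moreover have "eventually (\<lambda>n. ?b (?e n) / ?a (?e n)
      = real (card {j \<in> {1..n}. (theta_bar \<alpha> x j, theta_bar \<alpha> x (j + 1)) \<in> B}) / real n) sequentially"
    using eventually_gt_at_top[of 0]
  proof eventually_elim
    case (elim n)
    \<comment> \<open>Ensures that N is positive, so that it cancels.\<close>
    have "n \<le> ?e n" using mono by (rule strict_mono_imp_increasing)
    then show ?case using elim unfolding count(2,3) by simp
  qed
  ultimately show "(\<lambda>n. real (card {j \<in> {1..n}. (theta_bar \<alpha> x j, theta_bar \<alpha> x (j + 1)) \<in> B}) / real n)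
      \<longlonglongrightarrow> (LINT p:B|lborel. lambda_density \<alpha> p)"
    using tendsto_cong by fastforce
qed

end
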